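(* Let $0\le\alpha<1/4$. There exist smooth initial data $\theta_0$ on $\mathbb{R}$ such that the solution $\theta(x,t)$ of the dissipative CCF equation $$\theta_t=(H\theta)\theta_x-(-\Delta)^\alpha\theta,\qquad\theta(x,0)=\theta_0(x),\quad x\in\mathbb{R},$$ forms a singularity in finite time.
   Context: $H\theta$ is the Hilbert transform, $H\theta(x)=\mathrm{P.V.}\,\frac1\pi\int_{\mathbb{R}}\frac{\theta(y)}{x-y}\,dy$. For $\alpha=0$ the equation is understood to have no dissipative term, i.e. $\theta_t=(H\theta)\theta_x$. Forming a singularity in finite time means that the solution does not stay smooth for all times $t>0$. *)

theory Defs
  imports "HOL-Analysis.Analysis"
begin

definition hilbert_transform :: "(real \<Rightarrow> real) \<Rightarrow> real \<Rightarrow> real" where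
  "hilbert_transform f x =
     1 / pi * Lim (at_right 0) (\<lambda>\<epsilon>. LINT y:{y. \<bar>x - y\<bar> > \<epsilon>}|lborel. f y / (x - y))"

text \<open>
  The singular integral form of \<open>(-\<Delta>)\<^sup>\<alpha>\<close> on the real line, for \<open>0 < \<alpha> < 1\<close>. The constant is
  the one that makes this operator the Fourier multiplier with symbol \<open>\<bar>\<xi>\<bar> powr (2 * \<alpha>)\<close>.
\<close>

definition frac_laplacian :: "real \<Rightarrow> (real \<Rightarrow> real) \<Rightarrow> real \<Rightarrow> real" where
  "frac_laplacian \<alpha> f x =
     4 powr \<alpha> * Gamma (1 / 2 + \<alpha>) / (sqrt pi * \<bar>Gamma (- \<alpha>)\<bar>) *
     Lim (at_right 0)
       (\<lambda>\<epsilon>. LINT y:{y. \<bar>x - y\<bar> > \<epsilon>}|lborel. (f x - f y) / \<bar>x - y\<bar> powr (1 + 2 * \<alpha>))"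

text \<open>By convention the case \<open>\<alpha> = 0\<close> is the equation without dissipation (not with damping).\<close>

definition dissipation :: "real \<Rightarrow> (real \<Rightarrow> real) \<Rightarrow> real \<Rightarrow> real" where
  "dissipation \<alpha> f x = (if \<alpha> = 0 then 0 else frac_laplacian \<alpha> f x)"

text \<open>
  Smooth functions on the line with all derivatives square integrable. For such functions both
  principal values above exist at every point, and the Cauchy problem is locally well posed.
\<close>

definition smooth_Sobolev :: "(real \<Rightarrow> real) \<Rightarrow> bool" where
  "smooth_Sobolev f \<longleftrightarrow>
     (\<forall>n x. (deriv ^^ n) f differentiable (at x)) \<and>
     (\<forall>n. integrable lborel (\<lambda>x. ((deriv ^^ n) f x)\<^sup>2))"

text \<open>
  \<open>\<theta> t\<close> is the spatial profile at time \<open>t\<close>; values at \<open>t < 0\<close> are irrelevant. The third conjunct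
  is continuity in time with values in every Sobolev space \<open>H\<^sup>k\<close>. Smoothness in time is not
  imposed since it follows from the equation.
\<close>

definition global_smooth_CCF_solution ::
  "real \<Rightarrow> (real \<Rightarrow> real) \<Rightarrow> (real \<Rightarrow> real \<Rightarrow> real) \<Rightarrow> bool" where
  "global_smooth_CCF_solution \<alpha> \<theta>\<^sub>0 \<theta> \<longleftrightarrow>
     \<theta> 0 = \<theta>\<^sub>0 \<and>
     (\<forall>t\<ge>0. smooth_Sobolev (\<theta> t)) \<and>
     (\<forall>n. \<forall>t\<ge>0.
        ((\<lambda>s. LINT x|lborel. ((deriv ^^ n) (\<theta> s) x - (deriv ^^ n) (\<theta> t) x)\<^sup>2) \<longlongrightarrow> 0)
          (at t within {0..})) \<and>
     (\<forall>t>0. \<forall>x.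
        ((\<lambda>s. \<theta> s x) has_real_derivative
           hilbert_transform (\<theta> t) x * deriv (\<theta> t) x - dissipation \<alpha> (\<theta> t) x) (at t))"

definition forms_finite_time_singularity :: "real \<Rightarrow> (real \<Rightarrow> real) \<Rightarrow> bool" where
  "forms_finite_time_singularity \<alpha> \<theta>\<^sub>0 \<longleftrightarrow> \<not> (\<exists>\<theta>. global_smooth_CCF_solution \<alpha> \<theta>\<^sub>0 \<theta>)"

end

theory Submission
  imports Defs "HOL-Real_Asymp.Real_Asymp"
begin

text \<open>
  The data are \<open>K exp (- N x\<^sup>2)\<close> with \<open>K\<close> and \<open>N\<close> large. A smooth solution stays between 0 and \<open>K\<close> and
  stays even, by the maximum principle. For even \<open>f\<close> and \<open>x > 0\<close>, \<open>\<pi> H f(x)\<close> is the integral of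
  \<open>- f'(y)\<close> against \<open>ln ((x + y) / \<bar>x - y\<bar>)\<close>, a positive combination of the kernels
  \<open>(min x y / max x y)\<^sup>n\<close> with \<open>n\<close> odd. Each of these is a Green's function in \<open>ln x\<close>, so that with a weight
  \<open>\<phi>\<close> like \<open>x\<^bsup>-w\<^esup>\<close> at the origin, \<open>4 \<alpha> < w < 1\<close>, one gets \<open>\<integral> \<phi> (H f) f' \<le> - c A\<close>, where \<open>A\<close> is a weighted
  square norm of \<open>f(0) - f(x)\<close> minus its mean over \<open>(0, x)\<close>. Hence the nonlinearity makes
  the weighted mean \<open>P = \<integral> \<phi> \<theta>\<close> decrease at rate at least \<open>c A\<close>, while \<open>w > 4 \<alpha>\<close> lets \<open>\<surd>A\<close> and \<open>K\<close> control
  every dissipative term, including the decay of \<open>\<theta>(0, t)\<close>. The function \<open>Z = \<theta>(0, t) - 2 P\<close> satisfies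
  \<open>Z \<le> C \<surd>A\<close> and so \<open>Z' \<ge> c Z\<^sup>2 - C (1 + K)\<close>; for large \<open>K\<close> it exceeds \<open>K\<close> before time 1, although
  \<open>Z \<le> \<theta>(0, t) \<le> K\<close>.
\<close>

section \<open>Integration on the line\<close>

text \<open>The range \<open>\<alpha> < 1/4\<close> is what three demands on exponents leave.
  \<open>A\<close> controls the gap \<open>f 0 - f x\<close> at the scale
  \<open>x powr (w/2)\<close>, so it bounds the integral of the gap against
  \<open>x powr (- 1 - b)\<close> if \<open>2 * b < w\<close>; the dissipation at the origin is
  bounded by that integral if \<open>2 * \<alpha> \<le> b\<close>; and the weight is integrable at
  the origin if \<open>w < 1\<close>.

  The obstacle is uniformity: \<open>K\<close> is fixed before any solution is given, so the final
  inequality may contain only constants made of \<open>\<alpha>\<close>, \<open>w\<close>,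
  \<open>b\<close> and \<open>K\<close>. The regularity of the solution on \<open>[0, 1]\<close>
  yields a bound by compactness, but this bound depends on the solution. It serves only to make
  integrals converge, to justify Fubini and differentiation under the integral, to remove boundary
  terms, and to prove evenness.

  Square roots are avoided: a bound by a multiple of \<open>\<surd>A\<close> is stated as a multiple
  of \<open>l * A + 1 / l\<close> for every \<open>l > 0\<close>, and \<open>l\<close> is chosen at
  the very end. Nor is the quadratic inequality for \<open>Z\<close> integrated: above the level
  \<open>K/2\<close> it gives the constant rate \<open>K + 1\<close>, which is enough on a time
  interval of length 1.\<close>

lemma set_integrable_dominated:
  fixes f g :: "real \<Rightarrow> real"
  assumes "set_integrable lborel A g" "A \<in> sets borel" "f \<in> borel_measurable borel"
    and "\<And>x. x \<in> A \<Longrightarrow> \<bar>f x\<bar> \<le> g x"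
  shows "set_integrable lborel A f" "\<bar>LBINT x:A. f x\<bar> \<le> (LBINT x:A. g x)"
proof -
  have m: "set_borel_measurable lborel A f"
    unfolding set_borel_measurable_def using assms(2,3) by measurable
  show 1: "set_integrable lborel A f"
    by (rule set_integrable_bound[OF assms(1) m]) (use assms(4) in force)
  have "\<bar>LBINT x:A. f x\<bar> \<le> (LBINT x:A. \<bar>f x\<bar>)"
    unfolding set_lebesgue_integral_def
    using integral_abs_bound[of lborel "\<lambda>x. indicat_real A x *\<^sub>R f x"] by (simp add: abs_mult)
  also have "\<dots> \<le> (LBINT x:A. g x)"
    by (rule set_integral_mono[OF set_integrable_abs[OF 1] assms(1) assms(4)])
  finally show "\<bar>LBINT x:A. f x\<bar> \<le> (LBINT x:A. g x)" .
qed

lemma set_integrable_lborel_imp: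
  fixes f :: "real \<Rightarrow> real"
  assumes "integrable lborel f" "A \<in> sets borel"
  shows "set_integrable lborel A f"
  using assms set_integrable_subset[of lborel UNIV f A] by (simp add: set_integrable_def)

lemma set_integral_nonneg_le_integral:
  fixes f :: "real \<Rightarrow> real"
  assumes "integrable lborel f" "A \<in> sets borel" "\<And>x. f x \<ge> 0"
  shows "(LBINT x:A. f x) \<le> (LBINT x. f x)"
  unfolding set_lebesgue_integral_def
  by (rule integral_mono) (use assms set_integrable_lborel_imp[OF assms(1,2)] in
      \<open>auto simp: set_integrable_def split: split_indicator\<close>)

lemma set_integral_nonneg_mono_set:
  fixes f :: "real \<Rightarrow> real"
  assumes "set_integrable lborel B f" "A \<in> sets borel" "A \<subseteq> B" "\<And>x. x \<in> B \<Longrightarrow> f x \<ge> 0"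
  shows "(LBINT x:A. f x) \<le> (LBINT x:B. f x)"
proof -
  have "set_integrable lborel A f" using set_integrable_subset[OF assms(1)] assms by auto
  thus ?thesis using assms unfolding set_lebesgue_integral_def set_integrable_def
    by (intro integral_mono) (auto split: split_indicator)
qed

lemma set_integral_nonneg':
  fixes f :: "real \<Rightarrow> real"
  assumes "\<And>x. x \<in> A \<Longrightarrow> f x \<ge> 0"
  shows "(LBINT x:A. f x) \<ge> 0"
  unfolding set_lebesgue_integral_def using assms by (intro integral_nonneg_AE) (auto split: split_indicator)

lemma
  fixes a c :: real
  assumes "a > -1" "c > 0"
  shows set_integrable_powr_from_0: "set_integrable lborel {0<..<c} (\<lambda>x. x powr a)"
    and set_integral_powr_from_0: "(LBINT x:{0<..<c}. x powr a) = c powr (a+1) / (a+1)"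
proof -
  let ?F = "\<lambda>x. x powr (a+1) / (a+1)"
  have 1: "(?F \<longlongrightarrow> 0) (at_right 0)" using assms by real_asymp
  have 2: "(?F \<longlongrightarrow> c powr (a+1) / (a+1)) (at_left c)"
    using assms by (intro tendsto_intros) auto
  have lim1: "((?F \<circ> real_of_ereal) \<longlongrightarrow> 0) (at_right (ereal 0))"
    unfolding comp_def at_right_ereal filterlim_filtermap using 1 by simp
  have lim2: "((?F \<circ> real_of_ereal) \<longlongrightarrow> c powr (a+1) / (a+1)) (at_left (ereal c))"
    unfolding comp_def at_left_ereal filterlim_filtermap using 2 by simp
  have d: "(?F has_real_derivative x powr a) (at x)" if "x > 0" for x
    using that assms by (auto intro!: derivative_eq_intros simp: divide_simps)
  have e: "einterval (ereal 0) (ereal c) = {0<..<c}" by (rule einterval_eq(1))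
  note FTC = interval_integral_FTC_nonneg[of "ereal 0" "ereal c" ?F "\<lambda>x. x powr a", OF _ _ _ _ lim1 lim2]
  show "set_integrable lborel {0<..<c} (\<lambda>x. x powr a)"
    unfolding e[symmetric] using assms by (intro FTC(1) d) (auto intro!: continuous_intros)
  have "(LBINT x=ereal 0..ereal c. x powr a) = c powr (a+1) / (a+1) - 0"
    using assms by (intro FTC(2) d) (auto intro!: continuous_intros)
  thus "(LBINT x:{0<..<c}. x powr a) = c powr (a+1) / (a+1)"
    using assms by (simp add: interval_lebesgue_integral_def e)
qed

lemma
  fixes a c :: real
  assumes "a < -1" "c > 0"
  shows set_integrable_powr_at_top: "set_integrable lborel {c<..} (\<lambda>x. x powr a)"
    and set_integral_powr_at_top: "(LBINT x:{c<..}. x powr a) = c powr (a+1) / (-a-1)"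
proof -
  let ?F = "\<lambda>x. x powr (a+1) / (a+1)"
  have 1: "(?F \<longlongrightarrow> 0) at_top" using assms by real_asymp
  have 2: "(?F \<longlongrightarrow> c powr (a+1) / (a+1)) (at_right c)"
    using assms by (intro tendsto_intros) auto
  have lim1: "((?F \<circ> real_of_ereal) \<longlongrightarrow> 0) (at_left \<infinity>)"
    unfolding comp_def at_left_PInf filterlim_filtermap using 1 by simp
  have lim2: "((?F \<circ> real_of_ereal) \<longlongrightarrow> c powr (a+1) / (a+1)) (at_right (ereal c))"
    unfolding comp_def at_right_ereal filterlim_filtermap using 2 by simp
  have d: "(?F has_real_derivative x powr a) (at x)" if "x > 0" for x
    using that assms by (auto intro!: derivative_eq_intros simp: divide_simps)
  have e: "einterval (ereal c) \<infinity> = {c<..}" by (rule einterval_eq)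
  note FTC = interval_integral_FTC_nonneg[of "ereal c" \<infinity> ?F "\<lambda>x. x powr a", OF _ _ _ _ lim2 lim1]
  show "set_integrable lborel {c<..} (\<lambda>x. x powr a)"
    unfolding e[symmetric] using assms by (intro FTC(1) d) (auto intro!: continuous_intros)
  have "(LBINT x=ereal c..\<infinity>. x powr a) = 0 - c powr (a+1) / (a+1)"
    using assms by (intro FTC(2) d) (auto intro!: continuous_intros)
  thus "(LBINT x:{c<..}. x powr a) = c powr (a+1) / (-a-1)"
    using assms by (simp add: interval_lebesgue_integral_def e field_simps)
qed

lemma set_integral_FTC:
  fixes F f :: "real \<Rightarrow> real"
  assumes "a \<le> b" "\<And>x. a \<le> x \<Longrightarrow> x \<le> b \<Longrightarrow> (F has_real_derivative f x) (at x)"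
    "continuous_on {a..b} f"
  shows "(LBINT x:{a..b}. f x) = F b - F a"
  unfolding set_lebesgue_integral_def
  by (rule integral_FTC_atLeastAtMost[OF assms(1) _ assms(3)])
    (use assms(2) in \<open>auto simp: has_real_derivative_iff_has_vector_derivative intro: has_vector_derivative_at_within\<close>)

section \<open>Pointwise bounds and decay from square integrability\<close>

text \<open>On \<open>[x, x+1]\<close> the function \<open>g\<^sup>2\<close> varies by at most the
  integral of \<open>\<bar>2 * g * g'\<bar> \<le> g\<^sup>2 + g'\<^sup>2\<close>; averaging over the
  second endpoint removes the value of \<open>g\<close> there. The local window is kept because it
  yields decay at infinity as well as the sup bound.\<close>

lemma Sobolev_sup_bound_local:
  fixes g g' :: "real \<Rightarrow> real"
  assumes d: "\<And>x. (g has_real_derivative g' x) (at x)" and c: "continuous_on UNIV g'"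
  shows "(g x)\<^sup>2 \<le> (LBINT y:{x..x+1}. 2 * (g y)\<^sup>2 + (g' y)\<^sup>2)"
proof -
  have cg: "continuous_on UNIV g"
    using d by (meson DERIV_isCont continuous_at_imp_continuous_on)
  have cc: "continuous_on A g" "continuous_on A g'" for A
    using cg c continuous_on_subset by blast+
  have int1: "set_integrable lborel {x..x+1} (\<lambda>y. (g y)\<^sup>2)" "set_integrable lborel {x..x+1} (\<lambda>y. (g' y)\<^sup>2)"
    "set_integrable lborel {x..x+1} (\<lambda>y. (g y)\<^sup>2 + (g' y)\<^sup>2)"
    by (intro borel_integrable_atLeastAtMost' continuous_intros cc)+
  define J where "J = (LBINT y:{x..x+1}. (g y)\<^sup>2 + (g' y)\<^sup>2)"
  have *: "(g x)\<^sup>2 - J \<le> (g z)\<^sup>2" if z: "z \<in> {x..x+1}" for z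
  proof -
    have "(LBINT y:{x..z}. 2 * g y * g' y) = (g z)\<^sup>2 - (g x)\<^sup>2"
      using z by (intro set_integral_FTC continuous_intros cc) (auto intro!: derivative_eq_intros d)
    moreover have "(LBINT y:{x..z}. - ((g y)\<^sup>2 + (g' y)\<^sup>2)) \<le> (LBINT y:{x..z}. 2 * g y * g' y)"
    proof (intro set_integral_mono borel_integrable_atLeastAtMost' continuous_intros cc)
      fix y show "- ((g y)\<^sup>2 + (g' y)\<^sup>2) \<le> 2 * g y * g' y"
        using zero_le_power2[of "g y + g' y"] by (simp add: power2_eq_square algebra_simps)
    qed
    moreover have "(LBINT y:{x..z}. ((g y)\<^sup>2 + (g' y)\<^sup>2)) \<le> J"
      unfolding J_def using z by (intro set_integral_nonneg_mono_set int1) auto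
    moreover have "(LBINT y:{x..z}. - ((g y)\<^sup>2 + (g' y)\<^sup>2)) = - (LBINT y:{x..z}. ((g y)\<^sup>2 + (g' y)\<^sup>2))"
      by (intro set_integral_uminus borel_integrable_atLeastAtMost' continuous_intros cc)
    ultimately show ?thesis by linarith
  qed
  have "(LBINT z:{x..x+1}. (g x)\<^sup>2 - J) \<le> (LBINT z:{x..x+1}. (g z)\<^sup>2)"
    by (intro set_integral_mono int1 *) (auto intro!: borel_integrable_atLeastAtMost')
  moreover have "(LBINT z:{x..x+1}. (g x)\<^sup>2 - J) = (g x)\<^sup>2 - J"
    by (simp add: set_lebesgue_integral_def)
  moreover have "(LBINT y:{x..x+1}. 2 * (g y)\<^sup>2 + (g' y)\<^sup>2) = (LBINT z:{x..x+1}. (g z)\<^sup>2) + J"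
    unfolding J_def by (subst set_integral_add(2)[symmetric, OF int1(1,3)]) (simp add: algebra_simps)
  ultimately show ?thesis by linarith
qed

lemma Sobolev_sup_bound:
  fixes g g' :: "real \<Rightarrow> real"
  assumes d: "\<And>x. (g has_real_derivative g' x) (at x)" and c: "continuous_on UNIV g'"
    and i: "integrable lborel (\<lambda>x. (g x)\<^sup>2)" "integrable lborel (\<lambda>x. (g' x)\<^sup>2)"
  shows "(g x)\<^sup>2 \<le> 2 * (LBINT y. (g y)\<^sup>2) + (LBINT y. (g' y)\<^sup>2)"
proof -
  have "(g x)\<^sup>2 \<le> (LBINT y:{x..x+1}. 2 * (g y)\<^sup>2 + (g' y)\<^sup>2)"
    by (rule Sobolev_sup_bound_local[OF d c])
  also have "\<dots> \<le> (LBINT y. 2 * (g y)\<^sup>2 + (g' y)\<^sup>2)"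
    by (intro set_integral_nonneg_le_integral) (use i in auto)
  finally show ?thesis using i by simp
qed

text \<open>The local bound is the integral of a fixed integrable function over a window that
  escapes to infinity, so it tends to 0 by dominated convergence.\<close>

lemma Sobolev_vanishes_at_infinity:
  fixes g g' :: "real \<Rightarrow> real"
  assumes d: "\<And>x. (g has_real_derivative g' x) (at x)" and c: "continuous_on UNIV g'"
    and i: "integrable lborel (\<lambda>x. (g x)\<^sup>2)" "integrable lborel (\<lambda>x. (g' x)\<^sup>2)"
    and e: "e > 0"
  shows "\<exists>R. \<forall>x. \<bar>x\<bar> > R \<longrightarrow> \<bar>g x\<bar> < e"
proof -
  define h where "h = (\<lambda>y. 2 * (g y)\<^sup>2 + (g' y)\<^sup>2)"
  have h: "integrable lborel h" unfolding h_def using i by simp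
  have lim: "((\<lambda>x. LBINT y:{x..x+1}. h y) \<longlongrightarrow> 0) F" if F: "F = at_top \<or> F = at_bot" for F
  proof -
    have sq: "(\<lambda>n. LBINT y:{X n..X n+1}. h y) \<longlonglongrightarrow> 0"
      if X: "filterlim X at_top sequentially \<or> filterlim X at_bot sequentially" for X
    proof -
      have "(\<lambda>n. LBINT y:{X n..X n+1}. h y) \<longlonglongrightarrow> (LBINT (y::real). (0::real))"
        unfolding set_lebesgue_integral_def
      proof (rule integral_dominated_convergence[where w="\<lambda>y. \<bar>h y\<bar>"])
        show "AE y in lborel. (\<lambda>n. indicator {X n..X n+1} y *\<^sub>R h y) \<longlonglongrightarrow> 0"
        proof
          fix y
          have "eventually (\<lambda>n. y \<notin> {X n..X n+1}) sequentially"
            using X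
          proof
            assume "filterlim X at_top sequentially"
            hence "eventually (\<lambda>n. X n > y) sequentially" by (simp add: filterlim_at_top_dense)
            thus ?thesis by eventually_elim auto
          next
            assume "filterlim X at_bot sequentially"
            hence "eventually (\<lambda>n. X n < y - 1) sequentially" by (simp add: filterlim_at_bot_dense)
            thus ?thesis by eventually_elim auto
          qed
          thus "(\<lambda>n. indicator {X n..X n+1} y *\<^sub>R h y) \<longlonglongrightarrow> 0"
            by (intro tendsto_eventually) (auto elim!: eventually_mono)
        qed
      qed (use h in \<open>auto split: split_indicator\<close>)
      thus ?thesis by simp
    qed
    show ?thesis using F
    proof
      assume "F = at_top" thus ?thesis using sq by (auto intro!: tendsto_at_topI_sequentially)
    next
      assume F: "F = at_bot"
      show ?thesis unfolding F at_bot_mirror filterlim_filtermap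
        by (rule tendsto_at_topI_sequentially, rule sq)
          (simp add: filterlim_uminus_at_bot)
    qed
  qed
  have e2: "e\<^sup>2 > 0" using e by simp
  obtain R1 where R1: "\<And>x. x \<ge> R1 \<Longrightarrow> (LBINT y:{x..x+1}. h y) < e\<^sup>2"
    using order_tendstoD(2)[OF lim e2, of at_top] by (auto simp: eventually_at_top_linorder)
  obtain R2 where R2: "\<And>x. x \<le> R2 \<Longrightarrow> (LBINT y:{x..x+1}. h y) < e\<^sup>2"
    using order_tendstoD(2)[OF lim e2, of at_bot] by (auto simp: eventually_at_bot_linorder)
  show ?thesis
  proof (intro exI allI impI)
    fix x assume x: "\<bar>x\<bar> > \<bar>R1\<bar> + \<bar>R2\<bar>"
    hence "(LBINT y:{x..x+1}. h y) < e\<^sup>2" using R1[of x] R2[of x] by linarith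
    hence "(g x)\<^sup>2 < e\<^sup>2" using Sobolev_sup_bound_local[OF d c, of x] by (simp add: h_def)
    thus "\<bar>g x\<bar> < e" using e by (metis abs_less_iff power2_less_imp_less power2_abs less_eq_real_def abs_ge_zero)
  qed
qed

lemma smooth_Sobolev_deriv:
  assumes "smooth_Sobolev f"
  shows "((deriv ^^ n) f has_real_derivative (deriv ^^ Suc n) f x) (at x)"
    "continuous_on A ((deriv ^^ n) f)" "(deriv ^^ n) f \<in> borel_measurable borel"
    "integrable lborel (\<lambda>x. ((deriv ^^ n) f x)\<^sup>2)"
proof -
  have "\<forall>n x. (deriv ^^ n) f differentiable (at x)" using assms by (simp add: smooth_Sobolev_def)
  hence d: "((deriv ^^ n) f has_real_derivative (deriv ^^ Suc n) f x) (at x)" for n x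
    by (simp add: DERIV_deriv_iff_real_differentiable)
  show "((deriv ^^ n) f has_real_derivative (deriv ^^ Suc n) f x) (at x)" by (rule d)
  have c: "continuous_on UNIV ((deriv ^^ n) f)"
    using d by (meson DERIV_isCont continuous_at_imp_continuous_on)
  thus "continuous_on A ((deriv ^^ n) f)" using continuous_on_subset by blast
  show "(deriv ^^ n) f \<in> borel_measurable borel"
    by (rule borel_measurable_continuous_onI[OF c])
  show "integrable lborel (\<lambda>x. ((deriv ^^ n) f x)\<^sup>2)" using assms by (simp add: smooth_Sobolev_def)
qed

section \<open>The Hilbert transform and the fractional Laplacian\<close>

text \<open>A class on which both singular integrals converge absolutely once they are written with
  differences. One constant \<open>M\<close> carries the bounds that have to be uniform in time. The
  square integral of the derivative is only required to be finite: it is used at one fixed time, in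
  majorants and vanishing boundary terms.\<close>

definition tame :: "real \<Rightarrow> (real \<Rightarrow> real) \<Rightarrow> bool" where
  "tame M f \<longleftrightarrow> (\<forall>x. (f has_real_derivative deriv f x) (at x)) \<and> continuous_on UNIV (deriv f) \<and>
     (\<forall>x. \<bar>f x\<bar> \<le> M) \<and> (\<forall>x. \<bar>deriv f x\<bar> \<le> M) \<and>
     integrable lborel (\<lambda>x. (f x)\<^sup>2) \<and> (LBINT x. (f x)\<^sup>2) \<le> M \<and>
     integrable lborel (\<lambda>x. (deriv f x)\<^sup>2)"

lemma lipschitz_of_deriv_bound:
  fixes f f' :: "real \<Rightarrow> real"
  assumes "\<And>x. (f has_real_derivative f' x) (at x)" "\<And>x. \<bar>f' x\<bar> \<le> M"
  shows "\<bar>f x - f y\<bar> \<le> M * \<bar>x - y\<bar>"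
  using field_differentiable_bound[of UNIV f f' M x y] assms
  by (auto simp: has_field_derivative_at_within)

lemma tameD:
  assumes "tame M f"
  shows "(f has_real_derivative deriv f x) (at x)" "continuous_on A (deriv f)" "continuous_on A f"
    "\<bar>f x\<bar> \<le> M" "\<bar>deriv f x\<bar> \<le> M"
    "integrable lborel (\<lambda>x. (f x)\<^sup>2)" "(LBINT x. (f x)\<^sup>2) \<le> M"
    "integrable lborel (\<lambda>x. (deriv f x)\<^sup>2)" "\<bar>f x - f y\<bar> \<le> M * \<bar>x - y\<bar>"
    "f \<in> borel_measurable borel" "deriv f \<in> borel_measurable borel" "M \<ge> 0"
proof -
  note a = assms[unfolded tame_def]
  show "(f has_real_derivative deriv f x) (at x)" using a by blast
  have c: "continuous_on UNIV f" using a by (meson DERIV_isCont continuous_at_imp_continuous_on)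
  thus "continuous_on A f" using continuous_on_subset by blast
  show "continuous_on A (deriv f)" using a continuous_on_subset by blast
  show "\<bar>f x\<bar> \<le> M" "\<bar>deriv f x\<bar> \<le> M"
    "integrable lborel (\<lambda>x. (f x)\<^sup>2)" "(LBINT x. (f x)\<^sup>2) \<le> M"
    "integrable lborel (\<lambda>x. (deriv f x)\<^sup>2)" using a by auto
  show "\<bar>f x - f y\<bar> \<le> M * \<bar>x - y\<bar>" using a by (intro lipschitz_of_deriv_bound[of f "deriv f"]) auto
  show "f \<in> borel_measurable borel" "deriv f \<in> borel_measurable borel"
    using c a by (auto intro!: borel_measurable_continuous_onI)
  show "M \<ge> 0" using \<open>\<bar>f x\<bar> \<le> M\<close> by linarith
qed

lemma set_integral_symmetric_split:
  fixes q :: "real \<Rightarrow> real"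
  assumes "set_integrable lborel {e<..} (\<lambda>z. q (x - z))" "set_integrable lborel {e<..} (\<lambda>z. q (x + z))" "e \<ge> 0"
  shows "(LBINT y:{y. \<bar>x - y\<bar> > e}. q y) = (LBINT z:{e<..}. q (x - z) + q (x + z))"
proof -
  have i1: "has_bochner_integral lborel (\<lambda>z. indicat_real {e<..} z *\<^sub>R q (x - z)) (LBINT z:{e<..}. q (x - z))"
    using assms(1) unfolding set_integrable_def set_lebesgue_integral_def by (rule has_bochner_integral_integrable)
  have i2: "has_bochner_integral lborel (\<lambda>z. indicat_real {e<..} z *\<^sub>R q (x + z)) (LBINT z:{e<..}. q (x + z))"
    using assms(2) unfolding set_integrable_def set_lebesgue_integral_def by (rule has_bochner_integral_integrable)
  have j1: "has_bochner_integral lborel (\<lambda>y. indicat_real {e<..} (x - y) *\<^sub>R q y) (LBINT z:{e<..}. q (x - z))"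
    using lborel_has_bochner_integral_real_affine_iff[of "-1" "\<lambda>z. indicat_real {e<..} z *\<^sub>R q (x - z)" _ x] i1 by simp
  have j2: "has_bochner_integral lborel (\<lambda>y. indicat_real {e<..} (y - x) *\<^sub>R q y) (LBINT z:{e<..}. q (x + z))"
    using lborel_has_bochner_integral_real_affine_iff[of "1" "\<lambda>z. indicat_real {e<..} z *\<^sub>R q (x + z)" _ "-x"] i2 by simp
  have "has_bochner_integral lborel (\<lambda>y. indicat_real {e<..} (x - y) *\<^sub>R q y + indicat_real {e<..} (y - x) *\<^sub>R q y)
     ((LBINT z:{e<..}. q (x - z)) + (LBINT z:{e<..}. q (x + z)))"
    by (rule has_bochner_integral_add[OF j1 j2])
  also have "(\<lambda>y. indicat_real {e<..} (x - y) *\<^sub>R q y + indicat_real {e<..} (y - x) *\<^sub>R q y) =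
     (\<lambda>y. indicat_real {y. \<bar>x - y\<bar> > e} y *\<^sub>R q y)"
    using assms(3) by (auto simp: fun_eq_iff indicator_def)
  finally have "(LBINT y:{y. \<bar>x - y\<bar> > e}. q y) = (LBINT z:{e<..}. q (x - z)) + (LBINT z:{e<..}. q (x + z))"
    unfolding set_lebesgue_integral_def by (rule has_bochner_integral_integral_eq)
  also have "\<dots> = (LBINT z:{e<..}. q (x - z) + q (x + z))"
    using assms by simp
  finally show ?thesis .
qed

text \<open>Serves for both principal values and for exhausting the half line by
  \<open>[e, 1/e]\<close>. The point \<open>p\<close> is one that the sets \<open>S e\<close> may
  never reach, such as the centre of a principal value.\<close>

lemma tendsto_set_integral_at_right_0:
  fixes h :: "real \<Rightarrow> real" and S :: "real \<Rightarrow> real set"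
  assumes h: "set_integrable lborel A h" and A: "A \<in> sets borel"
    and S: "\<And>e. S e \<in> sets borel" "\<And>e. S e \<subseteq> A" "\<And>z. z \<in> A \<Longrightarrow> z \<noteq> p \<Longrightarrow> \<exists>d>0. \<forall>e. 0 < e \<and> e < d \<longrightarrow> z \<in> S e"
  shows "((\<lambda>e. LBINT z:S e. h z) \<longlongrightarrow> (LBINT z:A. h z)) (at_right 0)"
proof (rule tendsto_at_right_sequentially[of _ 1])
  fix X :: "nat \<Rightarrow> real"
  assume X: "\<And>n. 0 < X n" "X \<longlonglongrightarrow> 0"
  have int: "set_integrable lborel (S e) h" for e
    using S by (intro set_integrable_subset[OF h]) auto
  show "(\<lambda>n. LBINT z:S (X n). h z) \<longlonglongrightarrow> (LBINT z:A. h z)"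
    unfolding set_lebesgue_integral_def
  proof (rule integral_dominated_convergence[where w="\<lambda>z. norm (indicat_real A z *\<^sub>R h z)"])
    show "AE z in lborel. (\<lambda>n. indicat_real (S (X n)) z *\<^sub>R h z) \<longlonglongrightarrow> indicat_real A z *\<^sub>R h z"
      using AE_lborel_singleton[of p]
    proof eventually_elim
      case (elim z)
      show ?case
      proof (cases "z \<in> A")
        case True
        then obtain d where d: "d > 0" "\<And>e. 0 < e \<Longrightarrow> e < d \<Longrightarrow> z \<in> S e" using S(3)[OF True elim] by blast
        have "eventually (\<lambda>n. X n < d) sequentially" using order_tendstoD(2)[OF X(2) d(1)] .
        hence "eventually (\<lambda>n. z \<in> S (X n)) sequentially" by eventually_elim (use X d in auto)
        hence "eventually (\<lambda>n. indicat_real (S (X n)) z *\<^sub>R h z = indicat_real A z *\<^sub>R h z) sequentially"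
          by eventually_elim (use True in simp)
        thus ?thesis by (rule tendsto_eventually)
      next
        case False
        hence "z \<notin> S e" for e using S(2) by blast
        thus ?thesis using False by simp
      qed
    qed
    fix n show "AE z in lborel. norm (indicat_real (S (X n)) z *\<^sub>R h z) \<le> norm (indicat_real A z *\<^sub>R h z)"
      using S(2) by (auto split: split_indicator)
  qed (use int h in \<open>auto simp: set_integrable_def\<close>)
qed simp

text \<open>Young's inequality with a free weight replaces Cauchy-Schwarz throughout, so that no
  square root of an integral appears.\<close>

lemma amgm_divide:
  fixes a b l :: real
  assumes "l > 0"
  shows "\<bar>a * b\<bar> \<le> (l * a\<^sup>2 + b\<^sup>2 / l) / 2"
proof -
  have "0 \<le> (l * \<bar>a\<bar> - \<bar>b\<bar>)\<^sup>2" by simp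
  hence "2 * l * (\<bar>a\<bar> * \<bar>b\<bar>) \<le> l\<^sup>2 * a\<^sup>2 + b\<^sup>2" by (simp add: power2_eq_square algebra_simps)
  thus ?thesis using assms by (simp add: field_simps abs_mult power2_eq_square)
qed

lemma abs_mult_le_squares: "\<bar>a * b\<bar> \<le> a\<^sup>2 + b\<^sup>2" for a b :: real
proof -
  have "\<bar>a * b\<bar> \<le> (1 * a\<^sup>2 + b\<^sup>2 / 1) / 2" by (rule amgm_divide) auto
  also have "\<dots> \<le> a\<^sup>2 + b\<^sup>2" by simp
  finally show ?thesis .
qed

text \<open>The Lipschitz bound is used near 0, the sup bound in the middle, where
  \<open>1 / z\<close> integrates to a logarithm, and square integrability in the tail. With
  \<open>l = 0\<close> this is a plain bound for the Hilbert transform; with \<open>h\<close> of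
  size \<open>exp (-l)\<close> it is the bound of order \<open>h * ln (1 / h)\<close> behind the
  Osgood argument.\<close>

lemma odd_difference_integral:
  fixes a b :: "real \<Rightarrow> real"
  assumes m: "a \<in> borel_measurable borel" "b \<in> borel_measurable borel"
    and i: "integrable lborel (\<lambda>z. (a z)\<^sup>2)" "integrable lborel (\<lambda>z. (b z)\<^sup>2)"
    and Q: "(LBINT z. (a z)\<^sup>2) \<le> Q" "(LBINT z. (b z)\<^sup>2) \<le> Q"
    and lip: "\<And>z. z > 0 \<Longrightarrow> \<bar>a z - b z\<bar> \<le> 2 * M * z"
    and sup: "\<And>z. z > 0 \<Longrightarrow> \<bar>a z\<bar> \<le> h" "\<And>z. z > 0 \<Longrightarrow> \<bar>b z\<bar> \<le> h"
    and l: "l \<ge> 0"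
  shows "set_integrable lborel {0<..} (\<lambda>z. (a z - b z) / z)"
    "\<bar>LBINT z:{0<..}. (a z - b z) / z\<bar> \<le> (2 * M + 2 * Q + 1) * exp (-l) + 6 * h * l"
proof -
  define p where "p = exp (-l)"
  \<comment> \<open>The tail decays only like \<open>q powr (-1/2)\<close>; this \<open>q\<close>
    makes it as small as the inner part, of size \<open>p\<close>. The middle then contributes
    \<open>2 * h * (ln q - ln p) = 6 * h * l\<close>.\<close>
  define q where "q = exp (2*l)"
  have pq: "0 < p" "p \<le> q" "0 < q" unfolding p_def q_def using l by auto
  have q2: "1 / q = p\<^sup>2" unfolding p_def q_def
    by (simp add: power2_eq_square exp_minus field_simps flip: exp_add)
  let ?d = "\<lambda>z. (a z - b z) / z"
  have md: "?d \<in> borel_measurable borel" using m by measurable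
  have i1: "set_integrable lborel {0<..<p} (\<lambda>z. 2 * M)"
    unfolding set_integrable_def using pq by (auto intro!: integrable_real_indicator)
  have b1: "\<bar>?d z\<bar> \<le> 2 * M" if "z \<in> {0<..<p}" for z using lip[of z] that by (simp add: field_simps abs_divide)
  note I1 = set_integrable_dominated(1)[OF i1 _ md b1, simplified]
  have v1: "(LBINT z:{0<..<p}. 2 * M) = 2 * M * p" using pq by (simp add: set_lebesgue_integral_def)
  have i2: "set_integrable lborel {p..q} (\<lambda>z. 2 * h * (1 / z))"
    using pq by (intro borel_integrable_atLeastAtMost' continuous_intros) auto
  have b2: "\<bar>?d z\<bar> \<le> 2 * h * (1 / z)" if "z \<in> {p..q}" for z using sup[of z] that pq
    by (auto simp: field_simps abs_divide)
  note I2 = set_integrable_dominated(1)[OF i2 _ md b2, simplified]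
  have "(LBINT z:{p..q}. 2 * h * (1/z)) = 2 * h * ln q - 2 * h * ln p"
    using pq by (intro set_integral_FTC continuous_intros) (auto intro!: derivative_eq_intros)
  hence v2: "(LBINT z:{p..q}. 2 * h * (1/z)) = 6 * h * l" unfolding p_def q_def using l by simp
  let ?g = "\<lambda>z. p * ((a z)\<^sup>2 + (b z)\<^sup>2) + (1/(2*p)) * z powr (-2)"
  have i30: "set_integrable lborel {q<..} (\<lambda>z. z powr (-2))"
    using pq by (intro set_integrable_powr_at_top) auto
  have i3a: "set_integrable lborel {q<..} (\<lambda>z. p * ((a z)\<^sup>2 + (b z)\<^sup>2))"
    by (intro set_integrable_lborel_imp integrable_mult_right Bochner_Integration.integrable_add i) auto
  have i3: "set_integrable lborel {q<..} ?g"
    by (rule set_integral_add(1)[OF i3a set_integrable_mult_right[OF i30]])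
  have b3: "\<bar>?d z\<bar> \<le> ?g z" if "z \<in> {q<..}" for z
  proof -
    have z: "z > 0" using that pq by simp
    have "\<bar>(a z - b z) * (1/z)\<bar> \<le> (p * (a z - b z)\<^sup>2 + (1/z)\<^sup>2 / p) / 2" by (rule amgm_divide) (use pq in auto)
    also have "(a z - b z)\<^sup>2 \<le> 2 * ((a z)\<^sup>2 + (b z)\<^sup>2)"
      using zero_le_power2[of "a z + b z"] by (simp add: power2_eq_square algebra_simps)
    also have "(p * (2 * ((a z)\<^sup>2 + (b z)\<^sup>2)) + (1/z)\<^sup>2 / p) / 2 = ?g z"
      using z pq by (simp add: powr_minus powr_numeral field_simps)
    finally show ?thesis using pq by simp
  qed
  note I3 = set_integrable_dominated(1)[OF i3 _ md b3, simplified]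
  have v3: "(LBINT z:{q<..}. ?g z) \<le> 2 * Q * p + p"
  proof -
    have "(LBINT z:{q<..}. ?g z) = (LBINT z:{q<..}. p * ((a z)\<^sup>2 + (b z)\<^sup>2)) + (1/(2*p)) * (LBINT z:{q<..}. z powr (-2))"
      by (subst set_integral_add(2)[OF i3a set_integrable_mult_right[OF i30]]) simp
    also have "(LBINT z:{q<..}. z powr (-2)) = p\<^sup>2"
      using set_integral_powr_at_top[of "-2" q] pq q2 by simp
    also have "(LBINT z:{q<..}. p * ((a z)\<^sup>2 + (b z)\<^sup>2)) \<le> (LBINT z. p * ((a z)\<^sup>2 + (b z)\<^sup>2))"
      using i pq by (intro set_integral_nonneg_le_integral) auto
    also have "\<dots> = p * ((LBINT z. (a z)\<^sup>2) + (LBINT z. (b z)\<^sup>2))" using i by simp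
    also have "\<dots> \<le> p * (Q + Q)" using Q pq by (intro mult_left_mono add_mono) auto
    also have "p * (Q + Q) + (1/(2*p)) * p\<^sup>2 \<le> 2 * Q * p + p" using pq by (simp add: power2_eq_square algebra_simps)
    finally show ?thesis by simp
  qed
  have U: "{0<..} = ({0<..<p} \<union> {p..q}) \<union> {q<..}" using pq by auto
  have J12: "set_integrable lborel ({0<..<p} \<union> {p..q}) ?d"
    by (intro set_integrable_Un I1 I2) auto
  show "set_integrable lborel {0<..} ?d" unfolding U
    by (intro set_integrable_Un J12 I3) auto
  have "(LBINT z:{0<..}. ?d z) = (LBINT z:{0<..<p}. ?d z) + (LBINT z:{p..q}. ?d z) + (LBINT z:{q<..}. ?d z)"
    unfolding U using pq
    apply (subst set_integral_Un[OF _ J12 I3])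
     apply force
    apply (subst set_integral_Un[OF _ I1 I2])
     apply auto
    done
  moreover have "\<bar>LBINT z:{0<..<p}. ?d z\<bar> \<le> 2 * M * p"
    unfolding v1[symmetric] by (rule set_integrable_dominated(2)[OF i1 _ md b1]) auto
  moreover have "\<bar>LBINT z:{p..q}. ?d z\<bar> \<le> 6 * h * l"
    unfolding v2[symmetric] by (rule set_integrable_dominated(2)[OF i2 _ md b2]) auto
  moreover have "\<bar>LBINT z:{q<..}. ?d z\<bar> \<le> 2 * Q * p + p"
    by (rule order_trans[OF set_integrable_dominated(2)[OF i3 _ md b3] v3]) auto
  moreover have "(2 * M + 2 * Q + 1) * exp (-l) = 2 * M * p + (2 * Q * p + p)"
    unfolding p_def by (simp add: algebra_simps)
  ultimately show "\<bar>LBINT z:{0<..}. ?d z\<bar> \<le> (2 * M + 2 * Q + 1) * exp (-l) + 6 * h * l"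
    by linarith
qed

lemma square_integrable_affine:
  fixes f :: "real \<Rightarrow> real"
  assumes "integrable lborel (\<lambda>z. (f z)\<^sup>2)" "c = 1 \<or> c = -1"
  shows "integrable lborel (\<lambda>z. (f (x + c * z))\<^sup>2)" "(LBINT z. (f (x + c * z))\<^sup>2) = (LBINT z. (f z)\<^sup>2)"
  using assms lborel_integrable_real_affine[of "\<lambda>z. (f z)\<^sup>2" c x]
    lborel_integral_real_affine[of c "\<lambda>z. (f z)\<^sup>2" x] by auto

lemma tame_shift_square:
  assumes "tame M f"
  shows "integrable lborel (\<lambda>z. (f (x + z))\<^sup>2)" "integrable lborel (\<lambda>z. (f (x - z))\<^sup>2)"
    "(LBINT z. (f (x + z))\<^sup>2) \<le> M" "(LBINT z. (f (x - z))\<^sup>2) \<le> M"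
  using square_integrable_affine[of f 1 x] square_integrable_affine[of f "-1" x] tameD(6,7)[OF assms] by auto

text \<open>Folding the integral about \<open>x\<close> turns the numerator into a difference that
  is Lipschitz in \<open>z\<close>. The integral becomes absolutely convergent, and the
  \<open>Lim\<close> in the definition is an actual limit.\<close>

lemma hilbert_transform_tame:
  assumes t: "tame M f"
  shows "set_integrable lborel {0<..} (\<lambda>z. (f (x - z) - f (x + z)) / z)" (is ?A)
    "hilbert_transform f x = 1 / pi * (LBINT z:{0<..}. (f (x - z) - f (x + z)) / z)"
    "\<bar>hilbert_transform f x\<bar> \<le> 4 * M + 1"
proof -
  note tD = tameD[OF t]
  have [measurable]: "f \<in> borel_measurable borel" by (rule tD)
  have lip: "\<bar>f (x - z) - f (x + z)\<bar> \<le> 2 * M * z" if "z > 0" for z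
    using tD(9)[of "x - z" "x + z"] that by simp
  note O = odd_difference_integral[OF _ _ tame_shift_square(2,1)[OF t] tame_shift_square(4,3)[OF t] lip tD(4) tD(4)]
  show A: ?A by (rule O(1)[where l=0]) auto
  have eq: "(LBINT y:{y. \<bar>x - y\<bar> > e}. f y / (x - y)) = (LBINT z:{e<..}. (f (x - z) - f (x + z)) / z)"
    if e: "e > 0" for e
  proof -
    have i: "set_integrable lborel {e<..} (\<lambda>z. (g z)\<^sup>2 + z powr (-2))" if "integrable lborel (\<lambda>z. (g z)\<^sup>2)" for g :: "real \<Rightarrow> real"
      using e by (intro set_integral_add set_integrable_lborel_imp set_integrable_powr_at_top that) auto
    have b: "\<bar>g z / z\<bar> \<le> (g z)\<^sup>2 + z powr (-2)" if z: "z \<in> {e<..}" for g :: "real \<Rightarrow> real" and z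
    proof -
      have z0: "z > 0" using z e by simp
      have "\<bar>g z * (1/z)\<bar> \<le> (g z)\<^sup>2 + (1/z)\<^sup>2" by (rule abs_mult_le_squares)
      also have "(1/z)\<^sup>2 = z powr (-2)" using z0 by (simp add: powr_minus powr_numeral field_simps)
      finally show ?thesis by simp
    qed
    have 1: "set_integrable lborel {e<..} (\<lambda>z. f (x - z) / z)"
      by (rule set_integrable_dominated(1)[OF i[OF tame_shift_square(2)[OF t, of x]] _ _ b[where g="\<lambda>z. f (x - z)"]]) auto
    have 2: "set_integrable lborel {e<..} (\<lambda>z. f (x + z) / z)"
      by (rule set_integrable_dominated(1)[OF i[OF tame_shift_square(1)[OF t, of x]] _ _ b[where g="\<lambda>z. f (x + z)"]]) auto
    have "set_integrable lborel {e<..} (\<lambda>z. - 1 * (f (x + z) / z))"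
      by (intro set_integrable_mult_right 2)
    hence 3: "set_integrable lborel {e<..} (\<lambda>z. f (x + z) / (x - (x + z)))" by simp
    show ?thesis
      by (subst set_integral_symmetric_split) (use 1 3 e in \<open>simp_all add: diff_divide_distrib\<close>)
  qed
  have "((\<lambda>e. LBINT z:{e<..} \<inter> {0<..}. (f (x - z) - f (x + z)) / z) \<longlongrightarrow>
      (LBINT z:{0<..}. (f (x - z) - f (x + z)) / z)) (at_right 0)"
    by (rule tendsto_set_integral_at_right_0[OF A, of _ 0]) auto
  moreover have "eventually (\<lambda>e. (LBINT z:{e<..} \<inter> {0<..}. (f (x - z) - f (x + z)) / z) =
     (LBINT y:{y. \<bar>x - y\<bar> > e}. f y / (x - y))) (at_right 0)"
    unfolding eventually_at_right_field by (intro exI[of _ 1]) (auto simp: eq max_def min_def greaterThan_Int_greaterThan intro!: arg_cong2[where f="set_lebesgue_integral lborel"])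
  ultimately have "((\<lambda>e. LBINT y:{y. \<bar>x - y\<bar> > e}. f y / (x - y)) \<longlongrightarrow>
      (LBINT z:{0<..}. (f (x - z) - f (x + z)) / z)) (at_right 0)"
    by (rule Lim_transform_eventually)
  hence "Lim (at_right 0) (\<lambda>e. LBINT y:{y. \<bar>x - y\<bar> > e}. f y / (x - y)) =
     (LBINT z:{0<..}. (f (x - z) - f (x + z)) / z)"
    by (intro tendsto_Lim) auto
  thus eq: "hilbert_transform f x = 1 / pi * (LBINT z:{0<..}. (f (x - z) - f (x + z)) / z)"
    unfolding hilbert_transform_def by simp
  have "\<bar>LBINT z:{0<..}. (f (x - z) - f (x + z)) / z\<bar> \<le> 4 * M + 1"
    using O(2)[where l=0] by simp
  moreover have "\<bar>hilbert_transform f x\<bar> = \<bar>LBINT z:{0<..}. (f (x - z) - f (x + z)) / z\<bar> / pi"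
    unfolding eq by (simp add: abs_mult)
  moreover have "\<dots> \<le> \<bar>LBINT z:{0<..}. (f (x - z) - f (x + z)) / z\<bar> / 1"
    by (rule divide_left_mono) (use pi_gt3 in auto)
  ultimately show "\<bar>hilbert_transform f x\<bar> \<le> 4 * M + 1" using tD(12) by linarith
qed

section \<open>The kernel of the fractional Laplacian\<close>

definition frac_kernel :: "real \<Rightarrow> real \<Rightarrow> real" where
  "frac_kernel a z = \<bar>z\<bar> powr (- 1 - 2 * a)"

lemma frac_kernel_nonneg [simp]: "frac_kernel a z \<ge> 0" by (simp add: frac_kernel_def)

lemma frac_kernel_measurable [measurable]: "frac_kernel a \<in> borel_measurable borel"
  unfolding frac_kernel_def by measurable

lemma integrable_even_half_line:
  fixes g :: "real \<Rightarrow> real"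
  assumes "\<And>z. g (-z) = g z" "set_integrable lborel {0<..} g"
  shows "integrable lborel g" "(LBINT z. g z) = 2 * (LBINT z:{0<..}. g z)"
proof -
  have i1: "has_bochner_integral lborel (\<lambda>z. indicat_real {0<..} z *\<^sub>R g z) (LBINT z:{0<..}. g z)"
    using assms(2) unfolding set_integrable_def set_lebesgue_integral_def by (rule has_bochner_integral_integrable)
  have j1: "has_bochner_integral lborel (\<lambda>y. indicat_real {0<..} (- y) *\<^sub>R g y) (LBINT z:{0<..}. g z)"
    using lborel_has_bochner_integral_real_affine_iff[of "-1" "\<lambda>z. indicat_real {0<..} z *\<^sub>R g z" _ 0] i1 assms(1) by simp
  have AE: "AE y in lborel. indicat_real {0<..} y *\<^sub>R g y + indicat_real {0<..} (- y) *\<^sub>R g y = g y"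
    using AE_lborel_singleton[of 0] by eventually_elim (auto simp: indicator_def)
  have i: "has_bochner_integral lborel (\<lambda>y. indicat_real {0<..} y *\<^sub>R g y + indicat_real {0<..} (- y) *\<^sub>R g y)
     ((LBINT z:{0<..}. g z) + (LBINT z:{0<..}. g z))"
    by (rule has_bochner_integral_add[OF i1 j1])
  have g: "g \<in> borel_measurable borel"
  proof -
    have [measurable]: "(\<lambda>y. indicat_real {0<..} y *\<^sub>R g y + indicat_real {0<..} (- y) *\<^sub>R g y) \<in> borel_measurable borel"
      using borel_measurable_has_bochner_integral[OF i] by (simp only: measurable_lborel2)
    have "(\<lambda>y. indicat_real {0<..} y *\<^sub>R g y + indicat_real {0<..} (- y) *\<^sub>R g y + indicat_real {0} y * g 0) \<in> borel_measurable borel"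
      by measurable
    also have "(\<lambda>y. indicat_real {0<..} y *\<^sub>R g y + indicat_real {0<..} (- y) *\<^sub>R g y + indicat_real {0} y * g 0) = g"
      by (auto simp: fun_eq_iff indicator_def)
    finally show ?thesis .
  qed
  have "has_bochner_integral lborel g ((LBINT z:{0<..}. g z) + (LBINT z:{0<..}. g z))"
    using i AE g by (subst has_bochner_integral_cong_AE[of _ _ "\<lambda>y. indicat_real {0<..} y *\<^sub>R g y + indicat_real {0<..} (- y) *\<^sub>R g y"])
      (auto dest: borel_measurable_has_bochner_integral)
  thus "integrable lborel g" "(LBINT z. g z) = 2 * (LBINT z:{0<..}. g z)"
    by (auto simp: has_bochner_integral_iff)
qed

text \<open>For \<open>a < 1/2\<close> a first difference of a bounded Lipschitz function, of size
  \<open>min 1 \<bar>z\<bar>\<close>, already makes the fractional Laplacian absolutely convergent;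
  no second difference is needed. The value of this integral recurs in all bounds below.\<close>

lemma frac_kernel_truncated_integrable:
  assumes "0 < a" "a < 1/2"
  shows "integrable lborel (\<lambda>z. min 1 \<bar>z\<bar> * frac_kernel a z)"
    "(LBINT z. min 1 \<bar>z\<bar> * frac_kernel a z) = 2 / (1 - 2 * a) + 1 / a"
proof -
  let ?g = "\<lambda>z. min 1 \<bar>z\<bar> * frac_kernel a z"
  have s1: "set_integrable lborel {0<..<1} (\<lambda>z. z powr (-2*a))" "(LBINT z:{0<..<1}. z powr (-2*a)) = 1 / (1 - 2*a)"
    using set_integrable_powr_from_0[of "-2*a" 1] set_integral_powr_from_0[of "-2*a" 1] assms by auto
  have s2: "set_integrable lborel {1<..} (\<lambda>z. z powr (-1-2*a))" "(LBINT z:{1<..}. z powr (-1-2*a)) = 1 / (2 * a)"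
    using set_integrable_powr_at_top[of "-1-2*a" 1] set_integral_powr_at_top[of "-1-2*a" 1] assms by auto
  have e1: "?g z = z powr (-2*a)" if "z \<in> {0<..<1}" for z
    using that powr_add[of z 1 "-1-2*a"] by (simp add: frac_kernel_def)
  have e2: "?g z = z powr (-1-2*a)" if "z \<in> {1<..}" for z
    using that by (simp add: frac_kernel_def)
  have c1: "set_integrable lborel {0<..<1} ?g = set_integrable lborel {0<..<1} (\<lambda>z. z powr (-2*a))"
    by (rule set_integrable_cong[OF refl refl e1])
  have c2: "set_integrable lborel {1<..} ?g = set_integrable lborel {1<..} (\<lambda>z. z powr (-1-2*a))"
    by (rule set_integrable_cong[OF refl refl e2])
  have v1: "(LBINT z:{0<..<1}. ?g z) = 1 / (1 - 2*a)"
    by (subst set_lebesgue_integral_cong[where g="\<lambda>z. z powr (-2*a)"]) (use e1 s1 in auto)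
  have v2: "(LBINT z:{1<..}. ?g z) = 1 / (2*a)"
    by (subst set_lebesgue_integral_cong[where g="\<lambda>z. z powr (-1-2*a)"]) (use e2 s2 in auto)
  have U: "set_integrable lborel ({0<..<1} \<union> {1<..}) ?g"
    by (intro set_integrable_Un) (use c1 c2 s1 s2 in auto)
  have VU: "(LBINT z:({0<..<1} \<union> {1<..}). ?g z) = 1 / (1 - 2*a) + 1 / (2*a)"
    by (subst set_integral_Un) (use c1 c2 s1 s2 v1 v2 in auto)
  have d1: "set_integrable lborel {0<..} ?g = set_integrable lborel ({0<..<1} \<union> {1<..}) ?g"
    by (rule set_integrable_discrete_difference[where X="{1}"]) auto
  have d2: "(LBINT z:{0<..}. ?g z) = (LBINT z:({0<..<1} \<union> {1<..}). ?g z)"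
    by (rule set_integral_discrete_difference[where X="{1}"]) auto
  have ev: "?g (-z) = ?g z" for z by (simp add: frac_kernel_def)
  show "integrable lborel ?g" using integrable_even_half_line(1)[of ?g, OF ev] d1 U by simp
  have "(LBINT z. ?g z) = 2 * (1 / (1 - 2*a) + 1 / (2*a))"
    using integrable_even_half_line(2)[of ?g, OF ev] d1 U VU d2 by simp
  thus "(LBINT z. ?g z) = 2 / (1 - 2 * a) + 1 / a" by (simp add: distrib_left)
qed

text \<open>The value 0 at \<open>a = 0\<close> encodes the convention of no dissipation, so that
  estimates with this factor hold on the whole range \<open>0 \<le> a\<close>, with
  \<open>1 / a = 0\<close> at \<open>a = 0\<close>.\<close>

definition frac_const :: "real \<Rightarrow> real" where
  "frac_const a = (if a = 0 then 0 else 4 powr a * Gamma (1 / 2 + a) / (sqrt pi * \<bar>Gamma (- a)\<bar>))"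

lemma frac_const_nonneg: "a \<ge> 0 \<Longrightarrow> frac_const a \<ge> 0"
  unfolding frac_const_def by (auto intro!: divide_nonneg_nonneg mult_nonneg_nonneg Gamma_real_nonneg)

lemma tame_frac_integrable:
  assumes t: "tame M f" and a: "0 < a" "a < 1/2"
  shows "integrable lborel (\<lambda>z. (f x - f (x + z)) * frac_kernel a z)"
    "integrable lborel (\<lambda>z. (f x - f (x - z)) * frac_kernel a z)"
    "\<bar>LBINT z. (f x - f (x + z)) * frac_kernel a z\<bar> \<le> 2 * M * (2 / (1 - 2 * a) + 1 / a)"
proof -
  note tD = tameD[OF t]
  have [measurable]: "f \<in> borel_measurable borel" by (rule tD)
  have b: "\<bar>f x - f y\<bar> \<le> 2 * M * min 1 \<bar>x - y\<bar>" for y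
    using tD(9)[of x y] tD(4)[of x] tD(4)[of y] tD(12) by (auto simp: min_def mult_right_mono intro: order_trans)
  have b': "\<bar>(f x - f y) * frac_kernel a z\<bar> \<le> 2 * M * (min 1 \<bar>z\<bar> * frac_kernel a z)" if "\<bar>x - y\<bar> = \<bar>z\<bar>" for y z
    using mult_right_mono[OF b[of y] frac_kernel_nonneg[of a z]] that by (simp add: abs_mult)
  have i: "integrable lborel (\<lambda>z. 2 * M * (min 1 \<bar>z\<bar> * frac_kernel a z))"
    by (intro integrable_mult_right frac_kernel_truncated_integrable a)
  show i1: "integrable lborel (\<lambda>z. (f x - f (x + z)) * frac_kernel a z)"
    by (rule Bochner_Integration.integrable_bound[OF i]) (auto simp del: abs_mult intro!: order_trans[OF b'])
  show "integrable lborel (\<lambda>z. (f x - f (x - z)) * frac_kernel a z)"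
    by (rule Bochner_Integration.integrable_bound[OF i]) (auto simp del: abs_mult intro!: order_trans[OF b'])
  have "\<bar>LBINT z. (f x - f (x + z)) * frac_kernel a z\<bar> \<le> (LBINT z. \<bar>(f x - f (x + z)) * frac_kernel a z\<bar>)"
    by (rule integral_abs_bound)
  also have "\<dots> \<le> (LBINT z. 2 * M * (min 1 \<bar>z\<bar> * frac_kernel a z))"
    by (rule integral_mono[OF integrable_abs[OF i1] i]) (rule b', simp)
  finally show "\<bar>LBINT z. (f x - f (x + z)) * frac_kernel a z\<bar> \<le> 2 * M * (2 / (1 - 2 * a) + 1 / a)"
    using frac_kernel_truncated_integrable[OF a] by simp
qed

lemma dissipation_tame:
  assumes t: "tame M f" and a: "0 \<le> a" "a < 1/2"
  shows "dissipation a f x = frac_const a * (LBINT z. (f x - f (x + z)) * frac_kernel a z)"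
proof (cases "a = 0")
  case True thus ?thesis by (simp add: dissipation_def frac_const_def)
next
  case False
  hence a: "0 < a" "a < 1/2" using a by auto
  let ?g = "\<lambda>y. (f x - f y) / \<bar>x - y\<bar> powr (1 + 2 * a)"
  have g: "?g y = (f x - f (x + (y - x))) * frac_kernel a (y - x)" for y
  proof -
    have "frac_kernel a (y - x) = inverse (\<bar>x - y\<bar> powr (1 + 2 * a))"
      unfolding frac_kernel_def powr_minus[symmetric] by (simp add: abs_minus_commute)
    thus ?thesis by (simp add: divide_inverse)
  qed
  have hb: "has_bochner_integral lborel ?g (LBINT z. (f x - f (x + z)) * frac_kernel a z)"
    using lborel_has_bochner_integral_real_affine_iff[of "1" "\<lambda>z. (f x - f (x + z)) * frac_kernel a z" _ "-x"]
      has_bochner_integral_integrable[OF tame_frac_integrable(1)[OF t a, of x]]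
    unfolding g by simp
  have s: "set_integrable lborel UNIV ?g" using hb by (simp add: set_integrable_def has_bochner_integral_iff)
  have "((\<lambda>e. LBINT y:{y. \<bar>x - y\<bar> > e}. ?g y) \<longlongrightarrow> (LBINT y:UNIV. ?g y)) (at_right 0)"
  proof (rule tendsto_set_integral_at_right_0[OF s, where p=x])
    fix z assume "z \<noteq> x"
    thus "\<exists>d>0. \<forall>e. 0 < e \<and> e < d \<longrightarrow> z \<in> {y. e < \<bar>x - y\<bar>}" by (intro exI[of _ "\<bar>x - z\<bar>"]) auto
  qed auto
  hence "Lim (at_right 0) (\<lambda>e. LBINT y:{y. \<bar>x - y\<bar> > e}. ?g y) = (LBINT y:UNIV. ?g y)"
    by (intro tendsto_Lim) auto
  also have "\<dots> = (LBINT z. (f x - f (x + z)) * frac_kernel a z)"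
    using hb by (simp add: has_bochner_integral_iff set_lebesgue_integral_def)
  finally show ?thesis using False unfolding dissipation_def frac_laplacian_def frac_const_def by simp
qed

lemma dissipation_bound:
  assumes t: "tame M f" and a: "0 \<le> a" "a < 1/2"
  shows "\<bar>dissipation a f x\<bar> \<le> frac_const a * (2 * M * (2 / (1 - 2 * a) + 1 / a))"
proof (cases "a = 0")
  case True thus ?thesis by (simp add: dissipation_def frac_const_def)
next
  case False
  thus ?thesis using tame_frac_integrable(3)[OF t _ a(2), of x] a frac_const_nonneg[of a]
    by (auto simp: dissipation_tame[OF t a] abs_mult intro!: mult_left_mono)
qed

lemma dissipation_at_max:
  assumes t: "tame M f" and a: "0 \<le> a" "a < 1/2" and "\<And>y. f y \<le> f x"
  shows "dissipation a f x \<ge> 0"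
  unfolding dissipation_tame[OF t a] using assms(4)
  by (intro mult_nonneg_nonneg frac_const_nonneg a integral_nonneg_AE) auto

lemma dissipation_at_min:
  assumes t: "tame M f" and a: "0 \<le> a" "a < 1/2" and "\<And>y. f y \<ge> f x"
  shows "dissipation a f x \<le> 0"
proof -
  have "(LBINT z. (f x - f (x + z)) * frac_kernel a z) = - (LBINT z. (f (x + z) - f x) * frac_kernel a z)"
    by (subst integral_minus[symmetric]) (simp add: algebra_simps)
  moreover have "(LBINT z. (f (x + z) - f x) * frac_kernel a z) \<ge> 0"
    using assms(4) by (intro integral_nonneg_AE) auto
  ultimately have "(LBINT z. (f x - f (x + z)) * frac_kernel a z) \<le> 0" by linarith
  thus ?thesis unfolding dissipation_tame[OF t a] using frac_const_nonneg[OF a(1)]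
    by (rule mult_nonneg_nonpos[rotated])
qed

text \<open>Reflecting \<open>z\<close> in the integral at \<open>-x\<close> pairs
  \<open>f (x + z)\<close> with \<open>f (-x - z)\<close>. What remains is the fractional Laplacian
  of the odd difference \<open>f y - f (-y)\<close> at its maximum.\<close>

lemma dissipation_reflection:
  assumes t: "tame M f" and a: "0 \<le> a" "a < 1/2" and "\<And>y. f y - f (-y) \<le> f x - f (-x)"
  shows "dissipation a f x \<ge> dissipation a f (-x)"
proof (cases "a = 0")
  case True thus ?thesis by (simp add: dissipation_def)
next
  case False
  hence a': "0 < a" using a by simp
  have "(LBINT z. (f (-x) - f (-x + z)) * frac_kernel a z) = (LBINT z. (f (-x) - f (-x - z)) * frac_kernel a z)"
    using lborel_integral_real_affine[of "-1" "\<lambda>z. (f (-x) - f (-x + z)) * frac_kernel a z" 0]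
    by (simp add: frac_kernel_def)
  also have "\<dots> \<le> (LBINT z. (f x - f (x + z)) * frac_kernel a z)"
  proof (rule integral_mono[OF tame_frac_integrable(2,1)[OF t a' a(2)]])
    fix z show "(f (-x) - f (-x - z)) * frac_kernel a z \<le> (f x - f (x + z)) * frac_kernel a z"
      using assms(4)[of "x + z"] by (intro mult_right_mono) auto
  qed
  finally show ?thesis unfolding dissipation_tame[OF t a]
    using frac_const_nonneg[OF a(1)] by (intro mult_left_mono) auto
qed

section \<open>The maximum principle and its consequences\<close>

text \<open>First-contact argument. Continuity in time, uniform in \<open>x\<close>, makes the set
  of contact times closed; decay against a positive barrier keeps the contact point from escaping to
  infinity. At the first contact the point is a spatial maximum, which is the information that
  \<open>touch\<close> exploits.\<close>

lemma comparison_principle: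
  fixes g :: "real \<Rightarrow> real \<Rightarrow> real" and \<eta> :: "real \<Rightarrow> real"
  assumes cont: "\<And>t. t \<in> {0..T} \<Longrightarrow> continuous_on UNIV (g t)"
    and unif: "\<And>t e. t \<in> {0..T} \<Longrightarrow> e > 0 \<Longrightarrow> \<exists>d>0. \<forall>s\<in>{0..T}. \<bar>s - t\<bar> < d \<longrightarrow> (\<forall>x. \<bar>g s x - g t x\<bar> \<le> e)"
    and decay: "\<And>t e. t \<in> {0..T} \<Longrightarrow> e > 0 \<Longrightarrow> \<exists>R. \<forall>x. \<bar>x\<bar> > R \<longrightarrow> g t x < e"
    and eta: "continuous_on {0..T} \<eta>" "\<And>t. t \<in> {0..T} \<Longrightarrow> \<eta> t > 0"
    and init: "\<And>x. g 0 x < \<eta> 0"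
    and touch: "\<And>t x. t \<in> {0<..T} \<Longrightarrow> g t x = \<eta> t \<Longrightarrow> (\<And>y. g t y \<le> \<eta> t) \<Longrightarrow>
        \<exists>D D'. ((\<lambda>s. g s x) has_real_derivative D) (at t) \<and> (\<eta> has_real_derivative D') (at t) \<and> D < D'"
    and t: "t \<in> {0..T}"
  shows "g t x < \<eta> t"
proof (rule ccontr)
  define S where "S = {t\<in>{0..T}. \<exists>x. g t x \<ge> \<eta> t}"
  assume "\<not> g t x < \<eta> t"
  hence tS: "t \<in> S" using t by (auto simp: S_def not_less)
  have eta_near: "\<exists>d>0. \<forall>s\<in>{0..T}. \<bar>s - t\<bar> < d \<longrightarrow> \<bar>\<eta> s - \<eta> t\<bar> < e" if "t \<in> {0..T}" "e > 0" for t e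
    using eta(1) that unfolding continuous_on_iff dist_real_def by blast
  have opn: "\<exists>d>0. \<forall>s\<in>{0..T}. \<bar>s - t\<bar> < d \<longrightarrow> s \<notin> S" if t: "t \<in> {0..T}" "t \<notin> S" for t
  proof -
    have lt: "g t x < \<eta> t" for x using t by (auto simp: S_def not_le)
    \<comment> \<open>Away from contact the distance to the barrier is uniform: outside a compact
      interval decay leaves at least \<open>\<eta> t / 2\<close>, inside it the maximum is
      attained.\<close>
    obtain \<delta> where d: "\<delta> > 0" "\<And>x. g t x \<le> \<eta> t - \<delta>"
    proof -
      obtain R where R: "\<And>x. \<bar>x\<bar> > R \<Longrightarrow> g t x < \<eta> t / 2"
        using decay[OF t(1), of "\<eta> t / 2"] eta(2)[OF t(1)] by auto
      have "\<exists>x1\<in>{-\<bar>R\<bar>..\<bar>R\<bar>}. \<forall>y\<in>{-\<bar>R\<bar>..\<bar>R\<bar>}. g t y \<le> g t x1"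
        by (rule continuous_attains_sup) (use cont[OF t(1)] continuous_on_subset in auto)
      then obtain x1 where x1': "\<forall>y\<in>{-\<bar>R\<bar>..\<bar>R\<bar>}. g t y \<le> g t x1" by blast
      have x1: "g t y \<le> g t x1" if "\<bar>y\<bar> \<le> \<bar>R\<bar>" for y using x1' that by (auto simp: abs_le_iff)
      show ?thesis
      proof (rule that[of "min (\<eta> t / 2) (\<eta> t - g t x1)"])
        show "0 < min (\<eta> t / 2) (\<eta> t - g t x1)" using lt[of x1] eta(2)[OF t(1)] by auto
        fix x show "g t x \<le> \<eta> t - min (\<eta> t / 2) (\<eta> t - g t x1)"
        proof (cases "\<bar>x\<bar> \<le> \<bar>R\<bar>")
          case True thus ?thesis using x1[of x] by linarith
        next
          case False hence "g t x < \<eta> t / 2" by (intro R) auto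
          thus ?thesis by linarith
        qed
      qed
    qed
    obtain d1 where d1: "d1 > 0" "\<And>s x. s \<in> {0..T} \<Longrightarrow> \<bar>s - t\<bar> < d1 \<Longrightarrow> \<bar>g s x - g t x\<bar> \<le> \<delta>/3"
      using unif[OF t(1), of "\<delta>/3"] d(1) by auto
    obtain d2 where d2: "d2 > 0" "\<And>s. s \<in> {0..T} \<Longrightarrow> \<bar>s - t\<bar> < d2 \<Longrightarrow> \<bar>\<eta> s - \<eta> t\<bar> < \<delta>/3"
      using eta_near[OF t(1), of "\<delta>/3"] d(1) by auto
    show ?thesis
    proof (intro exI[of _ "min d1 d2"] conjI ballI impI)
      show "0 < min d1 d2" using d1 d2 by simp
      fix s assume s: "s \<in> {0..T}" "\<bar>s - t\<bar> < min d1 d2"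
      have "g s x < \<eta> s" for x using d1(2)[of s x] d2(2)[of s] s d(2)[of x] d(1) by linarith
      thus "s \<notin> S" by (auto simp: S_def not_le)
    qed
  qed
  define t0 where "t0 = Inf S"
  have bdd: "bdd_below S" by (rule bdd_belowI[of _ 0]) (auto simp: S_def)
  have t0r: "t0 \<in> {0..T}"
  proof -
    have "0 \<le> t0" unfolding t0_def by (rule cInf_greatest) (use tS in \<open>auto simp: S_def\<close>)
    moreover have "t0 \<le> t" unfolding t0_def by (rule cInf_lower[OF tS bdd])
    ultimately show ?thesis using t by auto
  qed
  have below: "s \<notin> S" if "s < t0" for s
    using cInf_lower[OF _ bdd, of s] that unfolding t0_def by auto
  have t0S: "t0 \<in> S"
  proof (rule ccontr)
    assume "t0 \<notin> S"
    then obtain d where d: "d > 0" "\<And>s. s \<in> {0..T} \<Longrightarrow> \<bar>s - t0\<bar> < d \<Longrightarrow> s \<notin> S" using opn[OF t0r] by auto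
    have "t0 + d \<le> t0" unfolding t0_def
    proof (rule cInf_greatest)
      fix s assume s: "s \<in> S"
      hence "s \<ge> t0" using below[of s] by linarith
      moreover have "s \<in> {0..T}" using s by (auto simp: S_def)
      ultimately show "Inf S + d \<le> s" using d(2)[of s] s unfolding t0_def by linarith
    qed (use tS in auto)
    thus False using d by simp
  qed
  have "0 \<notin> S" using init by (auto simp: S_def not_le)
  hence t0p: "t0 > 0" using t0S t0r by (cases "t0 = 0") auto
  obtain x0 where x0: "g t0 x0 \<ge> \<eta> t0" using t0S by (auto simp: S_def)
  have le: "g t0 y \<le> \<eta> t0" for y
  proof (rule field_le_epsilon)
    fix e :: real assume e: "e > 0"
    obtain d1 where d1: "d1 > 0" "\<And>s x. s \<in> {0..T} \<Longrightarrow> \<bar>s - t0\<bar> < d1 \<Longrightarrow> \<bar>g s x - g t0 x\<bar> \<le> e/2"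
      using unif[OF t0r, of "e/2"] e by auto
    obtain d2 where d2: "d2 > 0" "\<And>s. s \<in> {0..T} \<Longrightarrow> \<bar>s - t0\<bar> < d2 \<Longrightarrow> \<bar>\<eta> s - \<eta> t0\<bar> < e/2"
      using eta_near[OF t0r, of "e/2"] e by auto
    define s where "s = max 0 (t0 - min d1 d2 / 2)"
    have s: "s \<in> {0..T}" "s < t0" "\<bar>s - t0\<bar> < d1" "\<bar>s - t0\<bar> < d2" using t0p t0r d1(1) d2(1) by (auto simp: s_def max_def min_def)
    have "g s y < \<eta> s" using below[OF s(2)] s(1) by (auto simp: S_def not_le)
    thus "g t0 y \<le> \<eta> t0 + e" using d1(2)[OF s(1,3), of y] d2(2)[OF s(1,4)] by linarith
  qed
  have eq: "g t0 x0 = \<eta> t0" using x0 le[of x0] by linarith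
  obtain D D' where D: "((\<lambda>s. g s x0) has_real_derivative D) (at t0)" "(\<eta> has_real_derivative D') (at t0)" "D < D'"
    using touch[of t0 x0, OF _ eq le] t0p t0r by auto
  have "((\<lambda>s. g s x0 - \<eta> s) has_real_derivative (D - D')) (at t0)" by (intro derivative_intros D)
  \<comment> \<open>Since \<open>g - \<eta>\<close> decreases strictly through its zero at
    \<open>t0\<close>, it was positive just before, against the minimality of
    \<open>t0\<close>.\<close>
  from DERIV_neg_dec_left[OF this] D(3) obtain d where d: "d > 0"
    "\<And>h. h > 0 \<Longrightarrow> h < d \<Longrightarrow> g t0 x0 - \<eta> t0 < g (t0 - h) x0 - \<eta> (t0 - h)" by auto
  define h where "h = min (d/2) (t0/2)"
  have h: "h > 0" "h < d" "t0 - h \<in> {0..T}" "t0 - h < t0" using d(1) t0p t0r by (auto simp: h_def min_def)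
  have "g (t0 - h) x0 < \<eta> (t0 - h)" using below[OF h(4)] h(3) by (auto simp: S_def not_le)
  thus False using d(2)[OF h(1,2)] eq by linarith
qed

section \<open>Regularity of a solution on \<open>[0, 1]\<close> and its maximum principle\<close>

locale CCF_solution =
  fixes \<alpha> :: real and \<theta>\<^sub>0 :: "real \<Rightarrow> real" and \<theta> :: "real \<Rightarrow> real \<Rightarrow> real"
  assumes sol: "global_smooth_CCF_solution \<alpha> \<theta>\<^sub>0 \<theta>" and alpha: "0 \<le> \<alpha>" "\<alpha> < 1 / 4"
begin

lemma alpha_half: "\<alpha> < 1 / 2" using alpha by simp

lemma initial: "\<theta> 0 = \<theta>\<^sub>0" using sol by (simp add: global_smooth_CCF_solution_def)

lemma smooth: "t \<ge> 0 \<Longrightarrow> smooth_Sobolev (\<theta> t)" using sol by (simp add: global_smooth_CCF_solution_def)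

lemma equation:
  "t > 0 \<Longrightarrow> ((\<lambda>s. \<theta> s x) has_real_derivative
     hilbert_transform (\<theta> t) x * deriv (\<theta> t) x - dissipation \<alpha> (\<theta> t) x) (at t)"
  using sol by (simp add: global_smooth_CCF_solution_def)

lemma Sobolev_continuity:
  assumes t: "t \<ge> 0" and e: "e > 0"
  shows "\<exists>d>0. \<forall>s\<ge>0. \<bar>s - t\<bar> < d \<longrightarrow> (LBINT x. ((deriv ^^ n) (\<theta> s) x - (deriv ^^ n) (\<theta> t) x)\<^sup>2) < e"
proof -
  let ?I = "\<lambda>s. LBINT x. ((deriv ^^ n) (\<theta> s) x - (deriv ^^ n) (\<theta> t) x)\<^sup>2"
  have "(?I \<longlongrightarrow> 0) (at t within {0..})" using sol t by (simp add: global_smooth_CCF_solution_def)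
  hence "eventually (\<lambda>s. ?I s < e) (at t within {0..})" using e by (rule order_tendstoD)
  then obtain d where d: "d > 0" "\<And>s. s \<in> {0..} \<Longrightarrow> s \<noteq> t \<Longrightarrow> dist s t < d \<Longrightarrow> ?I s < e"
    unfolding eventually_at by blast
  show ?thesis
  proof (intro exI[of _ d] conjI allI impI d(1))
    fix s assume "0 \<le> s" "\<bar>s - t\<bar> < d"
    thus "?I s < e" using d(2)[of s] e by (cases "s = t") (auto simp: dist_real_def)
  qed
qed

lemma diff_square_integrable:
  assumes "s \<ge> 0" "t \<ge> 0"
  shows "integrable lborel (\<lambda>x. ((deriv ^^ n) (\<theta> s) x - (deriv ^^ n) (\<theta> t) x)\<^sup>2)"
proof -
  note a = smooth_Sobolev_deriv[OF smooth[OF assms(1)], where n=n] and b = smooth_Sobolev_deriv[OF smooth[OF assms(2)], where n=n]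
  show ?thesis
  proof (rule Bochner_Integration.integrable_bound)
    show "integrable lborel (\<lambda>x. 2 * ((deriv ^^ n) (\<theta> s) x)\<^sup>2 + 2 * ((deriv ^^ n) (\<theta> t) x)\<^sup>2)"
      using a(4) b(4) by auto
    show "(\<lambda>x. ((deriv ^^ n) (\<theta> s) x - (deriv ^^ n) (\<theta> t) x)\<^sup>2) \<in> borel_measurable lborel"
      using a(3) b(3) by measurable
    have "(u - v)\<^sup>2 \<le> 2 * u\<^sup>2 + 2 * v\<^sup>2" for u v :: real
      using zero_le_power2[of "u + v"] by (simp add: power2_eq_square algebra_simps)
    thus "AE x in lborel. norm (((deriv ^^ n) (\<theta> s) x - (deriv ^^ n) (\<theta> t) x)\<^sup>2) \<le>
       norm (2 * ((deriv ^^ n) (\<theta> s) x)\<^sup>2 + 2 * ((deriv ^^ n) (\<theta> t) x)\<^sup>2)" by auto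
  qed
qed

lemma uniform_continuity:
  assumes t: "t \<ge> 0" and e: "e > 0"
  shows "\<exists>d>0. \<forall>s\<ge>0. \<bar>s - t\<bar> < d \<longrightarrow> (\<forall>x. \<bar>\<theta> s x - \<theta> t x\<bar> \<le> e)"
proof -
  have e2: "e\<^sup>2/3 > 0" using e by simp
  obtain d0 where d0: "d0 > 0" "\<And>s. s \<ge> 0 \<Longrightarrow> \<bar>s - t\<bar> < d0 \<Longrightarrow> (LBINT x. (\<theta> s x - \<theta> t x)\<^sup>2) < e\<^sup>2/3"
    using Sobolev_continuity[OF t e2, of 0] by auto
  obtain d1 where d1: "d1 > 0" "\<And>s. s \<ge> 0 \<Longrightarrow> \<bar>s - t\<bar> < d1 \<Longrightarrow> (LBINT x. (deriv (\<theta> s) x - deriv (\<theta> t) x)\<^sup>2) < e\<^sup>2/3"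
    using Sobolev_continuity[OF t e2, of 1] by auto
  show ?thesis
  proof (intro exI[of _ "min d0 d1"] conjI allI impI)
    show "0 < min d0 d1" using d0 d1 by simp
    fix s x assume s: "0 \<le> s" "\<bar>s - t\<bar> < min d0 d1"
    have "(\<theta> s x - \<theta> t x)\<^sup>2 \<le> 2 * (LBINT y. (\<theta> s y - \<theta> t y)\<^sup>2) + (LBINT y. (deriv (\<theta> s) y - deriv (\<theta> t) y)\<^sup>2)"
    proof (rule Sobolev_sup_bound)
      fix y show "((\<lambda>x. \<theta> s x - \<theta> t x) has_real_derivative (deriv (\<theta> s) y - deriv (\<theta> t) y)) (at y)"
        using smooth_Sobolev_deriv(1)[OF smooth[OF s(1)], of 0 y] smooth_Sobolev_deriv(1)[OF smooth[OF t], of 0 y]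
        by (auto intro!: derivative_intros)
    next
      show "continuous_on UNIV (\<lambda>y. deriv (\<theta> s) y - deriv (\<theta> t) y)"
        using smooth_Sobolev_deriv(2)[OF smooth[OF s(1)], of UNIV 1] smooth_Sobolev_deriv(2)[OF smooth[OF t], of UNIV 1]
        by (auto intro!: continuous_intros)
    qed (use diff_square_integrable[OF s(1) t, of 0] diff_square_integrable[OF s(1) t, of 1] in auto)
    also have "\<dots> \<le> e\<^sup>2" using d0(2)[OF s(1)] d1(2)[OF s(1)] s(2) by linarith
    finally show "\<bar>\<theta> s x - \<theta> t x\<bar> \<le> e" using e by (simp add: abs_le_square_iff[symmetric])
  qed
qed

text \<open>Continuity in time bounds each norm near every time by \<open>2 + 2 * ?N t\<close>;
  finitely many such neighbourhoods cover \<open>[0, 1]\<close>.\<close>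

lemma Sobolev_bounded: "\<exists>B. \<forall>t\<in>{0..1}. (LBINT x. ((deriv ^^ n) (\<theta> t) x)\<^sup>2) \<le> B"
proof -
  let ?N = "\<lambda>t. LBINT x. ((deriv ^^ n) (\<theta> t) x)\<^sup>2"
  have "\<exists>d>0. \<forall>s\<ge>0. \<bar>s - t\<bar> < d \<longrightarrow> ?N s \<le> 2 + 2 * ?N t" if t: "t \<in> {0..1}" for t
  proof -
    have t0: "t \<ge> 0" using t by simp
    obtain d where d: "d > 0" "\<And>s. s \<ge> 0 \<Longrightarrow> \<bar>s - t\<bar> < d \<Longrightarrow> (LBINT x. ((deriv ^^ n) (\<theta> s) x - (deriv ^^ n) (\<theta> t) x)\<^sup>2) < 1"
      using Sobolev_continuity[OF t0, of 1 n] by auto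
    show ?thesis
    proof (intro exI[of _ d] conjI allI impI d(1))
      fix s assume s: "0 \<le> s" "\<bar>s - t\<bar> < d"
      note i = smooth_Sobolev_deriv(4)[OF smooth[OF s(1)], of n] smooth_Sobolev_deriv(4)[OF smooth[OF t0], of n]
        diff_square_integrable[OF s(1) t0, of n]
      have *: "u\<^sup>2 \<le> 2 * (u - v)\<^sup>2 + 2 * v\<^sup>2" for u v :: real
        using zero_le_power2[of "u - 2 * v"] by (simp add: power2_eq_square algebra_simps)
      have "?N s \<le> (LBINT x. 2 * ((deriv ^^ n) (\<theta> s) x - (deriv ^^ n) (\<theta> t) x)\<^sup>2 + 2 * ((deriv ^^ n) (\<theta> t) x)\<^sup>2)"
        by (rule integral_mono) (use i * in auto)
      also have "\<dots> = 2 * (LBINT x. ((deriv ^^ n) (\<theta> s) x - (deriv ^^ n) (\<theta> t) x)\<^sup>2) + 2 * ?N t"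
        using i by simp
      finally show "?N s \<le> 2 + 2 * ?N t" using d(2)[OF s] by linarith
    qed
  qed
  then obtain d where d: "\<And>t. t \<in> {0..1} \<Longrightarrow> d t > 0"
    "\<And>t s. t \<in> {0..1} \<Longrightarrow> s \<ge> 0 \<Longrightarrow> \<bar>s - t\<bar> < d t \<Longrightarrow> ?N s \<le> 2 + 2 * ?N t" by metis
  obtain C where C: "C \<subseteq> {0..1}" "finite C" "{0..1} \<subseteq> (\<Union>t\<in>C. ball t (d t))"
  proof (rule compactE_image[of "{0..1::real}" "{0..1}" "\<lambda>t. ball t (d t)"])
    show "{0..1} \<subseteq> (\<Union>t\<in>{0..1}. ball t (d t))" using d(1) by force
  qed auto
  show ?thesis
  proof (intro exI ballI)
    fix s :: real assume s: "s \<in> {0..1}"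
    then obtain t where t: "t \<in> C" "dist t s < d t" using C by force
    have nn: "?N t \<ge> 0" for t by simp
    have "?N s \<le> 2 + 2 * ?N t" by (rule d(2)) (use s t C in \<open>auto simp: dist_real_def abs_minus_commute\<close>)
    also have "?N t \<le> (\<Sum>t\<in>C. ?N t)" by (rule member_le_sum) (use t C nn in auto)
    finally show "?N s \<le> 2 + 2 * (\<Sum>t\<in>C. ?N t)" by simp
  qed
qed

lemma ex_tame: "\<exists>M. \<forall>t\<in>{0..1}. tame M (\<theta> t)"
proof -
  obtain B where B: "\<And>n t. t \<in> {0..1} \<Longrightarrow> (LBINT x. ((deriv ^^ n) (\<theta> t) x)\<^sup>2) \<le> B n"
    using Sobolev_bounded by metis
  have Bn: "B n \<ge> 0" for n using B[of 0 n] by (auto intro: order_trans[rotated])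
  \<comment> \<open>Chosen above \<open>2 * B n + B (Suc n)\<close> for \<open>n = 0\<close> and
    \<open>n = 1\<close>, which bound the squares of the profile and of its derivative. The summand
    1 ensures \<open>M \<le> M\<^sup>2\<close>, so that the same constant bounds the functions
    themselves.\<close>
  define M where "M = 1 + 2 * B 0 + 3 * B 1 + B 2"
  have M1: "M \<ge> 1" unfolding M_def using Bn[of 0] Bn[of 1] Bn[of 2] by linarith
  have sup: "\<bar>(deriv ^^ n) (\<theta> t) x\<bar> \<le> M" if t: "t \<in> {0..1}" and n: "n \<in> {0,1}" for n t x
  proof -
    have t0: "t \<ge> 0" using t by simp
    note s = smooth_Sobolev_deriv[OF smooth[OF t0]]
    have "((deriv ^^ n) (\<theta> t) x)\<^sup>2 \<le> 2 * (LBINT y. ((deriv ^^ n) (\<theta> t) y)\<^sup>2) + (LBINT y. ((deriv ^^ Suc n) (\<theta> t) y)\<^sup>2)"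
      by (rule Sobolev_sup_bound[OF s(1) s(2) s(4) s(4)])
    also have "\<dots> \<le> 2 * B n + B (Suc n)" using B[OF t, of n] B[OF t, of "Suc n"] by linarith
    also have "\<dots> \<le> M" unfolding M_def using n Bn[of 0] Bn[of 1] Bn[of 2] by (auto simp: eval_nat_numeral)
    also have "\<dots> \<le> M\<^sup>2" using M1 by (simp add: power2_eq_square)
    finally show ?thesis using M1 by (simp add: abs_le_square_iff[symmetric])
  qed
  have "tame M (\<theta> t)" if t: "t \<in> {0..1}" for t
  proof -
    have t0: "t \<ge> 0" using t by simp
    note s = smooth_Sobolev_deriv[OF smooth[OF t0]]
    show ?thesis unfolding tame_def
    proof (intro conjI allI)
      show "(\<theta> t has_real_derivative deriv (\<theta> t) x) (at x)" for x using s(1)[of 0 x] by simp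
      show "continuous_on UNIV (deriv (\<theta> t))" using s(2)[of UNIV 1] by simp
      show "\<bar>\<theta> t x\<bar> \<le> M" for x using sup[OF t, of 0 x] by simp
      show "\<bar>deriv (\<theta> t) x\<bar> \<le> M" for x using sup[OF t, of 1 x] by simp
      show "integrable lborel (\<lambda>x. (\<theta> t x)\<^sup>2)" using s(4)[of 0] by simp
      show "(LBINT x. (\<theta> t x)\<^sup>2) \<le> M"
        using B[OF t, of 0] M1 Bn[of 0] Bn[of 1] Bn[of 2] unfolding M_def by simp
      show "integrable lborel (\<lambda>x. (deriv (\<theta> t) x)\<^sup>2)" using s(4)[of 1] by simp
    qed
  qed
  thus ?thesis by blast
qed

text \<open>A constant of the individual solution. It can therefore not enter the choice of
  \<open>K\<close> and is absent from the final differential inequality.\<close>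

definition bound where "bound = (SOME M. \<forall>t\<in>{0..1}. tame M (\<theta> t))"

lemma tame_bound: "t \<in> {0..1} \<Longrightarrow> tame bound (\<theta> t)"
  unfolding bound_def using someI_ex[OF ex_tame] by blast

lemma decay:
  assumes "t \<ge> 0" "e > 0"
  shows "\<exists>R. \<forall>x. \<bar>x\<bar> > R \<longrightarrow> \<bar>\<theta> t x\<bar> < e"
  using Sobolev_vanishes_at_infinity[of "\<theta> t" "deriv (\<theta> t)" e] smooth_Sobolev_deriv[OF smooth[OF assms(1)], where n=0]
    smooth_Sobolev_deriv[OF smooth[OF assms(1)], where n=1] assms by auto

text \<open>At a spatial extremum the transport term vanishes, however large the Hilbert transform
  is, and the dissipation has a favourable sign. The sign \<open>\<sigma>\<close> treats upper and
  lower bounds together, and the slope \<open>e\<close> of the barrier supplies the strict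
  inequality even without dissipation.\<close>

lemma maximum_principle:
  assumes \<sigma>: "\<sigma> = 1 \<or> \<sigma> = (-1::real)" and init: "\<And>x. \<sigma> * \<theta>\<^sub>0 x \<le> K" and K: "K \<ge> 0" and t: "t \<in> {0..1}"
  shows "\<sigma> * \<theta> t x \<le> K"
proof -
  have abs\<sigma>: "\<bar>\<sigma> * u\<bar> = \<bar>u\<bar>" for u using \<sigma> by auto
  have *: "\<sigma> * \<theta> t x < K + e * (1 + t)" if e: "e > 0" for e
  proof (rule comparison_principle[where T=1 and g="\<lambda>t x. \<sigma> * \<theta> t x" and \<eta>="\<lambda>t. K + e * (1 + t)", OF _ _ _ _ _ _ _ t])
    show "continuous_on UNIV (\<lambda>x. \<sigma> * \<theta> t x)" if "t \<in> {0..1}" for t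
      by (intro continuous_intros tameD(3)[OF tame_bound[OF that]])
    show "\<exists>d>0. \<forall>s\<in>{0..1}. \<bar>s - t\<bar> < d \<longrightarrow> (\<forall>x. \<bar>\<sigma> * \<theta> s x - \<sigma> * \<theta> t x\<bar> \<le> e)" if "t \<in> {0..1}" "e > 0" for t e
      using uniform_continuity[of t e] that unfolding right_diff_distrib[symmetric] abs\<sigma> by auto
    show "\<exists>R. \<forall>x. R < \<bar>x\<bar> \<longrightarrow> \<sigma> * \<theta> t x < e" if te: "t \<in> {0..1}" "e > 0" for t e
    proof -
      obtain R where R: "\<And>x. R < \<bar>x\<bar> \<Longrightarrow> \<bar>\<theta> t x\<bar> < e" using decay[of t e] te by auto
      have "\<sigma> * \<theta> t x < e" if "R < \<bar>x\<bar>" for x using R[OF that] abs\<sigma>[of "\<theta> t x"] by linarith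
      thus ?thesis by blast
    qed
    show "\<sigma> * \<theta> 0 x < K + e * (1 + 0)" for x using init[of x] e by (simp add: initial)
    show "\<exists>D D'. ((\<lambda>s. \<sigma> * \<theta> s x) has_real_derivative D) (at t) \<and> ((\<lambda>t. K + e * (1 + t)) has_real_derivative D') (at t) \<and> D < D'"
      if t: "t \<in> {0<..1}" and eq: "\<sigma> * \<theta> t x = K + e * (1 + t)" and le: "\<And>y. \<sigma> * \<theta> t y \<le> K + e * (1 + t)" for t x
    proof -
      note tb = tame_bound[of t]
      have t': "t \<in> {0..1}" "t > 0" using t by auto
      have max: "\<sigma> * \<theta> t y \<le> \<sigma> * \<theta> t x" for y using le[of y] eq by linarith
      have "\<sigma> * deriv (\<theta> t) x = 0"
        by (rule DERIV_local_max[OF DERIV_cmult[OF tameD(1)[OF tb[OF t'(1)]]], of 1]) (use max in auto)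
      hence d0: "deriv (\<theta> t) x = 0" using \<sigma> by auto
      have diss: "\<sigma> * dissipation \<alpha> (\<theta> t) x \<ge> 0"
        using \<sigma> max dissipation_at_max[OF tb[OF t'(1)] alpha(1) alpha_half, of x]
          dissipation_at_min[OF tb[OF t'(1)] alpha(1) alpha_half, of x] by auto
      have "((\<lambda>s. \<sigma> * \<theta> s x) has_real_derivative - (\<sigma> * dissipation \<alpha> (\<theta> t) x)) (at t)"
        using DERIV_cmult[OF equation[OF t'(2), of x], of \<sigma>] d0 by simp
      moreover have "((\<lambda>t. K + e * (1 + t)) has_real_derivative e) (at t)" by (auto intro!: derivative_eq_intros)
      moreover have "- (\<sigma> * dissipation \<alpha> (\<theta> t) x) < e" using diss e by linarith
      ultimately show ?thesis by blast
    qed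
  qed (use e K in \<open>auto intro!: continuous_intros add_nonneg_pos\<close>)
  show ?thesis
  proof (rule ccontr)
    assume "\<not> \<sigma> * \<theta> t x \<le> K"
    \<comment> \<open>With this \<open>e\<close> and \<open>t \<le> 1\<close> the barrier is at most
      \<open>K + 2 * e = \<sigma> * \<theta> t x\<close>.\<close>
    thus False using *[of "(\<sigma> * \<theta> t x - K) / 2"] t mult_left_mono[of "1 + t" 2 "(\<sigma> * \<theta> t x - K) / 2"] by auto
  qed
qed

lemma nonneg:
  assumes "\<And>x. \<theta>\<^sub>0 x \<ge> 0" "t \<in> {0..1}"
  shows "\<theta> t x \<ge> 0"
  using maximum_principle[of "-1" 0 t x] assms by simp

lemma upper_bound:
  assumes "\<And>x. \<theta>\<^sub>0 x \<le> K" "K > 0" "t \<in> {0..1}"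
  shows "\<theta> t x \<le> K"
  using maximum_principle[of 1 K t x] assms by simp

end

section \<open>Preservation of evenness\<close>

text \<open>The sum is the Hilbert transform at \<open>x\<close> of the odd difference
  \<open>w y = f y - f (-y)\<close>, which is bounded by \<open>h\<close>, has Lipschitz constant
  \<open>2 * M\<close> and square integral at most \<open>4 * M\<close>. The constant
  \<open>12 * M + 1\<close> is \<open>2 * (2 * M) + 2 * (4 * M) + 1\<close> from the logarithmic
  estimate.\<close>

lemma tame_hilbert_reflection_bound:
  assumes t: "tame M f" and h: "\<And>y. \<bar>f y - f (-y)\<bar> \<le> h" and l: "l \<ge> 0"
  shows "\<bar>hilbert_transform f x + hilbert_transform f (-x)\<bar> \<le> (12 * M + 1) * exp (-l) + 6 * h * l"
proof -
  note tD = tameD[OF t]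
  have [measurable]: "f \<in> borel_measurable borel" by (rule tD)
  define w where "w = (\<lambda>y. f y - f (-y))"
  have [measurable]: "w \<in> borel_measurable borel" unfolding w_def by measurable
  have sq: "(w y)\<^sup>2 \<le> 2 * (f y)\<^sup>2 + 2 * (f (-y))\<^sup>2" for y
    unfolding w_def using zero_le_power2[of "f y + f (-y)"] by (simp add: power2_eq_square algebra_simps)
  have i2: "integrable lborel (\<lambda>y. 2 * (f y)\<^sup>2 + 2 * (f (-y))\<^sup>2)"
    "(LBINT y. 2 * (f y)\<^sup>2 + 2 * (f (-y))\<^sup>2) \<le> 4 * M"
    using square_integrable_affine[OF tD(6), of "-1" 0] tD(6,7) by auto
  have wi: "integrable lborel (\<lambda>y. (w y)\<^sup>2)"
    by (rule Bochner_Integration.integrable_bound[OF i2(1)]) (use sq in auto)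
  have "(LBINT y. (w y)\<^sup>2) \<le> (LBINT y. 2 * (f y)\<^sup>2 + 2 * (f (-y))\<^sup>2)"
    by (rule integral_mono[OF wi i2(1) sq])
  hence wI: "(LBINT y. (w y)\<^sup>2) \<le> 4 * M" using i2(2) by linarith
  have lip: "\<bar>w (x - z) - w (x + z)\<bar> \<le> 2 * (2 * M) * z" if "z > 0" for z
    using tD(9)[of "x - z" "x + z"] tD(9)[of "-(x - z)" "-(x + z)"] that unfolding w_def by auto
  have wh: "\<bar>w y\<bar> \<le> h" for y using h unfolding w_def by auto
  have sqa: "integrable lborel (\<lambda>z. (w (x - z))\<^sup>2)" "integrable lborel (\<lambda>z. (w (x + z))\<^sup>2)"
    "(LBINT z. (w (x - z))\<^sup>2) \<le> 4 * M" "(LBINT z. (w (x + z))\<^sup>2) \<le> 4 * M"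
    using square_integrable_affine[OF wi, of 1 x] square_integrable_affine[OF wi, of "-1" x] wI by auto
  have b: "\<bar>LBINT z:{0<..}. (w (x - z) - w (x + z)) / z\<bar> \<le> (2 * (2 * M) + 2 * (4 * M) + 1) * exp (-l) + 6 * h * l"
    by (rule odd_difference_integral(2)[OF _ _ sqa lip wh wh l]) auto
  have "hilbert_transform f x + hilbert_transform f (-x) = 1 / pi *
     ((LBINT z:{0<..}. (f (x - z) - f (x + z)) / z) + (LBINT z:{0<..}. (f (- x - z) - f (- x + z)) / z))"
    unfolding hilbert_transform_tame(2)[OF t] by (simp add: distrib_left)
  also have "(LBINT z:{0<..}. (f (x - z) - f (x + z)) / z) + (LBINT z:{0<..}. (f (- x - z) - f (- x + z)) / z)
     = (LBINT z:{0<..}. (f (x - z) - f (x + z)) / z + (f (- x - z) - f (- x + z)) / z)"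
    by (rule set_integral_add(2)[symmetric, OF hilbert_transform_tame(1)[OF t] hilbert_transform_tame(1)[OF t]])
  also have "\<dots> = (LBINT z:{0<..}. (w (x - z) - w (x + z)) / z)"
    unfolding w_def by (rule set_lebesgue_integral_cong) (auto simp: diff_divide_distrib)
  finally have "\<bar>hilbert_transform f x + hilbert_transform f (-x)\<bar> = \<bar>LBINT z:{0<..}. (w (x - z) - w (x + z)) / z\<bar> / pi"
    by (simp add: abs_mult)
  also have "\<dots> \<le> \<bar>LBINT z:{0<..}. (w (x - z) - w (x + z)) / z\<bar> / 1"
    by (rule divide_left_mono) (use pi_gt3 in auto)
  finally show ?thesis using b by simp
qed

context CCF_solution begin

text \<open>
  The odd part \<open>\<theta> t x - \<theta> t (-x)\<close> obeys a maximum principle up to a logarithmic loss, since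
  \<open>H\<close> is not bounded on \<open>L\<^sup>\<infinity>\<close>; the barrier \<open>exp (- L exp (- B t))\<close> absorbs the logarithm as in
  Osgood's criterion, and \<open>L\<close> tends to infinity.
\<close>

lemma even:
  assumes init: "\<And>x. \<theta>\<^sub>0 (-x) = \<theta>\<^sub>0 x" and t: "t \<in> {0..1}"
  shows "\<theta> t (-x) = \<theta> t x"
proof -
  define M where "M = bound"
  have tm: "tame M (\<theta> t)" if "t \<in> {0..1}" for t unfolding M_def by (rule tame_bound[OF that])
  have M0: "M \<ge> 0" by (rule tameD(12)[OF tm[of 0]]) auto
  \<comment> \<open>At a contact the transport term is at most
    \<open>M * (12 * M + 7) * l * h\<close>, whereas the barrier grows at rate
    \<open>B * l * h\<close>; the extra 1 makes the inequality strict. The 7 adds the coefficients 1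
    and 6 of the Hilbert bound.\<close>
  define B where "B = M * (12 * M + 7) + 1"
  have B: "B \<ge> 1" unfolding B_def using M0 by auto
  have *: "\<theta> t x - \<theta> t (-x) < exp (- L * exp (- B * t))" if L: "L \<ge> exp B" for L x
  proof (rule comparison_principle[where T=1 and g="\<lambda>t x. \<theta> t x - \<theta> t (-x)" and \<eta>="\<lambda>t. exp (- L * exp (- B * t))", OF _ _ _ _ _ _ _ t])
    show "continuous_on UNIV (\<lambda>x. \<theta> t x - \<theta> t (-x))" if t: "t \<in> {0..1}" for t
    proof -
      have "continuous_on UNIV (\<theta> t \<circ> uminus)"
        by (intro continuous_on_compose tameD(3)[OF tm[OF t]] continuous_intros)
      thus ?thesis using tameD(3)[OF tm[OF t]] by (intro continuous_intros) (auto simp: o_def)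
    qed
    show "\<exists>d>0. \<forall>s\<in>{0..1}. \<bar>s - t\<bar> < d \<longrightarrow> (\<forall>x. \<bar>\<theta> s x - \<theta> s (-x) - (\<theta> t x - \<theta> t (-x))\<bar> \<le> e)" if te: "t \<in> {0..1}" "e > 0" for t e
    proof -
      obtain d where d: "d > 0" "\<And>s x. s \<ge> 0 \<Longrightarrow> \<bar>s - t\<bar> < d \<Longrightarrow> \<bar>\<theta> s x - \<theta> t x\<bar> \<le> e/2"
        using uniform_continuity[of t "e/2"] te by auto
      show ?thesis
      proof (intro exI[of _ d] conjI ballI impI allI d(1))
        fix s x assume s: "s \<in> {0..1}" "\<bar>s - t\<bar> < d"
        have "\<bar>\<theta> s x - \<theta> t x\<bar> \<le> e/2" "\<bar>\<theta> s (-x) - \<theta> t (-x)\<bar> \<le> e/2" using d(2)[of s] s by auto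
        thus "\<bar>\<theta> s x - \<theta> s (-x) - (\<theta> t x - \<theta> t (-x))\<bar> \<le> e" by linarith
      qed
    qed
    show "\<exists>R. \<forall>x. R < \<bar>x\<bar> \<longrightarrow> \<theta> t x - \<theta> t (-x) < e" if te: "t \<in> {0..1}" "e > 0" for t e
    proof -
      obtain R where R: "\<And>x. R < \<bar>x\<bar> \<Longrightarrow> \<bar>\<theta> t x\<bar> < e/2" using decay[of t "e/2"] te by auto
      have "\<theta> t x - \<theta> t (-x) < e" if "R < \<bar>x\<bar>" for x using R[of x] R[of "-x"] that by auto
      thus ?thesis by blast
    qed
    show "\<theta> 0 x - \<theta> 0 (-x) < exp (- L * exp (- B * 0))" for x using init[of x] by (simp add: initial)
    show "\<exists>D D'. ((\<lambda>s. \<theta> s x - \<theta> s (-x)) has_real_derivative D) (at t) \<and>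
        ((\<lambda>t. exp (- L * exp (- B * t))) has_real_derivative D') (at t) \<and> D < D'"
      if t: "t \<in> {0<..1}" and eq: "\<theta> t x - \<theta> t (-x) = exp (- L * exp (- B * t))"
        and le: "\<And>y. \<theta> t y - \<theta> t (-y) \<le> exp (- L * exp (- B * t))" for t x
    proof -
      have t': "t \<in> {0..1}" using t by auto
      define l where "l = L * exp (- B * t)"
      \<comment> \<open>The requirement \<open>L \<ge> exp B\<close> keeps \<open>l \<ge> 1\<close>
        up to time 1, so that \<open>exp (-l)\<close> is absorbed into \<open>h * l\<close>.\<close>
      have "exp (B * t) \<le> exp B" using t B by auto
      hence "L \<ge> exp (B * t)" using L by linarith
      hence "L * exp (- B * t) \<ge> exp (B * t) * exp (- B * t)" by (rule mult_right_mono) simp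
      hence l1: "l \<ge> 1" unfolding l_def by (simp flip: exp_add)
      define h where "h = exp (-l)"
      have h: "h > 0" unfolding h_def by simp
      have le': "\<bar>\<theta> t y - \<theta> t (-y)\<bar> \<le> h" for y using le[of y] le[of "-y"] unfolding h_def l_def by auto
      have d1: "((\<lambda>y. \<theta> t y - \<theta> t (-y)) has_real_derivative (deriv (\<theta> t) x + deriv (\<theta> t) (-x))) (at x)"
        using DERIV_diff[OF tameD(1)[OF tm[OF t'], of x] DERIV_mirror[THEN iffD1, OF tameD(1)[OF tm[OF t'], of "-x"]]] by simp
      \<comment> \<open>At a maximum of the odd difference the two slopes are opposite, so the two
        transport terms combine into one slope times the sum of the Hilbert transforms, which is
        small.\<close>
      have "deriv (\<theta> t) x + deriv (\<theta> t) (-x) = 0"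
        by (rule DERIV_local_max[OF d1, of 1]) (use le eq in auto)
      hence dx: "deriv (\<theta> t) (-x) = - deriv (\<theta> t) x" by linarith
      have diss: "dissipation \<alpha> (\<theta> t) x \<ge> dissipation \<alpha> (\<theta> t) (-x)"
        by (rule dissipation_reflection[OF tm[OF t'] alpha(1) alpha_half]) (use le eq in auto)
      have t0: "t > 0" using t by simp
      let ?H = "hilbert_transform (\<theta> t) x + hilbert_transform (\<theta> t) (-x)"
      have D: "((\<lambda>s. \<theta> s x - \<theta> s (-x)) has_real_derivative
          (deriv (\<theta> t) x * ?H - (dissipation \<alpha> (\<theta> t) x - dissipation \<alpha> (\<theta> t) (-x)))) (at t)"
        using DERIV_diff[OF equation[OF t0, of x] equation[OF t0, of "-x"]] by (simp add: dx algebra_simps)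
      have D': "((\<lambda>t. exp (- L * exp (- B * t))) has_real_derivative B * l * h) (at t)"
        unfolding l_def h_def by (auto intro!: derivative_eq_intros)
      have "\<bar>?H\<bar> \<le> (12 * M + 1) * exp (-l) + 6 * h * l"
        by (rule tame_hilbert_reflection_bound[OF tm[OF t'] le']) (use l1 in auto)
      also have "\<dots> = (12 * M + 1) * h * 1 + 6 * h * l" unfolding h_def by simp
      also have "\<dots> \<le> (12 * M + 1) * h * l + 6 * h * l"
        using M0 h l1 by (intro add_right_mono mult_left_mono) auto
      finally have H: "\<bar>?H\<bar> \<le> (12 * M + 7) * (h * l)" by (simp add: algebra_simps)
      have "deriv (\<theta> t) x * ?H \<le> \<bar>deriv (\<theta> t) x\<bar> * \<bar>?H\<bar>" by (metis abs_ge_self abs_mult)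
      also have "\<dots> \<le> M * ((12 * M + 7) * (h * l))"
        using tameD(5)[OF tm[OF t']] H M0 by (intro mult_mono) auto
      also have "\<dots> < M * ((12 * M + 7) * (h * l)) + h * l" using h l1 by auto
      also have "\<dots> = B * l * h" unfolding B_def by (simp add: algebra_simps)
      finally have "deriv (\<theta> t) x * ?H - (dissipation \<alpha> (\<theta> t) x - dissipation \<alpha> (\<theta> t) (-x)) < B * l * h"
        using diss by linarith
      thus ?thesis using D D' by blast
    qed
  qed (auto intro!: continuous_intros)
  have le: "\<theta> t x - \<theta> t (-x) \<le> 0" for x
  proof (rule tendsto_lowerbound)
    have "0 < exp (- B * t)" by simp
    thus "((\<lambda>L. exp (- L * exp (- B * t))) \<longlongrightarrow> 0) at_top" by real_asymp
    show "eventually (\<lambda>L. \<theta> t x - \<theta> t (-x) \<le> exp (- L * exp (- B * t))) at_top"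
      using eventually_ge_at_top[of "exp B"] by eventually_elim (use * in \<open>auto intro: less_imp_le\<close>)
  qed simp
  show ?thesis using le[of x] le[of "-x"] by simp
qed

end

section \<open>The weight\<close>

lemma set_integrable_dominated_cont:
  fixes f g :: "real \<Rightarrow> real"
  assumes "set_integrable lborel A g" "A \<in> sets borel" "continuous_on A f"
    and "\<And>x. x \<in> A \<Longrightarrow> \<bar>f x\<bar> \<le> g x"
  shows "set_integrable lborel A f"
proof -
  have m: "set_borel_measurable lborel A f"
    unfolding set_borel_measurable_def using borel_measurable_continuous_on_indicator[OF assms(2,3)] by simp
  show 1: "set_integrable lborel A f"
    by (rule set_integrable_bound[OF assms(1) m]) (use assms(4) in force)
qed

lemma set_integrable_half_line_split:
  fixes f :: "real \<Rightarrow> real"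
  assumes "set_integrable lborel {0<..<c} f" "set_integrable lborel {c<..} f" "c > 0"
  shows "set_integrable lborel {0<..} f"
    "(LBINT x:{0<..}. f x) = (LBINT x:{0<..<c}. f x) + (LBINT x:{c<..}. f x)"
proof -
  have U: "set_integrable lborel ({0<..<c} \<union> {c<..}) f"
    by (intro set_integrable_Un) (use assms in auto)
  have VU: "(LBINT z:({0<..<c} \<union> {c<..}). f z) = (LBINT x:{0<..<c}. f x) + (LBINT x:{c<..}. f x)"
    by (subst set_integral_Un) (use assms in auto)
  have d1: "set_integrable lborel {0<..} f = set_integrable lborel ({0<..<c} \<union> {c<..}) f"
    by (rule set_integrable_discrete_difference[where X="{c}"]) (use assms(3) in auto)
  have d2: "(LBINT z:{0<..}. f z) = (LBINT z:({0<..<c} \<union> {c<..}). f z)"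
    by (rule set_integral_discrete_difference[where X="{c}"]) (use assms(3) in auto)
  show "set_integrable lborel {0<..} f" using d1 U by simp
  show "(LBINT x:{0<..}. f x) = (LBINT x:{0<..<c}. f x) + (LBINT x:{c<..}. f x)"
    using d2 VU by simp
qed

text \<open>
  The weight behaves like \<open>x\<^bsup>-w\<^esup>\<close> at the origin and is integrable at infinity. Both exponents
  have to stay below \<open>\<surd>2\<close> for the quadratic form of the nonlinearity to be coercive, and 5/4 is one
  choice in the interval between 1 and \<open>\<surd>2\<close>.
\<close>

definition wt :: "real \<Rightarrow> real \<Rightarrow> real" where
  "wt w x = 1 / (x powr w + x powr (5/4))"

text \<open>The local decay exponent of the weight, that is \<open>- x\<close> times its logarithmic
  derivative. It is a mean of \<open>w\<close> and \<open>5/4\<close> with weights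
  \<open>x powr w\<close> and \<open>x powr (5/4)\<close>, and hence lies between them.\<close>

definition wt_exponent :: "real \<Rightarrow> real \<Rightarrow> real" where
  "wt_exponent w x = (w * x powr w + 5/4 * x powr (5/4)) / (x powr w + x powr (5/4))"

lemma wt_measurable [measurable]: "wt w \<in> borel_measurable borel"
  unfolding wt_def by measurable

lemma wt_pos: "x > 0 \<Longrightarrow> wt w x > 0"
  unfolding wt_def by (auto intro!: add_pos_pos)

lemma wt_le:
  assumes "x > 0"
  shows "wt w x \<le> x powr (-w)" "wt w x \<le> x powr (-5/4)"
proof -
  have pos: "x powr w > 0" "x powr (5/4) > 0" using assms by auto
  have "1 / (x powr w + x powr (5/4)) \<le> 1 / x powr w"
    by (rule divide_left_mono) (use pos in \<open>auto intro!: mult_pos_pos add_pos_pos\<close>)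
  thus "wt w x \<le> x powr (-w)" unfolding wt_def powr_minus_divide .
  have "1 / (x powr w + x powr (5/4)) \<le> 1 / x powr (5/4)"
    by (rule divide_left_mono) (use pos in \<open>auto intro!: mult_pos_pos add_pos_pos\<close>)
  moreover have "(-5/4 :: real) = - (5/4)" by simp
  ultimately show "wt w x \<le> x powr (-5/4)" unfolding wt_def by (simp only: powr_minus_divide)
qed

lemma wt_ge:
  assumes "0 < x" "x \<le> 1" "w < 1"
  shows "x powr (-w) / 2 \<le> wt w x"
proof -
  have "x powr (5/4) \<le> x powr w" using assms by (intro powr_mono') auto
  hence "1 / (x powr w + x powr w) \<le> 1 / (x powr w + x powr (5/4))"
    using assms by (intro divide_left_mono mult_pos_pos add_pos_pos) auto
  thus ?thesis unfolding wt_def powr_minus_divide by simp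
qed

lemma wt_continuous: "continuous_on {0<..} (wt w)"
  unfolding wt_def by (intro continuous_intros) (auto simp: add_pos_pos intro!: less_imp_neq[THEN not_sym])

lemma wt_integrable:
  assumes "0 < w" "w < 1"
  shows "set_integrable lborel {0<..} (wt w)"
proof (rule set_integrable_half_line_split(1)[of 1])
  show "set_integrable lborel {0<..<1} (wt w)"
  proof (rule set_integrable_dominated(1)[OF _ _ wt_measurable])
    show "set_integrable lborel {0<..<1} (\<lambda>x. x powr (-w))"
      by (rule set_integrable_powr_from_0) (use assms in auto)
    show "\<bar>wt w x\<bar> \<le> x powr (-w)" if "x \<in> {0<..<1}" for x
      using wt_pos[of x w] wt_le(1)[of x w] that by simp
  qed simp
  show "set_integrable lborel {1<..} (wt w)"
  proof (rule set_integrable_dominated(1)[OF _ _ wt_measurable])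
    show "set_integrable lborel {1<..} (\<lambda>x::real. x powr (-5/4))"
      by (rule set_integrable_powr_at_top) auto
    show "\<bar>wt w x\<bar> \<le> x powr (-5/4)" if "x \<in> {1<..}" for x
      using wt_pos[of x w] wt_le(2)[of x w] that by simp
  qed simp
qed simp

lemma wt_bounded_integrable:
  assumes "0 < w" "w < 1" and g: "g \<in> borel_measurable borel" "\<And>x. \<bar>g x\<bar> \<le> B"
  shows "set_integrable lborel {0<..} (\<lambda>x. wt w x * g x)"
proof (rule set_integrable_dominated(1))
  show "set_integrable lborel {0<..} (\<lambda>x. B * wt w x)"
    by (intro set_integrable_mult_right wt_integrable assms)
  show "(\<lambda>x. wt w x * g x) \<in> borel_measurable borel" using g(1) by measurable
  fix x :: real assume "x \<in> {0<..}"
  thus "\<bar>wt w x * g x\<bar> \<le> B * wt w x"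
    using g(2)[of x] wt_pos[of x w] by (simp add: abs_mult mult.commute mult_left_mono)
qed simp

text \<open>Potentials of size \<open>sqrt x\<close> are to be integrated against
  \<open>wt w x * mu x\<close>; by Young's inequality the product is dominated by this function plus
  \<open>(mu x)\<^sup>2\<close>. The exponents are \<open>1 - 2 * w > -1\<close> at the origin and
  \<open>-3/2\<close> at infinity.\<close>

lemma wt_square_integrable:
  assumes "0 < w" "w < 1"
  shows "set_integrable lborel {0<..} (\<lambda>x. x * (wt w x)\<^sup>2)"
proof (rule set_integrable_half_line_split(1)[of 1])
  have *: "\<bar>x * (wt w x)\<^sup>2\<bar> \<le> x powr (1 + 2 * a)" if "x > 0" "wt w x \<le> x powr a" for x a
  proof -
    have "x * (wt w x)\<^sup>2 \<le> x * (x powr a)\<^sup>2" using that wt_pos[of x w] by (intro mult_left_mono power_mono) auto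
    also have "\<dots> = x powr 1 * (x powr a * x powr a)" using that by (simp add: power2_eq_square)
    also have "\<dots> = x powr (1 + 2 * a)" unfolding mult_2 powr_add ..
    finally show ?thesis using that by simp
  qed
  have m: "(\<lambda>x. x * (wt w x)\<^sup>2) \<in> borel_measurable borel" by measurable
  show "set_integrable lborel {0<..<1} (\<lambda>x. x * (wt w x)\<^sup>2)"
  proof (rule set_integrable_dominated(1)[OF _ _ m])
    show "set_integrable lborel {0<..<1} (\<lambda>x. x powr (1 + 2 * (-w)))"
      by (rule set_integrable_powr_from_0) (use assms in auto)
    show "\<bar>x * (wt w x)\<^sup>2\<bar> \<le> x powr (1 + 2 * (-w))" if "x \<in> {0<..<1}" for x
      using that by (intro * wt_le) auto
  qed simp
  show "set_integrable lborel {1<..} (\<lambda>x. x * (wt w x)\<^sup>2)"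
  proof (rule set_integrable_dominated(1)[OF _ _ m])
    show "set_integrable lborel {1<..} (\<lambda>x::real. x powr (1 + 2 * (-5/4)))"
      by (rule set_integrable_powr_at_top) auto
    show "\<bar>x * (wt w x)\<^sup>2\<bar> \<le> x powr (1 + 2 * (-5/4))" if "x \<in> {1<..}" for x
      using that by (intro * wt_le) auto
  qed simp
qed simp

lemma wt_deriv:
  assumes "x > 0"
  shows "(wt w has_real_derivative - wt_exponent w x * wt w x / x) (at x)"
proof -
  have p: "x powr w + x powr (5/4) > 0" using assms by (intro add_pos_pos) auto
  define a where "a = x powr w"
  define b where "b = x powr (5/4)"
  have e: "x powr (w - 1) = a / x" "x powr (5/4 - 1) = b / x" unfolding a_def b_def using powr_diff[of x w 1] powr_diff[of x "5/4" 1] assms by (simp_all only: powr_one less_imp_le)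
  have "(wt w has_real_derivative (0 * (x powr w + x powr (5/4)) - 1 * (w * x powr (w-1) + 5/4 * x powr (5/4-1))) /
      ((x powr w + x powr (5/4)) * (x powr w + x powr (5/4)))) (at x)"
    unfolding wt_def by (intro DERIV_divide DERIV_add DERIV_cmult DERIV_const has_real_derivative_powr assms less_imp_neq[THEN not_sym, OF p])
  also have "(0 * (x powr w + x powr (5/4)) - 1 * (w * x powr (w-1) + 5/4 * x powr (5/4-1))) /
      ((x powr w + x powr (5/4)) * (x powr w + x powr (5/4))) = - ((w * a + 5/4 * b) / (a + b)) * (1 / (a + b)) / x"
  proof -
    have "w * (a/x) + 5/4 * (b/x) = (w * a + 5/4 * b) / x" by (simp add: add_divide_distrib)
    thus ?thesis unfolding e a_def[symmetric] b_def[symmetric] by simp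
  qed
  finally show ?thesis unfolding wt_exponent_def a_def b_def wt_def .
qed

lemma wt_exponent_bounds:
  assumes "x > 0" "0 < w" "w < 1"
  shows "0 \<le> wt_exponent w x" "wt_exponent w x \<le> 5/4"
proof -
  have p: "x powr w + x powr (5/4) > 0" using assms by (intro add_pos_pos) auto
  show "0 \<le> wt_exponent w x" unfolding wt_exponent_def using assms p by auto
  have "w * x powr w + 5/4 * x powr (5/4) \<le> 5/4 * x powr w + 5/4 * x powr (5/4)"
    using assms by (intro add_right_mono mult_right_mono) auto
  thus "wt_exponent w x \<le> 5/4" unfolding wt_exponent_def using p by (simp add: field_simps)
qed

text \<open>In the variable \<open>ln x\<close> the slope of a mean of two exponents is their
  variance. It is nonnegative, which gives a term of the right sign in the energy estimate.\<close>

lemma wt_exponent_deriv: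
  assumes "x > 0" "0 < w" "w < 1"
  shows "(wt_exponent w has_real_derivative ((5/4 - w)\<^sup>2 * x powr w * x powr (5/4) * (wt w x)\<^sup>2) / x) (at x)"
proof -
  have p: "x powr w + x powr (5/4) > 0" using assms by (intro add_pos_pos) auto
  define a where "a = x powr w"
  define b where "b = x powr (5/4)"
  have e: "x powr (w - 1) = a / x" "x powr (5/4 - 1) = b / x" unfolding a_def b_def using powr_diff[of x w 1] powr_diff[of x "5/4" 1] assms by (simp_all only: powr_one less_imp_le)
  let ?D = "((w * (w * x powr (w-1)) + 5/4 * (5/4 * x powr (5/4-1))) * (x powr w + x powr (5/4)) -
      (w * x powr w + 5/4 * x powr (5/4)) * (w * x powr (w-1) + 5/4 * x powr (5/4-1))) / ((x powr w + x powr (5/4)) * (x powr w + x powr (5/4)))"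
  have "(wt_exponent w has_real_derivative ?D) (at x)"
    unfolding wt_exponent_def
    by (intro DERIV_divide DERIV_add DERIV_cmult DERIV_const has_real_derivative_powr assms less_imp_neq[THEN not_sym, OF p])
  also have "?D = ((w * (w * (a/x)) + 5/4 * (5/4 * (b/x))) * (a + b) - (w * a + 5/4 * b) * (w * (a/x) + 5/4 * (b/x))) / ((a + b) * (a + b))"
    unfolding e a_def[symmetric] b_def[symmetric] ..
  also have "(w * (w * (a/x)) + 5/4 * (5/4 * (b/x))) * (a + b) - (w * a + 5/4 * b) * (w * (a/x) + 5/4 * (b/x)) = (5/4 - w)\<^sup>2 * a * b / x"
    using assms by (simp add: field_simps power2_eq_square)
  also have "(5/4 - w)\<^sup>2 * a * b / x / ((a + b) * (a + b)) = ((5/4 - w)\<^sup>2 * a * b * (1 / (a + b))\<^sup>2) / x"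
    by (simp add: power2_eq_square)
  also have "\<dots> = ((5/4 - w)\<^sup>2 * x powr w * x powr (5/4) * (wt w x)\<^sup>2) / x"
    unfolding wt_def a_def b_def ..
  finally show ?thesis .
qed

section \<open>Improper integrals with a moving endpoint\<close>

lemma deriv_set_integral_head:
  fixes q :: "real \<Rightarrow> real"
  assumes c: "continuous_on {0<..} q" and i: "\<And>b. b > 0 \<Longrightarrow> set_integrable lborel {0<..b} q" and x: "x > 0"
  shows "((\<lambda>x. LBINT y:{0<..x}. q y) has_real_derivative q x) (at x)"
proof -
  have cc: "continuous_on {x/2..2*x} q" using x by (intro continuous_on_subset[OF c]) auto
  have "((\<lambda>s. integral {x/2..s} q) has_real_derivative q x) (at x within {x/2..2*x})"
    by (rule integral_has_real_derivative[OF cc]) (use x in auto)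
  hence "((\<lambda>s. integral {x/2..s} q) has_real_derivative q x) (at x)"
    using x by (subst (asm) at_within_Icc_at) auto
  hence "((\<lambda>s. (LBINT y:{0<..x/2}. q y) + integral {x/2..s} q) has_real_derivative 0 + q x) (at x)"
    by (intro DERIV_add DERIV_const)
  hence d: "((\<lambda>s. (LBINT y:{0<..x/2}. q y) + integral {x/2..s} q) has_real_derivative q x) (at x)" by simp
  show ?thesis
  proof (rule has_field_derivative_transform_within_open[OF d, of "{x/2<..<2*x}"])
    fix s assume s: "s \<in> {x/2<..<2*x}"
    have "continuous_on {x/2..s} q" using x by (intro continuous_on_subset[OF c]) auto
    hence i2: "set_integrable lborel {x/2..s} q" by (rule borel_integrable_atLeastAtMost')
    hence i3: "set_integrable lborel {x/2<..s} q" by (rule set_integrable_subset) auto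
    have "integral {x/2..s} q = (LBINT y:{x/2..s}. q y)"
      using set_borel_integral_eq_integral(2)[OF i2] by simp
    also have "\<dots> = (LBINT y:{x/2<..s}. q y)"
      by (rule set_integral_discrete_difference[where X="{x/2}"]) auto
    also have "(LBINT y:{0<..x/2}. q y) + \<dots> = (LBINT y:{0<..x/2} \<union> {x/2<..s}. q y)"
      by (subst set_integral_Un) (use i[of "x/2"] i3 x in auto)
    also have "{0<..x/2} \<union> {x/2<..s} = {0<..s}" using s x by auto
    finally show "(LBINT y:{0<..x/2}. q y) + integral {x/2..s} q = (LBINT y:{0<..s}. q y)" .
  qed (use x in auto)
qed

lemma deriv_set_integral_tail:
  fixes q :: "real \<Rightarrow> real"
  assumes c: "continuous_on {0<..} q" and i: "\<And>b. b > 0 \<Longrightarrow> set_integrable lborel {b<..} q" and x: "x > 0"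
  shows "((\<lambda>x. LBINT y:{x<..}. q y) has_real_derivative - q x) (at x)"
proof -
  have cc: "continuous_on {x/2..2*x} q" using x by (intro continuous_on_subset[OF c]) auto
  have "((\<lambda>s. integral {x/2..s} q) has_real_derivative q x) (at x within {x/2..2*x})"
    by (rule integral_has_real_derivative[OF cc]) (use x in auto)
  hence "((\<lambda>s. integral {x/2..s} q) has_real_derivative q x) (at x)"
    using x by (subst (asm) at_within_Icc_at) auto
  hence "((\<lambda>s. (LBINT y:{x/2<..}. q y) - integral {x/2..s} q) has_real_derivative 0 - q x) (at x)"
    by (intro DERIV_diff DERIV_const)
  hence d: "((\<lambda>s. (LBINT y:{x/2<..}. q y) - integral {x/2..s} q) has_real_derivative - q x) (at x)" by simp
  show ?thesis
  proof (rule has_field_derivative_transform_within_open[OF d, of "{x/2<..<2*x}"])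
    fix s assume s: "s \<in> {x/2<..<2*x}"
    have "continuous_on {x/2..s} q" using x by (intro continuous_on_subset[OF c]) auto
    hence i2: "set_integrable lborel {x/2..s} q" by (rule borel_integrable_atLeastAtMost')
    hence i3: "set_integrable lborel {x/2<..s} q" by (rule set_integrable_subset) auto
    have "integral {x/2..s} q = (LBINT y:{x/2..s}. q y)"
      using set_borel_integral_eq_integral(2)[OF i2] by simp
    also have "\<dots> = (LBINT y:{x/2<..s}. q y)"
      by (rule set_integral_discrete_difference[where X="{x/2}"]) auto
    finally have e: "integral {x/2..s} q = (LBINT y:{x/2<..s}. q y)" .
    have "{x/2<..} = {x/2<..s} \<union> {s<..}" using s x by auto
    hence "(LBINT y:{x/2<..}. q y) = (LBINT y:{x/2<..s} \<union> {s<..}. q y)" by simp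
    also have "\<dots> = (LBINT y:{x/2<..s}. q y) + (LBINT y:{s<..}. q y)"
      by (subst set_integral_Un) (use i[of s] i3 x s in auto)
    finally show "(LBINT y:{x/2<..}. q y) - integral {x/2..s} q = (LBINT y:{s<..}. q y)"
      unfolding e by simp
  qed (use x in auto)
qed

section \<open>The logarithmic kernel\<close>

lemma set_integrable_dominated_except:
  fixes f g :: "real \<Rightarrow> real"
  assumes "set_integrable lborel A g" "A \<in> sets borel" "f \<in> borel_measurable borel"
    and "\<And>x. x \<in> A \<Longrightarrow> x \<noteq> c \<Longrightarrow> \<bar>f x\<bar> \<le> g x"
  shows "set_integrable lborel A f" "\<bar>LBINT x:A. f x\<bar> \<le> (LBINT x:A. g x)"
proof -
  have d: "set_integrable lborel A f = set_integrable lborel (A - {c}) f"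
    by (rule set_integrable_discrete_difference[where X="{c}"]) auto
  have e: "(LBINT x:A. f x) = (LBINT x:A - {c}. f x)" for f :: "real \<Rightarrow> real"
    by (rule set_integral_discrete_difference[where X="{c}"]) auto
  have g: "set_integrable lborel (A - {c}) g"
    by (rule set_integrable_subset[OF assms(1)]) (use assms(2) in auto)
  have s: "A - {c} \<in> sets borel" using assms(2) by auto
  show "set_integrable lborel A f" unfolding d
    by (rule set_integrable_dominated(1)[OF g s assms(3)]) (use assms(4) in auto)
  show "\<bar>LBINT x:A. f x\<bar> \<le> (LBINT x:A. g x)" unfolding e
    by (rule set_integrable_dominated(2)[OF g s assms(3)]) (use assms(4) in auto)
qed

text \<open>
  On the diagonal \<open>log_kernel x x = ln 0 = 0\<close>, whence the side conditions \<open>y \<noteq> x\<close> below.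
\<close>

definition log_kernel :: "real \<Rightarrow> real \<Rightarrow> real" where
  "log_kernel x y = ln ((x + y) / \<bar>x - y\<bar>)"

definition ratio :: "real \<Rightarrow> real \<Rightarrow> real" where
  "ratio x y = min x y / max x y"

text \<open>These are \<open>2 / n\<close> for odd \<open>n\<close> and 0 for even \<open>n\<close>,
  including \<open>n = 0\<close>, where the numerator vanishes: the Taylor coefficients of
  \<open>2 * artanh r = ln ((1 + r) / (1 - r))\<close>.\<close>

definition artanh_coeff :: "nat \<Rightarrow> real" where
  "artanh_coeff n = (1 - (-1) ^ n) / real n"

lemma log_kernel_measurable [measurable]: "log_kernel x \<in> borel_measurable borel"
  unfolding log_kernel_def by measurable

lemma ratio_measurable [measurable]: "ratio x \<in> borel_measurable borel"
  unfolding ratio_def by measurable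

lemma artanh_coeff_nonneg: "artanh_coeff n \<ge> 0"
proof -
  have "(-1::real) ^ n \<le> \<bar>(-1) ^ n\<bar>" by (rule abs_ge_self)
  hence "(-1::real) ^ n \<le> 1" by (simp add: power_abs)
  thus ?thesis unfolding artanh_coeff_def by auto
qed

lemma artanh_sums:
  assumes "0 \<le> r" "r < (1::real)"
  shows "(\<lambda>n. artanh_coeff n * r ^ n) sums ln ((1 + r) / (1 - r))"
proof -
  have "(\<lambda>n. - ((-r)^n) / of_nat n - (- ((-(-r))^n) / of_nat n)) sums (ln (1 + r) - ln (1 + - r))"
    by (intro sums_diff ln_series') (use assms in auto)
  also have "(\<lambda>n. - ((-r)^n) / of_nat n - (- ((-(-r))^n) / of_nat n)) = (\<lambda>n. artanh_coeff n * r ^ n)"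
  proof
    fix n
    have "(-r)^n = (-1)^n * r^n" by (metis mult_minus1 power_mult_distrib)
    thus "- ((-r)^n) / of_nat n - (- ((-(-r))^n) / of_nat n) = artanh_coeff n * r ^ n"
      unfolding artanh_coeff_def by (simp add: diff_divide_distrib left_diff_distrib)
  qed
  finally show ?thesis using assms by (simp add: ln_div)
qed

lemma ratio_props:
  assumes "x > 0" "y > 0"
  shows "0 < ratio x y" "ratio x y \<le> 1" "x \<noteq> y \<Longrightarrow> ratio x y < 1"
    "x \<noteq> y \<Longrightarrow> log_kernel x y = ln ((1 + ratio x y) / (1 - ratio x y))"
proof -
  show "0 < ratio x y" "ratio x y \<le> 1" "x \<noteq> y \<Longrightarrow> ratio x y < 1"
    using assms unfolding ratio_def by (auto simp: min_def max_def)
  show "log_kernel x y = ln ((1 + ratio x y) / (1 - ratio x y))" if "x \<noteq> y"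
  proof -
    have "(x + y) / \<bar>x - y\<bar> = (1 + ratio x y) / (1 - ratio x y)"
      using assms that unfolding ratio_def min_def max_def by (auto simp: field_simps)
    thus ?thesis unfolding log_kernel_def by simp
  qed
qed

lemma artanh_partial_sum_le:
  assumes "x > 0" "y > 0" "x \<noteq> y"
  shows "(\<Sum>n<N. artanh_coeff n * ratio x y ^ n) \<le> log_kernel x y"
proof -
  note r = ratio_props[OF assms(1,2)]
  have s: "(\<lambda>n. artanh_coeff n * ratio x y ^ n) sums log_kernel x y"
    unfolding r(4)[OF assms(3)] by (rule artanh_sums) (use r assms in auto)
  have "(\<Sum>n<N. artanh_coeff n * ratio x y ^ n) \<le> (\<Sum>n. artanh_coeff n * ratio x y ^ n)"
    by (rule sum_le_suminf) (use s r(1) artanh_coeff_nonneg in \<open>auto simp: sums_iff less_imp_le\<close>)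
  thus ?thesis using s by (simp add: sums_iff)
qed

lemma ratio_le_log_kernel:
  assumes "x > 0" "y > 0" "x \<noteq> y"
  shows "ratio x y \<le> log_kernel x y"
proof -
  have "2 * ratio x y \<le> log_kernel x y"
    using artanh_partial_sum_le[OF assms, of 2] by (simp add: artanh_coeff_def eval_nat_numeral)
  thus ?thesis using ratio_props(1)[OF assms(1,2)] by linarith
qed

lemma integrable_abs_powr_half:
  assumes "x > 0"
  shows "set_integrable lborel {0<..<2*x} (\<lambda>y. \<bar>x - y\<bar> powr (-1/2))"
    "(LBINT y:{0<..<2*x}. \<bar>x - y\<bar> powr (-1/2)) = 4 * sqrt x"
proof -
  let ?g = "\<lambda>z. indicat_real {-x<..<x} z * \<bar>z\<bar> powr (-1/2)"
  have s: "set_integrable lborel {0<..<x} (\<lambda>z. z powr (-1/2))" "(LBINT z:{0<..<x}. z powr (-1/2)) = 2 * sqrt x"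
    using set_integrable_powr_from_0[of "-1/2" x] set_integral_powr_from_0[of "-1/2" x] assms by (auto simp: powr_half_sqrt)
  have e: "(\<lambda>z. indicat_real {0<..} z *\<^sub>R ?g z) = (\<lambda>z. indicat_real {0<..<x} z *\<^sub>R (z powr (-1/2)))"
    using assms by (auto simp: fun_eq_iff indicator_def)
  have i: "set_integrable lborel {0<..} ?g" "(LBINT z:{0<..}. ?g z) = 2 * sqrt x"
    using s unfolding set_integrable_def set_lebesgue_integral_def e by auto
  have ev: "?g (-z) = ?g z" for z by (auto simp: indicator_def)
  have h: "has_bochner_integral lborel ?g (4 * sqrt x)"
    using integrable_even_half_line[OF ev i(1)] i(2) by (simp add: has_bochner_integral_iff)
  have "has_bochner_integral lborel (\<lambda>y. ?g (x + (-1) * y)) (4 * sqrt x)"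
    using lborel_has_bochner_integral_real_affine_iff[of "-1" ?g "4 * sqrt x" x] h by simp
  also have "(\<lambda>y. ?g (x + (-1) * y)) = (\<lambda>y. indicat_real {0<..<2*x} y *\<^sub>R \<bar>x - y\<bar> powr (-1/2))"
    by (auto simp: fun_eq_iff indicator_def)
  finally show "set_integrable lborel {0<..<2*x} (\<lambda>y. \<bar>x - y\<bar> powr (-1/2))"
    "(LBINT y:{0<..<2*x}. \<bar>x - y\<bar> powr (-1/2)) = 4 * sqrt x"
    by (auto simp: has_bochner_integral_iff set_integrable_def set_lebesgue_integral_def)
qed

text \<open>The estimate \<open>ln u \<le> 4 * u powr (1/4)\<close> is used because its square has a
  singularity of order 1/2 on the diagonal, which is integrable.\<close>

lemma log_kernel_near_bound:
  assumes "x > 0" "0 < y" "y < 2 * x" "y \<noteq> x"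
  shows "0 \<le> log_kernel x y" "(log_kernel x y)\<^sup>2 \<le> 32 * (sqrt x * \<bar>x - y\<bar> powr (-1/2))"
proof -
  let ?u = "(x + y) / \<bar>x - y\<bar>"
  have u: "?u \<ge> 1" using assms by (auto simp: field_simps abs_if)
  show k0: "0 \<le> log_kernel x y" unfolding log_kernel_def using u by simp
  have "ln ?u = 4 * ln (?u powr (1/4))" using u by (simp add: ln_powr)
  also have "\<dots> \<le> 4 * (?u powr (1/4))" using u by (intro mult_left_mono ln_bound) auto
  finally have "(log_kernel x y)\<^sup>2 \<le> (4 * ?u powr (1/4))\<^sup>2" unfolding log_kernel_def[symmetric] using k0 by (intro power_mono) auto
  also have "\<dots> = 16 * ?u powr (1/2)"
    by (simp add: power_mult_distrib power2_eq_square flip: powr_add)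
  also have "?u powr (1/2) = sqrt (x + y) * \<bar>x - y\<bar> powr (-1/2)"
  proof -
    have m: "(-1/2::real) = - (1/2)" by simp
    have "?u powr (1/2) = (x + y) powr (1/2) / \<bar>x - y\<bar> powr (1/2)" by (rule powr_divide)
    also have "\<dots> = (x + y) powr (1/2) * \<bar>x - y\<bar> powr (-1/2)" unfolding m powr_minus_divide by simp
    finally show ?thesis using assms by (simp add: powr_half_sqrt)
  qed
  also have "sqrt (x + y) * \<bar>x - y\<bar> powr (-1/2) \<le> sqrt (4 * x) * \<bar>x - y\<bar> powr (-1/2)"
    using assms by (intro mult_right_mono) auto
  finally show "(log_kernel x y)\<^sup>2 \<le> 32 * (sqrt x * \<bar>x - y\<bar> powr (-1/2))" by (simp add: real_sqrt_mult)
qed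

lemma log_kernel_far_bound:
  assumes "x > 0" "y > 2 * x"
  shows "0 \<le> log_kernel x y" "log_kernel x y \<le> 4 * x / y"
proof -
  have u: "(x + y) / \<bar>x - y\<bar> = 1 + 2 * x / (y - x)" using assms by (simp add: field_simps)
  have p: "2 * x / (y - x) \<ge> 0" using assms by simp
  show "0 \<le> log_kernel x y" unfolding log_kernel_def u using p by simp
  have "log_kernel x y \<le> 2 * x / (y - x)" unfolding log_kernel_def u by (rule ln_add_one_self_le_self[OF p])
  also have "\<dots> \<le> 2 * x / (y / 2)" using assms by (intro divide_left_mono) auto
  finally show "log_kernel x y \<le> 4 * x / y" by simp
qed

lemma log_kernel_nonneg: "x > 0 \<Longrightarrow> y > 0 \<Longrightarrow> y \<noteq> x \<Longrightarrow> 0 \<le> log_kernel x y"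
  using ratio_le_log_kernel[of x y] ratio_props(1)[of x y] by auto

text \<open>The kernel is homogeneous of degree 0, so its square integral in \<open>y\<close> is a
  multiple of \<open>x\<close>. Young's inequality with weight \<open>sqrt x\<close> turns this into
  the factor \<open>sqrt x\<close>. The constant 68 adds 64 from \<open>y < 2 * x\<close> and 4 from
  \<open>y > 2 * x\<close>.\<close>

lemma log_kernel_integral_bound:
  fixes m :: "real \<Rightarrow> real"
  assumes x: "x > 0" and m[measurable]: "m \<in> borel_measurable borel" and i: "integrable lborel (\<lambda>y. (m y)\<^sup>2)"
    and Q: "(LBINT y. (m y)\<^sup>2) \<le> Q"
  shows "set_integrable lborel {0<..} (\<lambda>y. log_kernel x y * \<bar>m y\<bar>)"
    "(LBINT y:{0<..}. log_kernel x y * \<bar>m y\<bar>) \<le> 68 * (Q + 1) * sqrt x"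
proof -
  let ?h = "\<lambda>y. log_kernel x y * \<bar>m y\<bar>"
  have sx: "sqrt x > 0" using x by simp
  have Q0: "Q \<ge> 0" by (rule order_trans[OF _ Q]) simp
  have iA: "set_integrable lborel A (\<lambda>y. sqrt x / 2 * (m y)\<^sup>2)" if "A \<in> sets borel" for A
    by (intro set_integrable_lborel_imp integrable_mult_right i that)
  have vA: "(LBINT y:A. sqrt x / 2 * (m y)\<^sup>2) \<le> sqrt x / 2 * Q" if "A \<in> sets borel" for A
  proof -
    have "(LBINT y:A. sqrt x / 2 * (m y)\<^sup>2) \<le> (LBINT y. sqrt x / 2 * (m y)\<^sup>2)"
      by (rule set_integral_nonneg_le_integral) (use i that sx in auto)
    also have "\<dots> = sqrt x / 2 * (LBINT y. (m y)\<^sup>2)" by simp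
    also have "\<dots> \<le> sqrt x / 2 * Q" using Q sx by (intro mult_left_mono) auto
    finally show ?thesis .
  qed
  have amgm: "\<bar>?h y\<bar> \<le> sqrt x / 2 * (m y)\<^sup>2 + (log_kernel x y)\<^sup>2 / (2 * sqrt x)" for y
    using amgm_divide[OF sx, of "m y" "log_kernel x y"] by (simp add: abs_mult mult.commute add_divide_distrib)
  have i1: "set_integrable lborel {0<..<2*x} (\<lambda>y. 16 * \<bar>x - y\<bar> powr (-1/2))"
    by (rule set_integrable_mult_right[OF integrable_abs_powr_half(1)[OF x]])
  have g1: "set_integrable lborel {0<..<2*x} (\<lambda>y. sqrt x / 2 * (m y)\<^sup>2 + 16 * \<bar>x - y\<bar> powr (-1/2))"
    by (rule set_integral_add(1)[OF iA i1]) simp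
  have v1: "(LBINT y:{0<..<2*x}. sqrt x / 2 * (m y)\<^sup>2 + 16 * \<bar>x - y\<bar> powr (-1/2)) \<le> sqrt x / 2 * Q + 16 * (4 * sqrt x)"
    using vA[of "{0<..<2*x}"] integrable_abs_powr_half(2)[OF x]
    by (subst set_integral_add(2)[OF iA i1]) (simp_all only: set_integral_mult_right, simp_all)
  have b1: "\<bar>?h y\<bar> \<le> sqrt x / 2 * (m y)\<^sup>2 + 16 * \<bar>x - y\<bar> powr (-1/2)" if "y \<in> {0<..<2*x}" "y \<noteq> x" for y
  proof -
    have "(log_kernel x y)\<^sup>2 / (2 * sqrt x) \<le> 32 * (sqrt x * \<bar>x - y\<bar> powr (-1/2)) / (2 * sqrt x)"
      using log_kernel_near_bound(2)[of x y] that x sx by (intro divide_right_mono) auto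
    also have "\<dots> = 16 * \<bar>x - y\<bar> powr (-1/2)" using sx by (simp add: field_simps)
    finally show ?thesis using amgm[of y] by linarith
  qed
  have hm: "?h \<in> borel_measurable borel" by measurable
  have I1: "set_integrable lborel {0<..<2*x} ?h"
    by (rule set_integrable_dominated_except(1)[where c=x, OF g1 _ hm b1]) auto
  have I1': "\<bar>LBINT y:{0<..<2*x}. ?h y\<bar> \<le> sqrt x / 2 * Q + 16 * (4 * sqrt x)"
    by (rule order_trans[OF set_integrable_dominated_except(2)[where c=x, OF g1 _ hm b1] v1]) auto
  have x2: "0 < 2 * x" using x by simp
  have j0: "set_integrable lborel {2*x<..} (\<lambda>y. y powr (-2))" "(LBINT y:{2*x<..}. y powr (-2)) = 1 / (2 * x)"
    using set_integrable_powr_at_top[of "-2" "2*x"] set_integral_powr_at_top[of "-2" "2*x"] x by auto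
  have i2: "set_integrable lborel {2*x<..} (\<lambda>y. (8 * x\<^sup>2 / sqrt x) * y powr (-2))"
    by (rule set_integrable_mult_right[OF j0(1)])
  have g2: "set_integrable lborel {2*x<..} (\<lambda>y. sqrt x / 2 * (m y)\<^sup>2 + (8 * x\<^sup>2 / sqrt x) * y powr (-2))"
    by (rule set_integral_add(1)[OF iA i2]) simp
  have "(LBINT y:{2*x<..}. (8 * x\<^sup>2 / sqrt x) * y powr (-2)) = (8 * x\<^sup>2 / sqrt x) * (1 / (2 * x))"
    by (simp only: set_integral_mult_right j0(2))
  also have "\<dots> = 4 * sqrt x"
    using x sx by (simp add: field_simps power2_eq_square flip: power2_eq_square)
  finally have v2: "(LBINT y:{2*x<..}. sqrt x / 2 * (m y)\<^sup>2 + (8 * x\<^sup>2 / sqrt x) * y powr (-2)) \<le> sqrt x / 2 * Q + 4 * sqrt x"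
    using vA[of "{2*x<..}"] by (subst set_integral_add(2)[OF iA i2]) simp_all
  have b2: "\<bar>?h y\<bar> \<le> sqrt x / 2 * (m y)\<^sup>2 + (8 * x\<^sup>2 / sqrt x) * y powr (-2)" if "y \<in> {2*x<..}" for y
  proof -
    have y: "y > 0" using that x by simp
    have "(log_kernel x y)\<^sup>2 / (2 * sqrt x) \<le> (4 * x / y)\<^sup>2 / (2 * sqrt x)"
      using log_kernel_far_bound[of x y] that x sx by (intro divide_right_mono power_mono) auto
    also have "\<dots> = (8 * x\<^sup>2 / sqrt x) * (1 / y\<^sup>2)" using sx y by (simp add: power_divide power_mult_distrib)
    also have "1 / y\<^sup>2 = y powr (-2)" using y by (simp add: powr_minus_divide powr_numeral)
    finally show ?thesis using amgm[of y] by linarith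
  qed
  have I2: "set_integrable lborel {2*x<..} ?h"
    by (rule set_integrable_dominated(1)[OF g2 _ hm b2]) auto
  have I2': "\<bar>LBINT y:{2*x<..}. ?h y\<bar> \<le> sqrt x / 2 * Q + 4 * sqrt x"
    by (rule order_trans[OF set_integrable_dominated(2)[OF g2 _ hm b2] v2]) auto
  show "set_integrable lborel {0<..} ?h" by (rule set_integrable_half_line_split(1)[OF I1 I2 x2])
  have "(LBINT y:{0<..}. ?h y) = (LBINT y:{0<..<2*x}. ?h y) + (LBINT y:{2*x<..}. ?h y)"
    by (rule set_integrable_half_line_split(2)[OF I1 I2 x2])
  also have "\<dots> \<le> sqrt x * Q + 68 * sqrt x" using I1' I2' by linarith
  also have "\<dots> \<le> 68 * (Q + 1) * sqrt x" using Q0 sx by (simp add: algebra_simps)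
  finally show "(LBINT y:{0<..}. ?h y) \<le> 68 * (Q + 1) * sqrt x" .
qed

text \<open>
  For even \<open>f\<close> the difference \<open>f (x - z) - f (x + z)\<close> is the integral of \<open>- deriv f\<close> over
  \<open>\<bar>x - z\<bar> \<le> y \<le> x + z\<close>, which is the same as \<open>\<bar>x - y\<bar> \<le> z \<le> x + y\<close>; integrating \<open>1 / z\<close> first gives
  the logarithm.
\<close>

lemma hilbert_transform_even_log_kernel:
  assumes t: "tame M f" and ev: "\<And>y. f (-y) = f y" and x: "x > 0"
  shows "pi * hilbert_transform f x = (LBINT y:{0<..}. log_kernel x y * (- deriv f y))"
proof -
  note tD = tameD[OF t]
  define \<mu> where "\<mu> = (\<lambda>y. - deriv f y)"
  have [measurable]: "\<mu> \<in> borel_measurable borel" unfolding \<mu>_def using tD(11) by measurable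
  have mu2: "integrable lborel (\<lambda>y. (\<mu> y)\<^sup>2)" unfolding \<mu>_def using tD(8) by simp
  have cmu: "continuous_on A \<mu>" for A unfolding \<mu>_def by (intro continuous_intros tD(2))
  define h where "h = (\<lambda>y z. if 0 < y \<and> \<bar>x - y\<bar> \<le> z \<and> z \<le> x + y \<and> 0 < z then \<mu> y / z else 0)"
  have hm[measurable]: "case_prod h \<in> borel_measurable (lborel \<Otimes>\<^sub>M lborel)"
    unfolding h_def case_prod_beta by measurable
  have hz: "h y z = (if 0 < y \<and> \<bar>x - y\<bar> \<le> z \<and> z \<le> x + y \<and> 0 < z then \<mu> y / z else 0)" for y z
    unfolding h_def by simp
  have inner_z: "integrable lborel (h y)" "(LBINT z. norm (h y z)) = indicat_real {0<..} y * (log_kernel x y * \<bar>\<mu> y\<bar>)"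
      "(LBINT z. h y z) = indicat_real {0<..} y * (log_kernel x y * \<mu> y)" if y: "y \<noteq> x" for y
  proof -
    have "integrable lborel (h y) \<and> (LBINT z. norm (h y z)) = indicat_real {0<..} y * (log_kernel x y * \<bar>\<mu> y\<bar>) \<and>
       (LBINT z. h y z) = indicat_real {0<..} y * (log_kernel x y * \<mu> y)"
    proof (cases "y > 0")
      case False
      hence "h y = (\<lambda>z. 0)" by (auto simp: hz)
      thus ?thesis using False by simp
    next
      case True
      have p: "0 < \<bar>x - y\<bar>" "\<bar>x - y\<bar> \<le> x + y" using y True x by auto
      have e: "h y = (\<lambda>z. indicat_real {\<bar>x - y\<bar>..x + y} z *\<^sub>R (\<mu> y * (1/z)))"
        using p True by (auto simp: hz fun_eq_iff indicator_def)
      have e': "(\<lambda>z. norm (h y z)) = (\<lambda>z. indicat_real {\<bar>x - y\<bar>..x + y} z *\<^sub>R (\<bar>\<mu> y\<bar> * (1/z)))"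
        using p True by (auto simp: hz fun_eq_iff indicator_def abs_divide)
      have i: "set_integrable lborel {\<bar>x - y\<bar>..x + y} (\<lambda>z. c * (1/z))" for c
        using p by (intro borel_integrable_atLeastAtMost' continuous_intros) auto
      have v: "(LBINT z:{\<bar>x - y\<bar>..x + y}. c * (1/z)) = log_kernel x y * c" for c
      proof -
        have "(LBINT z:{\<bar>x - y\<bar>..x + y}. c * (1/z)) = c * ln (x + y) - c * ln \<bar>x - y\<bar>"
          using p by (intro set_integral_FTC continuous_intros) (auto intro!: derivative_eq_intros)
        also have "\<dots> = log_kernel x y * c" unfolding log_kernel_def using p True x
          by (simp add: ln_div algebra_simps)
        finally show ?thesis .
      qed
      show ?thesis using i[of "\<mu> y"] v[of "\<mu> y"] v[of "\<bar>\<mu> y\<bar>"] True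
        unfolding e' unfolding e by (simp add: set_integrable_def set_lebesgue_integral_def)
    qed
    thus "integrable lborel (h y)" "(LBINT z. norm (h y z)) = indicat_real {0<..} y * (log_kernel x y * \<bar>\<mu> y\<bar>)"
      "(LBINT z. h y z) = indicat_real {0<..} y * (log_kernel x y * \<mu> y)" by auto
  qed
  have nx: "AE y in lborel. y \<noteq> x" by (rule AE_lborel_singleton)
  have I: "integrable (lborel \<Otimes>\<^sub>M lborel) (case_prod h)"
  proof (rule lborel_pair.Fubini_integrable[OF hm])
    have k: "integrable lborel (\<lambda>y. indicat_real {0<..} y * (log_kernel x y * \<bar>\<mu> y\<bar>))"
      using log_kernel_integral_bound(1)[OF x _ mu2 order_refl] by (simp add: set_integrable_def)
    have "(\<lambda>y. LBINT z. norm (case_prod h (y, z))) \<in> borel_measurable lborel"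
      by measurable
    thus "integrable lborel (\<lambda>y. LBINT z. norm (case_prod h (y, z)))"
      by (subst integrable_cong_AE[where g="\<lambda>y. indicat_real {0<..} y * (log_kernel x y * \<bar>\<mu> y\<bar>)"])
        (use nx k inner_z(2) in \<open>auto elim!: eventually_mono\<close>)
    show "AE y in lborel. integrable lborel (\<lambda>z. case_prod h (y, z))"
      using nx by eventually_elim (use inner_z(1) in simp)
  qed
  have inner_y: "(LBINT y. h y z) = indicat_real {0<..} z * ((f (x - z) - f (x + z)) / z)" for z
  proof (cases "z > 0")
    case False
    hence "(\<lambda>y. h y z) = (\<lambda>y. 0)" by (auto simp: hz)
    thus ?thesis using False by simp
  next
    case True
    have AE: "AE y in lborel. h y z = indicat_real {\<bar>x - z\<bar>..x + z} y *\<^sub>R (\<mu> y * (1/z))"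
      using AE_lborel_singleton[of 0] by eventually_elim (use True in \<open>auto simp: hz indicator_def abs_le_iff\<close>)
    have "(LBINT y. h y z) = (LBINT y:{\<bar>x - z\<bar>..x + z}. \<mu> y * (1/z))"
      unfolding set_lebesgue_integral_def
      by (rule integral_cong_AE[OF _ _ AE]) measurable
    also have "\<dots> = - f (x + z) * (1/z) - - f \<bar>x - z\<bar> * (1/z)"
      using x True by (intro set_integral_FTC continuous_intros cmu) (auto intro!: derivative_eq_intros tD(1) simp: \<mu>_def)
    \<comment> \<open>Evenness enters here: for \<open>z > x\<close> the interval of integration in
      \<open>y\<close> starts at \<open>z - x\<close> instead of \<open>x - z\<close>.\<close>
    also have "f \<bar>x - z\<bar> = f (x - z)" using ev[of "x - z"] by (auto simp: abs_if)
    finally show ?thesis using True by (simp add: diff_divide_distrib)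
  qed
  have "pi * hilbert_transform f x = (LBINT z:{0<..}. (f (x - z) - f (x + z)) / z)"
    unfolding hilbert_transform_tame(2)[OF t] by simp
  also have "\<dots> = (LBINT z. (LBINT y. h y z))"
    unfolding inner_y set_lebesgue_integral_def by simp
  also have "\<dots> = (LBINT y. (LBINT z. h y z))"
    by (rule lborel_pair.Fubini_integral[OF I])
  also have "\<dots> = (LBINT y. indicat_real {0<..} y * (log_kernel x y * \<mu> y))"
  proof (rule integral_cong_AE)
    show "AE y in lborel. (LBINT z. h y z) = indicat_real {0<..} y * (log_kernel x y * \<mu> y)"
      using nx by eventually_elim (use inner_z(3) in simp)
    show "(\<lambda>y. LBINT z. h y z) \<in> borel_measurable lborel" by measurable
  qed measurable
  finally show ?thesis unfolding set_lebesgue_integral_def \<mu>_def by simp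
qed

section \<open>Coercivity of the weighted nonlinearity\<close>

locale even_profile =
  fixes w M :: real and f :: "real \<Rightarrow> real"
  assumes tame: "tame M f" and even_f: "\<And>x. f (-x) = f x" and w: "0 < w" "w < 1"
begin

text \<open>
  \<open>F n\<close> and \<open>G n\<close> are the contributions of \<open>y \<le> x\<close> and \<open>y > x\<close> to the potential of \<open>mu\<close> with kernel
  \<open>ratio x y ^ n\<close>. In the variable \<open>\<tau> = ln x\<close> this kernel is \<open>exp (- n \<bar>\<tau> - \<tau>'\<bar>)\<close>, a Green's function:
  \<open>V = F n + G n\<close> solves \<open>V'' = n\<^sup>2 V - 2 n x mu\<close>. Testing this equation with \<open>wt w x * V\<close> gives the
  energy inequality.
\<close>

definition mu where "mu y = - deriv f y"
definition Q where "Q = (LBINT y. (mu y)\<^sup>2)"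
text \<open>The constant contains the square integral of the derivative and is not uniform in time.
  It occurs in majorants and in boundary terms that vanish in the limit, but not in the coercivity
  and gap estimates.\<close>

definition C where "C = 68 * (Q + 1)"
definition F where "F n x = (LBINT y:{0<..x}. y ^ n * mu y) / x ^ n"
definition G where "G n x = x ^ n * (LBINT y:{x<..}. mu y / y ^ n)"

lemma mu_measurable [measurable]: "mu \<in> borel_measurable borel"
  unfolding mu_def using tameD(11)[OF tame] by measurable

lemma mu_continuous: "continuous_on A mu"
  unfolding mu_def by (intro continuous_intros tameD(2)[OF tame])

lemma mu_square_integrable: "integrable lborel (\<lambda>y. (mu y)\<^sup>2)"
  unfolding mu_def using tameD(8)[OF tame] by simp

lemma Q_nonneg: "Q \<ge> 0" unfolding Q_def by simp

lemma C_pos: "C > 0" unfolding C_def using Q_nonneg by simp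

lemmas kernel_bound = log_kernel_integral_bound[OF _ mu_measurable mu_square_integrable order_refl, folded Q_def, folded C_def]

lemma F_integrable: "set_integrable lborel {0<..x} (\<lambda>y. y ^ n * mu y)"
proof -
  have "set_integrable lborel {0..x} (\<lambda>y. y ^ n * mu y)"
    by (intro borel_integrable_atLeastAtMost' continuous_intros mu_continuous)
  thus ?thesis by (rule set_integrable_subset) auto
qed

lemma ratio_power_le:
  assumes "n \<ge> 1" "x > 0" "y > 0" "y \<noteq> x"
  shows "\<bar>ratio x y ^ n * mu y\<bar> \<le> log_kernel x y * \<bar>mu y\<bar>"
proof -
  note r = ratio_props[OF assms(2,3)]
  have "ratio x y ^ n \<le> ratio x y ^ 1" using r assms by (intro power_decreasing) auto
  also have "\<dots> \<le> log_kernel x y" using ratio_le_log_kernel[of x y] assms by auto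
  finally show ?thesis using r by (simp add: abs_mult mult_right_mono)
qed

lemma G_integrable:
  assumes "n \<ge> 1" "x > 0"
  shows "set_integrable lborel {x<..} (\<lambda>y. mu y / y ^ n)"
proof -
  have k: "set_integrable lborel {x<..} (\<lambda>y. log_kernel x y * \<bar>mu y\<bar>)"
    by (rule set_integrable_subset[OF kernel_bound(1)[OF assms(2)]]) (use assms in auto)
  have m: "(\<lambda>y. ratio x y ^ n * mu y) \<in> borel_measurable borel" by measurable
  have "set_integrable lborel {x<..} (\<lambda>y. ratio x y ^ n * mu y)"
    by (rule set_integrable_dominated(1)[OF k _ m]) (use ratio_power_le assms in auto)
  hence "set_integrable lborel {x<..} (\<lambda>y. (1 / x ^ n) * (ratio x y ^ n * mu y))" by (rule set_integrable_mult_right)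
  also have "?this \<longleftrightarrow> ?thesis"
    by (rule set_integrable_cong) (use assms in \<open>auto simp: ratio_def power_divide\<close>)
  finally show ?thesis .
qed

lemma FG_ratio:
  assumes "n \<ge> 1" "x > 0"
  shows "F n x = (LBINT y:{0<..x}. ratio x y ^ n * mu y)"
    "G n x = (LBINT y:{x<..}. ratio x y ^ n * mu y)"
    "set_integrable lborel {0<..x} (\<lambda>y. ratio x y ^ n * mu y)"
    "set_integrable lborel {x<..} (\<lambda>y. ratio x y ^ n * mu y)"
    "set_integrable lborel {0<..} (\<lambda>y. ratio x y ^ n * mu y)"
    "F n x + G n x = (LBINT y:{0<..}. ratio x y ^ n * mu y)"
    "\<bar>F n x\<bar> \<le> C * sqrt x" "\<bar>G n x\<bar> \<le> C * sqrt x"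
proof -
  have m: "(\<lambda>y. ratio x y ^ n * mu y) \<in> borel_measurable borel" by measurable
  note k = kernel_bound[OF assms(2)]
  show i: "set_integrable lborel {0<..} (\<lambda>y. ratio x y ^ n * mu y)"
    by (rule set_integrable_dominated_except(1)[OF k(1) _ m, of x]) (use ratio_power_le assms in auto)
  show i1: "set_integrable lborel {0<..x} (\<lambda>y. ratio x y ^ n * mu y)" by (rule set_integrable_subset[OF i]) auto
  show i2: "set_integrable lborel {x<..} (\<lambda>y. ratio x y ^ n * mu y)" by (rule set_integrable_subset[OF i]) (use assms in auto)
  show F: "F n x = (LBINT y:{0<..x}. ratio x y ^ n * mu y)"
    unfolding F_def set_integral_divide_zero[symmetric]
    by (rule set_lebesgue_integral_cong) (use assms in \<open>auto simp: ratio_def min_def max_def power_divide\<close>)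
  show G: "G n x = (LBINT y:{x<..}. ratio x y ^ n * mu y)"
    unfolding G_def set_integral_mult_right[symmetric]
    by (rule set_lebesgue_integral_cong) (use assms in \<open>auto simp: ratio_def min_def max_def power_divide\<close>)
  have U: "{0<..} = {0<..x} \<union> {x<..}" using assms by auto
  show "F n x + G n x = (LBINT y:{0<..}. ratio x y ^ n * mu y)"
    unfolding F G U by (rule set_integral_Un[symmetric]) (use i1 i2 in auto)
  have sub: "(LBINT y:A. log_kernel x y * \<bar>mu y\<bar>) \<le> C * sqrt x" if A: "A \<subseteq> {0<..}" "A \<in> sets borel" for A
  proof -
    have e: "(LBINT y:A. log_kernel x y * \<bar>mu y\<bar>) = (LBINT y:A - {x}. log_kernel x y * \<bar>mu y\<bar>)" for A
      by (rule set_integral_discrete_difference[where X="{x}"]) auto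
    have "(LBINT y:A - {x}. log_kernel x y * \<bar>mu y\<bar>) \<le> (LBINT y:{0<..} - {x}. log_kernel x y * \<bar>mu y\<bar>)"
    proof (rule set_integral_nonneg_mono_set)
      show "set_integrable lborel ({0<..} - {x}) (\<lambda>y. log_kernel x y * \<bar>mu y\<bar>)"
        by (rule set_integrable_subset[OF k(1)]) auto
    qed (use A assms log_kernel_nonneg[of x] in auto)
    thus ?thesis using k(2) e by simp
  qed
  have "\<bar>LBINT y:{0<..x}. ratio x y ^ n * mu y\<bar> \<le> (LBINT y:{0<..x}. log_kernel x y * \<bar>mu y\<bar>)"
  proof (rule set_integrable_dominated_except(2)[OF _ _ m, of _ _ x])
    show "set_integrable lborel {0<..x} (\<lambda>y. log_kernel x y * \<bar>mu y\<bar>)" by (rule set_integrable_subset[OF k(1)]) auto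
  qed (use ratio_power_le assms in auto)
  thus "\<bar>F n x\<bar> \<le> C * sqrt x" unfolding F by (rule order_trans[OF _ sub]) auto
  have "\<bar>LBINT y:{x<..}. ratio x y ^ n * mu y\<bar> \<le> (LBINT y:{x<..}. log_kernel x y * \<bar>mu y\<bar>)"
  proof (rule set_integrable_dominated_except(2)[OF _ _ m, of _ _ x])
    show "set_integrable lborel {x<..} (\<lambda>y. log_kernel x y * \<bar>mu y\<bar>)" by (rule set_integrable_subset[OF k(1)]) (use assms in auto)
  qed (use ratio_power_le assms in auto)
  thus "\<bar>G n x\<bar> \<le> C * sqrt x" unfolding G by (rule order_trans[OF _ sub]) (use assms in auto)
qed

lemma F_deriv:
  assumes "x > 0"
  shows "(F n has_real_derivative mu x - real n * F n x / x) (at x)"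
proof -
  let ?H = "\<lambda>x. LBINT y:{0<..x}. y ^ n * mu y"
  have H: "(?H has_real_derivative x ^ n * mu x) (at x)"
    by (rule deriv_set_integral_head[OF _ F_integrable assms]) (intro continuous_intros mu_continuous)
  have P: "((\<lambda>x. x ^ n) has_real_derivative real n * x ^ (n - 1)) (at x)"
    by (auto intro!: derivative_eq_intros)
  have "(F n has_real_derivative (x ^ n * mu x * x ^ n - ?H x * (real n * x ^ (n - 1))) / (x ^ n * x ^ n)) (at x)"
    unfolding F_def[abs_def] using assms by (intro DERIV_divide H P) auto
  also have "(x ^ n * mu x * x ^ n - ?H x * (real n * x ^ (n - 1))) / (x ^ n * x ^ n) = mu x - real n * F n x / x"
  proof (cases n)
    case (Suc k)
    thus ?thesis unfolding F_def using assms by (simp add: field_simps)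
  qed (use assms in \<open>simp add: F_def\<close>)
  finally show ?thesis .
qed

lemma G_deriv:
  assumes "x > 0" "n \<ge> 1"
  shows "(G n has_real_derivative real n * G n x / x - mu x) (at x)"
proof -
  let ?T = "\<lambda>x. LBINT y:{x<..}. mu y / y ^ n"
  have T: "(?T has_real_derivative - (mu x / x ^ n)) (at x)"
    by (rule deriv_set_integral_tail[OF _ G_integrable[OF assms(2)] assms(1)]) (auto intro!: continuous_intros mu_continuous)
  have P: "((\<lambda>x. x ^ n) has_real_derivative real n * x ^ (n - 1)) (at x)"
    by (auto intro!: derivative_eq_intros)
  have "(G n has_real_derivative real n * x ^ (n - 1) * ?T x + - (mu x / x ^ n) * x ^ n) (at x)"
    unfolding G_def[abs_def] by (intro DERIV_mult P T)
  also have "real n * x ^ (n - 1) * ?T x + - (mu x / x ^ n) * x ^ n = real n * G n x / x - mu x"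
    using assms by (cases n) (simp_all add: G_def)
  finally show ?thesis .
qed

lemma F_continuous: "continuous_on {0<..} (F n)"
  using F_deriv by (intro continuous_at_imp_continuous_on ballI DERIV_isCont) auto

lemma G_continuous: "n \<ge> 1 \<Longrightarrow> continuous_on {0<..} (G n)"
  using G_deriv by (intro continuous_at_imp_continuous_on ballI DERIV_isCont) auto

lemma wt_mu_integrable: "set_integrable lborel {0<..} (\<lambda>x. C * (x * (wt w x)\<^sup>2 + (mu x)\<^sup>2))"
  by (intro set_integrable_mult_right set_integral_add(1) wt_square_integrable w set_integrable_lborel_imp mu_square_integrable) auto

text \<open>One integrable majorant for all pairings of \<open>wt w x * mu x\<close> with a function
  of size \<open>sqrt x\<close>: single potentials, partial sums of the series and their limit, the
  Hilbert transform.\<close>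

lemma wt_mu_dominated:
  assumes "x > 0" "\<bar>v\<bar> \<le> 2 * (C * sqrt x)"
  shows "\<bar>wt w x * mu x * v\<bar> \<le> C * (x * (wt w x)\<^sup>2 + (mu x)\<^sup>2)"
proof -
  have "\<bar>wt w x * mu x * v\<bar> \<le> \<bar>wt w x * mu x\<bar> * (2 * (C * sqrt x))"
    unfolding abs_mult[of _ v] using assms by (intro mult_left_mono) auto
  also have "\<dots> = C * (2 * \<bar>(sqrt x * wt w x) * mu x\<bar>)" using assms by (simp add: abs_mult)
  also have "\<dots> \<le> C * ((sqrt x * wt w x)\<^sup>2 + (mu x)\<^sup>2)"
    using amgm_divide[of 1 "sqrt x * wt w x" "mu x"] C_pos by (intro mult_left_mono) auto
  also have "(sqrt x * wt w x)\<^sup>2 = x * (wt w x)\<^sup>2" using assms by (simp add: power_mult_distrib)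
  finally show ?thesis .
qed

lemma V_bound: "n \<ge> 1 \<Longrightarrow> x > 0 \<Longrightarrow> \<bar>F n x + G n x\<bar> \<le> 2 * (C * sqrt x)"
  using FG_ratio(7,8)[of n x] by linarith

lemma wt_mu_V_integrable:
  assumes "n \<ge> 1"
  shows "set_integrable lborel {0<..} (\<lambda>x. wt w x * mu x * (F n x + G n x))"
  by (rule set_integrable_dominated_cont[OF wt_mu_integrable])
    (use assms V_bound wt_mu_dominated in \<open>auto intro!: continuous_intros wt_continuous mu_continuous F_continuous G_continuous\<close>)

lemma wt_F_square_integrable:
  assumes "n \<ge> 1"
  shows "set_integrable lborel {0<..} (\<lambda>x. wt w x / x * (F n x)\<^sup>2)"
proof (rule set_integrable_dominated_cont)
  show "set_integrable lborel {0<..} (\<lambda>x. C\<^sup>2 * wt w x)"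
    by (intro set_integrable_mult_right wt_integrable w)
  show "continuous_on {0<..} (\<lambda>x. wt w x / x * (F n x)\<^sup>2)"
    by (intro continuous_intros wt_continuous F_continuous) auto
  fix x :: real assume "x \<in> {0<..}"
  hence x: "x > 0" by simp
  have "(F n x)\<^sup>2 \<le> (C * sqrt x)\<^sup>2" using FG_ratio(7)[OF assms x] by (metis abs_ge_zero power2_abs power_mono)
  also have "\<dots> = C\<^sup>2 * x" using x by (simp add: power_mult_distrib)
  finally have "wt w x / x * (F n x)\<^sup>2 \<le> wt w x / x * (C\<^sup>2 * x)" using x wt_pos[OF x, of w] by (intro mult_left_mono) auto
  thus "\<bar>wt w x / x * (F n x)\<^sup>2\<bar> \<le> C\<^sup>2 * wt w x" using x wt_pos[OF x, of w] by (simp add: mult.commute)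
qed auto

end

text \<open>Once the reciprocals of \<open>x\<close> and of 2 are named, this is a polynomial
  identity. It collects the derivative of the energy
  \<open>wt w x * (V * U + p * V\<^sup>2 / 2)\<close>, where \<open>p\<close> and
  \<open>q / x\<close> are the weight exponent and its derivative.\<close>

lemma energy_derivative_identity:
  fixes x :: real
  shows "(- p * W / x) * (V * U + p * V\<^sup>2 / 2) +
    (U / x * U + ((N\<^sup>2 * V - 2 * N * x * m) / x) * V + (q / x * V\<^sup>2 + 2 * V * (U / x) * p) / 2) * W =
    W / x * (- p * (V * U + p * V\<^sup>2 / 2) + U\<^sup>2 + (N\<^sup>2 * V - 2 * N * x * m) * V + q * V\<^sup>2 / 2 + p * V * U)"
proof -
  have *: "(- p * W * i) * (V * U + p * V\<^sup>2 * h) +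
    (U * i * U + ((N\<^sup>2 * V - 2 * N * x * m) * i) * V + (q * i * V\<^sup>2 + 2 * V * (U * i) * p) * h) * W =
    W * i * (- p * (V * U + p * V\<^sup>2 * h) + U\<^sup>2 + (N\<^sup>2 * V - 2 * N * x * m) * V + q * V\<^sup>2 * h + p * V * U)"
    if "2 * h = 1" for i h using that by algebra
  show ?thesis unfolding divide_inverse by (rule *) simp
qed

text \<open>The terms with \<open>m\<close> cancel, and so do the cross terms
  \<open>p * V * U\<close>. Only squares remain, which can be compared pointwise.\<close>

lemma energy_density_identity:
  fixes x :: real
  assumes "x \<noteq> 0"
  shows "2 * N * (W * m * V) - c * (W / x * F\<^sup>2) +
    W / x * (- p * (V * U + p * V\<^sup>2 / 2) + U\<^sup>2 + (N\<^sup>2 * V - 2 * N * x * m) * V + q * V\<^sup>2 / 2 + p * V * U) =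
    W / x * (U\<^sup>2 + N\<^sup>2 * V\<^sup>2 + (q * V\<^sup>2 - p\<^sup>2 * V\<^sup>2) / 2 - c * F\<^sup>2)"
proof -
  have *: "2 * N * (W * m * V) - c * (W * i * F\<^sup>2) +
    W * i * (- p * (V * U + p * V\<^sup>2 * h) + U\<^sup>2 + (N\<^sup>2 * V - 2 * N * x * m) * V + q * V\<^sup>2 * h + p * V * U) =
    W * i * (U\<^sup>2 + N\<^sup>2 * V\<^sup>2 + (q * V\<^sup>2 - p\<^sup>2 * V\<^sup>2) * h - c * F\<^sup>2)"
    if "2 * h = 1" "x * i = 1" for i h using that by algebra
  show ?thesis unfolding divide_inverse by (rule *) (use assms in simp_all)
qed

context even_profile begin

text \<open>With \<open>U = x * V'\<close> one has \<open>U\<^sup>2 + n\<^sup>2 * V\<^sup>2 = 2 *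
  n\<^sup>2 * (F\<^sup>2 + G\<^sup>2)\<close>, so the energy density splits into the parts from the
  left and from the right of \<open>x\<close>. The weight costs at most
  \<open>25/16 * (F\<^sup>2 + G\<^sup>2)\<close>, and for \<open>n = 1\<close> positivity amounts to
  \<open>25/16 < 2\<close>, which is where exponents below \<open>\<surd>2\<close> are required. The
  contribution of \<open>G\<close> is then dropped.\<close>

lemma energy_inequality:
  assumes n: "n \<ge> 1"
  shows "2 * real n * (LBINT x:{0<..}. wt w x * mu x * (F n x + G n x)) \<ge>
     (2 * (real n)\<^sup>2 - 25/16) * (LBINT x:{0<..}. wt w x / x * (F n x)\<^sup>2)"
proof -
  define V where "V x = F n x + G n x" for x
  define U where "U x = real n * (G n x - F n x)" for x
  define p where "p = wt_exponent w"
  define p' where "p' x = (5/4 - w)\<^sup>2 * x powr w * x powr (5/4) * (wt w x)\<^sup>2" for x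
  \<comment> \<open>\<open>V * U\<close> is the boundary term of the plain integration by parts.
    Differentiating the weight leaves a cross term in \<open>V * U\<close>; the second summand is
    its own integration by parts and replaces it by
    \<open>(p' - p\<^sup>2) * V\<^sup>2 / 2\<close>.\<close>
  define E where "E x = wt w x * (V x * U x + p x * (V x)\<^sup>2 / 2)" for x
  define E' where "E' x = wt w x / x * (- p x * (V x * U x + p x * (V x)\<^sup>2 / 2) + (U x)\<^sup>2 +
     ((real n)\<^sup>2 * V x - 2 * real n * x * mu x) * V x + p' x * (V x)\<^sup>2 / 2 + p x * V x * U x)" for x
  define c where "c = 2 * (real n)\<^sup>2 - 25/16"
  have n2: "1 \<le> (real n)\<^sup>2" using n by simp
  have c: "c \<ge> 0" unfolding c_def using n2 by linarith
  have dV: "(V has_real_derivative U x / x) (at x)" if "x > 0" for x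
  proof -
    have "(V has_real_derivative (mu x - real n * F n x / x) + (real n * G n x / x - mu x)) (at x)"
      unfolding V_def[abs_def] by (intro DERIV_add F_deriv G_deriv that n)
    thus ?thesis unfolding U_def by (simp add: diff_divide_distrib right_diff_distrib)
  qed
  have dU: "(U has_real_derivative ((real n)\<^sup>2 * V x - 2 * real n * x * mu x) / x) (at x)" if "x > 0" for x
  proof -
    have "(U has_real_derivative real n * ((real n * G n x / x - mu x) - (mu x - real n * F n x / x))) (at x)"
      unfolding U_def[abs_def] by (intro DERIV_cmult DERIV_diff F_deriv G_deriv that n)
    also have "real n * ((real n * G n x / x - mu x) - (mu x - real n * F n x / x)) = ((real n)\<^sup>2 * V x - 2 * real n * x * mu x) / x"
      unfolding V_def using that by (simp add: field_simps power2_eq_square)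
    finally show ?thesis .
  qed
  have dp: "(p has_real_derivative p' x / x) (at x)" if "x > 0" for x
    unfolding p_def p'_def by (rule wt_exponent_deriv[OF that w])
  have dE: "(E has_real_derivative E' x) (at x)" if x: "x > 0" for x
  proof -
    have dV2: "((\<lambda>x. (V x)\<^sup>2) has_real_derivative 2 * V x * (U x / x)) (at x)"
      using DERIV_mult[OF dV[OF x] dV[OF x]] by (simp add: power2_eq_square mult_ac)
    have "(E has_real_derivative (- wt_exponent w x * wt w x / x) * (V x * U x + p x * (V x)\<^sup>2 / 2) +
       (U x / x * U x + (((real n)\<^sup>2 * V x - 2 * real n * x * mu x) / x) * V x +
         (p' x / x * (V x)\<^sup>2 + 2 * V x * (U x / x) * p x) / 2) * wt w x) (at x)"
      unfolding E_def[abs_def]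
      by (rule DERIV_mult[OF wt_deriv[OF x] DERIV_add[OF DERIV_mult[OF dV[OF x] dU[OF x]] DERIV_cdivide[OF DERIV_mult[OF dp[OF x] dV2]]]])
    also have "(- wt_exponent w x * wt w x / x) * (V x * U x + p x * (V x)\<^sup>2 / 2) +
       (U x / x * U x + (((real n)\<^sup>2 * V x - 2 * real n * x * mu x) / x) * V x +
         (p' x / x * (V x)\<^sup>2 + 2 * V x * (U x / x) * p x) / 2) * wt w x = E' x"
      unfolding E'_def p_def by (rule energy_derivative_identity)
    finally show ?thesis .
  qed
  have cV: "continuous_on {0<..} V" "continuous_on {0<..} U" unfolding V_def[abs_def] U_def[abs_def]
    by (intro continuous_intros F_continuous G_continuous n)+
  have cp: "continuous_on {0<..} p"
    using dp by (intro continuous_at_imp_continuous_on ballI DERIV_isCont) auto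
  have cp': "continuous_on {0<..} p'" unfolding p'_def[abs_def]
    by (intro continuous_intros wt_continuous) auto
  have cE': "continuous_on {0<..} E'" unfolding E'_def[abs_def]
    by (intro continuous_intros cV cp cp' wt_continuous mu_continuous) auto
  let ?q = "\<lambda>x. 2 * real n * (wt w x * mu x * V x) - c * (wt w x / x * (F n x)\<^sup>2)"
  have qi: "set_integrable lborel {0<..} ?q"
    unfolding V_def by (intro set_integral_diff(1) set_integrable_mult_right wt_mu_V_integrable wt_F_square_integrable n)
  have key: "?q x + E' x \<ge> 0" if x: "x > 0" for x
  proof -
    have wp: "wt w x / x > 0" using wt_pos[OF x] x by simp
    note pb = wt_exponent_bounds[OF x w, folded p_def]
    have p2: "(p x)\<^sup>2 \<le> 25/16" using power_mono[OF pb(2,1), of 2] by (simp add: power2_eq_square)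
    have p'0: "p' x \<ge> 0" unfolding p'_def by simp
    define X where "X = (F n x)\<^sup>2 + (G n x)\<^sup>2"
    have VFG: "(V x)\<^sup>2 \<le> 2 * X"
      unfolding V_def X_def using zero_le_power2[of "F n x - G n x"] by (simp add: power2_eq_square algebra_simps)
    \<comment> \<open>Here \<open>y\<close> stands for \<open>X = F\<^sup>2 + G\<^sup>2\<close>:
      half of \<open>p\<^sup>2 * V\<^sup>2\<close> is at most \<open>25/16 * X\<close>, and what is
      left of \<open>2 * n\<^sup>2 * X\<close> is exactly \<open>c * X\<close>.\<close>
    have gen: "0 \<le> u + (q - r) / 2 - g" if "r \<le> 25/16 * v" "0 \<le> q" "u = 2 * s" "cX = 2 * s - 25/16 * y" "g \<le> cX" "v \<le> 2 * y"
      for u q r g v s cX y :: real using that by (simp add: field_simps)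
    have "(p x)\<^sup>2 * (V x)\<^sup>2 \<le> 25/16 * (V x)\<^sup>2" using p2 by (intro mult_right_mono) auto
    moreover have "p' x * (V x)\<^sup>2 \<ge> 0" using p'0 by simp
    moreover have "(U x)\<^sup>2 + (real n)\<^sup>2 * (V x)\<^sup>2 = 2 * ((real n)\<^sup>2 * X)"
      unfolding U_def V_def X_def by (simp add: power2_eq_square algebra_simps)
    moreover have "c * X = 2 * ((real n)\<^sup>2 * X) - 25/16 * X"
      unfolding c_def by (simp add: algebra_simps)
    moreover have "c * (F n x)\<^sup>2 \<le> c * X" unfolding X_def using c by (intro mult_left_mono) auto
    ultimately have *: "(U x)\<^sup>2 + (real n)\<^sup>2 * (V x)\<^sup>2 + (p' x * (V x)\<^sup>2 - (p x)\<^sup>2 * (V x)\<^sup>2) / 2 - c * (F n x)\<^sup>2 \<ge> 0"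
      using VFG by (rule gen)
    have "?q x + E' x = wt w x / x * ((U x)\<^sup>2 + (real n)\<^sup>2 * (V x)\<^sup>2 + (p' x * (V x)\<^sup>2 - (p x)\<^sup>2 * (V x)\<^sup>2) / 2 - c * (F n x)\<^sup>2)"
      unfolding E'_def by (rule energy_density_identity) (use x in simp)
    also have "\<dots> \<ge> 0" by (rule mult_nonneg_nonneg[OF less_imp_le[OF wp] *])
    finally show ?thesis .
  qed
  have ineq: "(LBINT x:{e..1/e} \<inter> {0<..}. ?q x) \<ge> E e - E (1/e)" if e: "0 < e" "e < 1" for e
  proof -
    have e1: "e \<le> 1/e" using e by (simp add: field_simps mult_le_one)
    have s: "{e..1/e} \<inter> {0<..} = {e..1/e}" using e by auto
    have i: "set_integrable lborel {e..1/e} ?q" by (rule set_integrable_subset[OF qi]) (use e in auto)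
    have cc: "continuous_on {e..1/e} E'" by (rule continuous_on_subset[OF cE']) (use e in auto)
    have v: "(LBINT x:{e..1/e}. E' x) = E (1/e) - E e"
      by (rule set_integral_FTC[OF e1 dE cc]) (use e in auto)
    have "0 \<le> (LBINT x:{e..1/e}. ?q x + E' x)"
      by (rule set_integral_nonneg') (rule key, use e in auto)
    also have "\<dots> = (LBINT x:{e..1/e}. ?q x) + (E (1/e) - E e)"
      by (subst set_integral_add(2)[OF i borel_integrable_atLeastAtMost'[OF cc]]) (simp add: v)
    finally show ?thesis unfolding s by simp
  qed
  \<comment> \<open>Both boundary terms are of order \<open>x * wt w x\<close>, which vanishes like
    \<open>x powr (1 - w)\<close> at the origin and like \<open>x powr (-1/4)\<close> at
    infinity.\<close>
  have Eb: "\<bar>E x\<bar> \<le> (4 * real n + 3) * C\<^sup>2 * (x * wt w x)" if x: "x > 0" for x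
  proof -
    note pb = wt_exponent_bounds[OF x w, folded p_def]
    have V: "\<bar>V x\<bar> \<le> 2 * (C * sqrt x)" unfolding V_def by (rule V_bound[OF n x])
    have "\<bar>G n x - F n x\<bar> \<le> 2 * (C * sqrt x)" using FG_ratio(7,8)[OF n x] by linarith
    hence U: "\<bar>U x\<bar> \<le> real n * (2 * (C * sqrt x))" unfolding U_def abs_mult by (simp add: mult_left_mono)
    have "\<bar>V x * U x\<bar> \<le> (2 * (C * sqrt x)) * (real n * (2 * (C * sqrt x)))"
      unfolding abs_mult using C_pos x by (intro mult_mono V U) auto
    also have "\<dots> = 4 * real n * C\<^sup>2 * (sqrt x * sqrt x)" by (simp add: power2_eq_square)
    finally have 1: "\<bar>V x * U x\<bar> \<le> 4 * real n * C\<^sup>2 * x" using x by simp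
    have "(V x)\<^sup>2 \<le> (2 * (C * sqrt x))\<^sup>2" using V by (metis abs_ge_zero power2_abs power_mono)
    also have "\<dots> = 4 * C\<^sup>2 * x" using x by (simp add: power_mult_distrib)
    finally have "p x * (V x)\<^sup>2 \<le> 5/4 * (4 * C\<^sup>2 * x)" using pb by (intro mult_mono) auto
    moreover have "0 \<le> p x * (V x)\<^sup>2" "0 \<le> C\<^sup>2 * x" using pb x by auto
    ultimately have 2: "\<bar>p x * (V x)\<^sup>2 / 2\<bar> \<le> 3 * (C\<^sup>2 * x)" by linarith
    have "\<bar>E x\<bar> \<le> wt w x * (4 * real n * C\<^sup>2 * x + 3 * (C\<^sup>2 * x))"
      unfolding E_def abs_mult using wt_pos[OF x, of w] 1 2 by (intro mult_mono) auto
    thus ?thesis by (simp add: algebra_simps)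
  qed
  let ?K = "(4 * real n + 3) * C\<^sup>2"
  have K: "?K \<ge> 0" by simp
  have lim: "((\<lambda>e. E e - E (1/e)) \<longlongrightarrow> 0) (at_right 0)"
  proof (rule Lim_null_comparison)
    show "eventually (\<lambda>e. norm (E e - E (1/e)) \<le> ?K * e powr (1 - w) + ?K * e powr (1/4)) (at_right 0)"
      unfolding eventually_at_right_field
    proof (intro exI[of _ 1] conjI allI impI)
      fix e :: real assume e: "0 < e" "e < 1"
      have "e * wt w e \<le> e powr 1 * e powr (-w)" using e wt_le(1)[of e w] by (intro mult_mono) (auto simp: less_imp_le wt_pos)
      hence a: "e * wt w e \<le> e powr (1 - w)" unfolding powr_add[symmetric] by simp
      have "(1/e) * wt w (1/e) \<le> (1/e) powr 1 * (1/e) powr (-5/4)"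
        using e wt_le(2)[of "1/e" w] wt_pos[of "1/e" w] by (intro mult_mono) auto
      also have "\<dots> = (1/e) powr (-(1/4))" unfolding powr_add[symmetric] by simp
      also have "\<dots> = 1 / (1/e) powr (1/4)" by (rule powr_minus_divide)
      also have "\<dots> = e powr (1/4)" using e by (simp add: powr_divide)
      finally have b: "(1/e) * wt w (1/e) \<le> e powr (1/4)" .
      have "\<bar>E e\<bar> \<le> ?K * e powr (1 - w)" by (rule order_trans[OF Eb[OF e(1)] mult_left_mono[OF a K]])
      moreover have "\<bar>E (1/e)\<bar> \<le> ?K * e powr (1/4)" by (rule order_trans[OF Eb mult_left_mono[OF b K]]) (use e in auto)
      ultimately show "norm (E e - E (1/e)) \<le> ?K * e powr (1 - w) + ?K * e powr (1/4)" by simp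
    qed simp
    have "((\<lambda>e::real. e powr (1 - w)) \<longlongrightarrow> 0) (at_right 0)" using w by real_asymp
    moreover have "((\<lambda>e::real. e powr (1/4)) \<longlongrightarrow> 0) (at_right 0)" by real_asymp
    ultimately have "((\<lambda>e::real. ?K * e powr (1 - w) + ?K * e powr (1/4)) \<longlongrightarrow> ?K * 0 + ?K * 0) (at_right 0)"
      by (intro tendsto_intros)
    thus "((\<lambda>e::real. ?K * e powr (1 - w) + ?K * e powr (1/4)) \<longlongrightarrow> 0) (at_right 0)" by simp
  qed
  have limq: "((\<lambda>e. LBINT x:{e..1/e} \<inter> {0<..}. ?q x) \<longlongrightarrow> (LBINT x:{0<..}. ?q x)) (at_right 0)"
  proof (rule tendsto_set_integral_at_right_0[OF qi, where p=0])
    fix z :: real assume "z \<in> {0<..}"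
    hence z: "z > 0" by simp
    show "\<exists>d>0. \<forall>e. 0 < e \<and> e < d \<longrightarrow> z \<in> {e..1 / e} \<inter> {0<..}"
      using z by (intro exI[of _ "min z (1/z)"]) (auto simp: field_simps)
  qed auto
  have "0 \<le> (LBINT x:{0<..}. ?q x)"
  proof (rule tendsto_le[OF _ limq lim])
    show "eventually (\<lambda>e. E e - E (1/e) \<le> (LBINT x:{e..1/e} \<inter> {0<..}. ?q x)) (at_right 0)"
      unfolding eventually_at_right_field by (intro exI[of _ 1]) (use ineq in auto)
  qed simp
  also have "(LBINT x:{0<..}. ?q x) = 2 * real n * (LBINT x:{0<..}. wt w x * mu x * V x) - c * (LBINT x:{0<..}. wt w x / x * (F n x)\<^sup>2)"
    unfolding V_def
    by (subst set_integral_diff(2)[OF set_integrable_mult_right[OF wt_mu_V_integrable[OF n]] set_integrable_mult_right[OF wt_F_square_integrable[OF n]]])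
       (simp only: set_integral_mult_right)
  finally show ?thesis unfolding c_def V_def by simp
qed

text \<open>By parts, \<open>F 1 x\<close> is the mean of \<open>f\<close> over
  \<open>(0, x)\<close> minus \<open>f x\<close>: it depends on \<open>f\<close> on
  \<open>(0, x]\<close> only, and it determines the gap \<open>f 0 - f x\<close>, which is recovered
  from it below.\<close>

definition A where "A = (LBINT x:{0<..}. wt w x / x * (F 1 x)\<^sup>2)"

lemma A_nonneg: "A \<ge> 0"
  unfolding A_def by (rule set_integral_nonneg') (auto intro!: divide_nonneg_nonneg mult_nonneg_nonneg less_imp_le[OF wt_pos])

text \<open>The logarithmic kernel is a series with nonnegative coefficients in the powers of
  \<open>ratio x y\<close>, and each power gives a nonnegative quadratic form by the energy
  inequality. Only the form for \<open>n = 1\<close> is kept: its coefficient is 2 and its energy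
  constant \<open>2 - 25/16 = 7/16\<close>. The partial sums are dominated by the kernel itself,
  which permits the limit.\<close>

lemma coercivity:
  shows "set_integrable lborel {0<..} (\<lambda>x. wt w x * (hilbert_transform f x * deriv f x))"
    "(LBINT x:{0<..}. wt w x * (hilbert_transform f x * deriv f x)) \<le> - 7 / (16 * pi) * A"
proof -
  define S where "S N x = (\<Sum>n<N. artanh_coeff n * (F n x + G n x))" for N x
  have c0: "artanh_coeff 0 = 0" by (simp add: artanh_coeff_def)
  have trm1: "set_integrable lborel {0<..} (\<lambda>y. artanh_coeff n * (ratio x y ^ n * mu y))" if x: "x > 0" for n x
  proof (cases "n = 0")
    case False
    show ?thesis by (rule set_integrable_mult_right) (rule FG_ratio(5)[OF _ x], use False in simp)
  qed (simp add: c0 set_integrable_def)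
  have trm2: "artanh_coeff n * (F n x + G n x) = (LBINT y:{0<..}. artanh_coeff n * (ratio x y ^ n * mu y))" if x: "x > 0" for n x
  proof (cases "n = 0")
    case False
    thus ?thesis unfolding set_integral_mult_right using FG_ratio(6)[OF _ x, of n] by simp
  qed (simp add: c0)
  have S_eq: "S N x = (LBINT y:{0<..}. (\<Sum>n<N. artanh_coeff n * ratio x y ^ n) * mu y)"
    and S_int: "set_integrable lborel {0<..} (\<lambda>y. (\<Sum>n<N. artanh_coeff n * ratio x y ^ n) * mu y)" if x: "x > 0" for N x
  proof -
    have e: "(\<lambda>y. indicat_real {0<..} y *\<^sub>R ((\<Sum>n<N. artanh_coeff n * ratio x y ^ n) * mu y)) =
      (\<lambda>y. \<Sum>n<N. indicat_real {0<..} y *\<^sub>R (artanh_coeff n * (ratio x y ^ n * mu y)))"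
      by (auto simp: sum_distrib_left sum_distrib_right mult_ac fun_eq_iff)
    show "set_integrable lborel {0<..} (\<lambda>y. (\<Sum>n<N. artanh_coeff n * ratio x y ^ n) * mu y)"
      unfolding set_integrable_def e
      by (intro Bochner_Integration.integrable_sum) (rule trm1[OF x, unfolded set_integrable_def])
    show "S N x = (LBINT y:{0<..}. (\<Sum>n<N. artanh_coeff n * ratio x y ^ n) * mu y)"
      unfolding S_def trm2[OF x] set_lebesgue_integral_def e
      by (rule Bochner_Integration.integral_sum[symmetric]) (rule trm1[OF x, unfolded set_integrable_def])
  qed
  have sum_nonneg: "(\<Sum>n<N. artanh_coeff n * ratio x y ^ n) \<ge> 0" if "x > 0" "y > 0" for N x y
    using ratio_props(1)[OF that] by (intro sum_nonneg mult_nonneg_nonneg artanh_coeff_nonneg) auto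
  have dom: "\<bar>(\<Sum>n<N. artanh_coeff n * ratio x y ^ n) * mu y\<bar> \<le> log_kernel x y * \<bar>mu y\<bar>" if "x > 0" "y > 0" "y \<noteq> x" for N x y
    unfolding abs_mult using artanh_partial_sum_le[of x y N] sum_nonneg[of x y N] that by (intro mult_right_mono) auto
  have S_bound: "\<bar>S N x\<bar> \<le> C * sqrt x" if x: "x > 0" for N x
    unfolding S_eq[OF x]
    by (rule order_trans[OF set_integrable_dominated_except(2)[where c=x, OF kernel_bound(1)[OF x]] kernel_bound(2)[OF x]])
       (use dom[OF x] in auto)
  have S_lim: "(\<lambda>N. S N x) \<longlonglongrightarrow> pi * hilbert_transform f x" if x: "x > 0" for x
    unfolding S_eq[OF x] hilbert_transform_even_log_kernel[OF tame even_f x] mu_def[symmetric] set_lebesgue_integral_def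
  proof (rule integral_dominated_convergence[where w="\<lambda>y. indicat_real {0<..} y *\<^sub>R (log_kernel x y * \<bar>mu y\<bar>)"])
    show "integrable lborel (\<lambda>y. indicat_real {0<..} y *\<^sub>R (log_kernel x y * \<bar>mu y\<bar>))"
      using kernel_bound(1)[OF x] by (simp add: set_integrable_def)
    show "AE y in lborel. norm (indicat_real {0<..} y *\<^sub>R ((\<Sum>n<N. artanh_coeff n * ratio x y ^ n) * mu y)) \<le> indicat_real {0<..} y *\<^sub>R (log_kernel x y * \<bar>mu y\<bar>)" for N
      using AE_lborel_singleton[of x] by eventually_elim (use dom[OF x] in \<open>auto simp: indicator_def\<close>)
    show "AE y in lborel. (\<lambda>N. indicat_real {0<..} y *\<^sub>R ((\<Sum>n<N. artanh_coeff n * ratio x y ^ n) * mu y)) \<longlonglongrightarrow> indicat_real {0<..} y *\<^sub>R (log_kernel x y * mu y)"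
      using AE_lborel_singleton[of x]
    proof eventually_elim
      case (elim y)
      show ?case
      proof (cases "y > 0")
        case True
        note r = ratio_props[OF x True]
        have "(\<lambda>n. artanh_coeff n * ratio x y ^ n) sums log_kernel x y"
          using r elim by (subst r(4)) (auto intro!: artanh_sums)
        hence "(\<lambda>N. \<Sum>n<N. artanh_coeff n * ratio x y ^ n) \<longlonglongrightarrow> log_kernel x y" by (simp add: sums_def)
        thus ?thesis by (intro tendsto_intros)
      qed simp
    qed
  qed (use S_int[OF x] in \<open>auto simp: set_integrable_def\<close>)
  have S_cont: "continuous_on {0<..} (S N)" for N
  proof -
    have "continuous_on {0<..} (\<lambda>x. artanh_coeff n * (F n x + G n x))" for n
    proof (cases "n = 0")
      case False thus ?thesis by (intro continuous_intros F_continuous G_continuous) auto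
    qed (simp add: c0)
    thus ?thesis unfolding S_def[abs_def] by (rule continuous_on_sum)
  qed
  have S_dom: "\<bar>wt w x * mu x * S N x\<bar> \<le> C * (x * (wt w x)\<^sup>2 + (mu x)\<^sup>2)" if "x > 0" for N x
    using S_bound[OF that, of N] C_pos by (intro wt_mu_dominated that order_trans[OF S_bound[OF that]]) (use that in auto)
  have wS_int: "set_integrable lborel {0<..} (\<lambda>x. wt w x * mu x * S N x)" for N
    by (rule set_integrable_dominated_cont[OF wt_mu_integrable])
      (use S_dom in \<open>auto intro!: continuous_intros wt_continuous mu_continuous S_cont\<close>)
  let ?h = "\<lambda>x. wt w x * mu x * (pi * hilbert_transform f x)"
  have lim: "(\<lambda>N. indicat_real {0<..} x *\<^sub>R (wt w x * mu x * S N x)) \<longlonglongrightarrow> indicat_real {0<..} x *\<^sub>R ?h x" for x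
    using S_lim[of x] by (cases "x > 0") (auto intro!: tendsto_intros)
  \<comment> \<open>Measurability of the Hilbert transform on the half line is inherited from the
    continuous partial sums \<open>S N\<close>.\<close>
  have meas: "(\<lambda>x. indicat_real {0<..} x *\<^sub>R ?h x) \<in> borel_measurable lborel"
    by (rule borel_measurable_LIMSEQ_real[OF lim]) (use wS_int in \<open>auto simp: set_integrable_def\<close>)
  have h_int: "set_integrable lborel {0<..} ?h"
    unfolding set_integrable_def
    by (rule integrable_dominated_convergence[OF meas _ wt_mu_integrable[unfolded set_integrable_def], where s="\<lambda>N x. indicat_real {0<..} x *\<^sub>R (wt w x * mu x * S N x)"])
      (use wS_int lim S_dom in \<open>auto simp: set_integrable_def indicator_def\<close>)
  have h_lim: "(\<lambda>N. LBINT x:{0<..}. wt w x * mu x * S N x) \<longlonglongrightarrow> (LBINT x:{0<..}. ?h x)"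
    unfolding set_lebesgue_integral_def
    by (rule integral_dominated_convergence[OF meas _ wt_mu_integrable[unfolded set_integrable_def]])
      (use wS_int lim S_dom in \<open>auto simp: set_integrable_def indicator_def\<close>)
  have lower: "(LBINT x:{0<..}. wt w x * mu x * S N x) \<ge> 7/16 * A" if N: "N \<ge> 2" for N
  proof -
    let ?I = "\<lambda>n. LBINT x:{0<..}. wt w x * mu x * (F n x + G n x)"
    have t: "set_integrable lborel {0<..} (\<lambda>x. artanh_coeff n * (wt w x * mu x * (F n x + G n x)))" for n
    proof (cases "n = 0")
      case False
      show ?thesis by (rule set_integrable_mult_right) (rule wt_mu_V_integrable, use False in simp)
    qed (simp add: c0 set_integrable_def)
    have e: "(\<lambda>x. indicat_real {0<..} x *\<^sub>R (wt w x * mu x * S N x)) =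
       (\<lambda>x. \<Sum>n<N. indicat_real {0<..} x *\<^sub>R (artanh_coeff n * (wt w x * mu x * (F n x + G n x))))"
      unfolding S_def by (auto simp: sum_distrib_left mult_ac fun_eq_iff)
    have "(LBINT x:{0<..}. wt w x * mu x * S N x) = (\<Sum>n<N. LBINT x:{0<..}. artanh_coeff n * (wt w x * mu x * (F n x + G n x)))"
      unfolding set_lebesgue_integral_def e
      by (rule Bochner_Integration.integral_sum) (use t in \<open>auto simp: set_integrable_def\<close>)
    also have "\<dots> = (\<Sum>n<N. artanh_coeff n * ?I n)" by (simp only: set_integral_mult_right)
    \<comment> \<open>All other terms are nonnegative, because \<open>2 * n\<^sup>2 > 25/16\<close>
      for \<open>n \<ge> 1\<close>.\<close>
    also have "\<dots> \<ge> artanh_coeff 1 * ?I 1"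
    proof (rule member_le_sum)
      fix n assume n: "n \<in> {..<N} - {1}"
      show "artanh_coeff n * ?I n \<ge> 0"
      proof (cases "n = 0")
        case False
        hence n1: "n \<ge> 1" by simp
        have "1 \<le> (real n)\<^sup>2" using n1 by simp
        hence "2 * (real n)\<^sup>2 - 25/16 \<ge> 0" by linarith
        moreover have "(LBINT x:{0<..}. wt w x / x * (F n x)\<^sup>2) \<ge> 0"
          by (rule set_integral_nonneg') (auto intro!: divide_nonneg_nonneg mult_nonneg_nonneg less_imp_le[OF wt_pos])
        ultimately have "2 * real n * ?I n \<ge> 0" using energy_inequality[OF n1] by (meson mult_nonneg_nonneg order_trans)
        hence "?I n \<ge> 0" using n1 by (simp add: zero_le_mult_iff)
        thus ?thesis by (intro mult_nonneg_nonneg artanh_coeff_nonneg)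
      qed (simp add: c0)
    qed (use N in auto)
    finally show ?thesis using energy_inequality[of 1] unfolding A_def by (simp add: artanh_coeff_def)
  qed
  have "7/16 * A \<le> (LBINT x:{0<..}. ?h x)"
    by (rule LIMSEQ_le_const[OF h_lim]) (use lower in auto)
  moreover have "(\<lambda>x. wt w x * (hilbert_transform f x * deriv f x)) = (\<lambda>x. (-1/pi) * ?h x)"
    by (auto simp: mu_def fun_eq_iff)
  moreover have "(LBINT x:{0<..}. (-1/pi) * ?h x) = (-1/pi) * (LBINT x:{0<..}. ?h x)"
    by (simp only: set_integral_mult_right)
  moreover have "set_integrable lborel {0<..} (\<lambda>x. (-1/pi) * ?h x)" by (rule set_integrable_mult_right[OF h_int])
  ultimately show "set_integrable lborel {0<..} (\<lambda>x. wt w x * (hilbert_transform f x * deriv f x))"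
    "(LBINT x:{0<..}. wt w x * (hilbert_transform f x * deriv f x)) \<le> - 7 / (16 * pi) * A"
    by (auto simp: field_simps)
qed

section \<open>The gap at the origin\<close>

lemma f_measurable [measurable]: "f \<in> borel_measurable borel" by (rule tameD(10)[OF tame])

text \<open>Young's inequality with weight \<open>l * wt w x / x\<close> splits any pairing with
  \<open>F 1\<close> into the density of \<open>A\<close> and an explicit power of \<open>x\<close>,
  since the weight is at least \<open>x powr (-w) / 2\<close> on \<open>(0, 1]\<close>.\<close>

lemma amgm_wt:
  assumes x: "0 < x" "x \<le> 1" and l: "l > 0"
  shows "\<bar>F 1 x * b\<bar> \<le> l / 2 * (wt w x / x * (F 1 x)\<^sup>2) + x powr (1 + w) * b\<^sup>2 / l"
proof -
  have wp: "wt w x > 0" by (rule wt_pos[OF x(1)])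
  have "x powr (-w) / 2 \<le> wt w x" by (rule wt_ge[OF x w(2)])
  hence "1 \<le> 2 * x powr w * wt w x" using x by (simp add: powr_minus_divide field_simps)
  hence i: "1 / wt w x \<le> 2 * x powr w" using wp by (simp add: field_simps)
  have "\<bar>F 1 x * b\<bar> \<le> ((l * (wt w x / x)) * (F 1 x)\<^sup>2 + b\<^sup>2 / (l * (wt w x / x))) / 2"
    by (rule amgm_divide) (use l wp x in auto)
  also have "b\<^sup>2 / (l * (wt w x / x)) = b\<^sup>2 * x / l * (1 / wt w x)" by simp
  also have "\<dots> \<le> b\<^sup>2 * x / l * (2 * x powr w)" using i l x by (intro mult_left_mono) auto
  also have "\<dots> = 2 * (x powr (1 + w) * b\<^sup>2 / l)" using x by (simp add: powr_add)
  also have "((l * (wt w x / x)) * (F 1 x)\<^sup>2 + 2 * (x powr (1 + w) * b\<^sup>2 / l)) / 2 =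
     l / 2 * (wt w x / x * (F 1 x)\<^sup>2) + x powr (1 + w) * b\<^sup>2 / l" by (simp add: add_divide_distrib)
  finally show ?thesis by simp
qed

lemma A_part:
  assumes "S \<subseteq> {0<..}" "S \<in> sets borel"
  shows "set_integrable lborel S (\<lambda>x. wt w x / x * (F 1 x)\<^sup>2)" "(LBINT x:S. wt w x / x * (F 1 x)\<^sup>2) \<le> A"
proof -
  have i: "set_integrable lborel {0<..} (\<lambda>x. wt w x / x * (F 1 x)\<^sup>2)" by (rule wt_F_square_integrable) simp
  show "set_integrable lborel S (\<lambda>x. wt w x / x * (F 1 x)\<^sup>2)"
    by (rule set_integrable_subset[OF i]) (use assms in auto)
  show "(LBINT x:S. wt w x / x * (F 1 x)\<^sup>2) \<le> A"
    unfolding A_def by (rule set_integral_nonneg_mono_set[OF i assms(2,1)])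
      (auto intro!: divide_nonneg_nonneg mult_nonneg_nonneg less_imp_le[OF wt_pos])
qed

text \<open>The gap minus \<open>F 1 x\<close> is the mean of the gap over \<open>(0, x)\<close>. It
  vanishes at the origin and has derivative \<open>F 1 x / x\<close>, so it is recovered by
  integrating \<open>F 1 y / y\<close> from 0.\<close>

lemma gap_minus_F_bound:
  assumes x: "0 < x" "x \<le> 1" and l: "l > 0"
  shows "\<bar>f 0 - f x - F 1 x\<bar> \<le> x powr (w/2) * (l / 2 * A + 1 / (w * l))"
proof -
  \<comment> \<open>The two terms of Young's inequality are \<open>m / 2 * A\<close> and
    \<open>x powr w / (w * m)\<close>; this \<open>m\<close> gives both the order
    \<open>x powr (w/2)\<close>.\<close>
  define m where "m = l * x powr (w/2)"
  have m: "m > 0" unfolding m_def using l x by simp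
  have step: "\<bar>f 0 - f x - F 1 x\<bar> \<le> \<bar>f 0 - f e - F 1 e\<bar> + (m / 2 * A + x powr w / (w * m))" if e: "0 < e" "e < x" for e
  proof -
    have c: "continuous_on {e..x} (\<lambda>y. F 1 y * (1/y))"
      using e by (intro continuous_intros continuous_on_subset[OF F_continuous]) auto
    have "(LBINT y:{e..x}. F 1 y * (1/y)) = (f 0 - f x - F 1 x) - (f 0 - f e - F 1 e)"
    proof (rule set_integral_FTC[OF _ _ c])
      fix y assume "e \<le> y" "y \<le> x"
      hence y: "y > 0" using e by simp
      have "((\<lambda>x. f 0 - f x - F 1 x) has_real_derivative 0 - deriv f y - (mu y - real 1 * F 1 y / y)) (at y)"
        by (intro DERIV_diff DERIV_const tameD(1)[OF tame] F_deriv y)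
      thus "((\<lambda>x. f 0 - f x - F 1 x) has_real_derivative F 1 y * (1/y)) (at y)" by (simp add: mu_def)
    qed (use e in simp)
    moreover have "\<bar>LBINT y:{e..x}. F 1 y * (1/y)\<bar> \<le> m / 2 * A + x powr w / (w * m)"
    proof -
      have p: "set_integrable lborel {0<..<x} (\<lambda>y. y powr (w - 1))" "(LBINT y:{0<..<x}. y powr (w - 1)) = x powr w / w"
        using set_integrable_powr_from_0[of "w - 1" x] set_integral_powr_from_0[of "w - 1" x] w x by auto
      have d: "(LBINT y:{0<..x}. y powr (w - 1)) = (LBINT y:{0<..<x}. y powr (w - 1))"
        "set_integrable lborel {0<..x} (\<lambda>y. y powr (w - 1)) = set_integrable lborel {0<..<x} (\<lambda>y. y powr (w - 1))"
        by (rule set_integral_discrete_difference[where X="{x}"], auto)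
          (rule set_integrable_discrete_difference[where X="{x}", THEN iffD1], auto,
            rule set_integrable_discrete_difference[where X="{x}", THEN iffD1], auto)
      have pe: "set_integrable lborel {e..x} (\<lambda>y. y powr (w - 1))"
        by (rule set_integrable_subset[of _ "{0<..x}"]) (use p d e in auto)
      have pv: "(LBINT y:{e..x}. y powr (w - 1)) \<le> x powr w / w"
        unfolding p(2)[symmetric] d(1)[symmetric] by (rule set_integral_nonneg_mono_set) (use p d e in auto)
      have sub: "{e..x} \<subseteq> {0<..}" using e by auto
      let ?g = "\<lambda>y. m / 2 * (wt w y / y * (F 1 y)\<^sup>2) + 1 / m * y powr (w - 1)"
      have i1: "set_integrable lborel {e..x} (\<lambda>y. m / 2 * (wt w y / y * (F 1 y)\<^sup>2))"
        by (intro set_integrable_mult_right A_part sub) auto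
      have i2: "set_integrable lborel {e..x} (\<lambda>y. 1 / m * y powr (w - 1))"
        by (intro set_integrable_mult_right pe)
      have "\<bar>LBINT y:{e..x}. F 1 y * (1/y)\<bar> \<le> (LBINT y:{e..x}. \<bar>F 1 y * (1/y)\<bar>)"
        unfolding set_lebesgue_integral_def
        using integral_abs_bound[of lborel "\<lambda>y. indicat_real {e..x} y *\<^sub>R (F 1 y * (1/y))"] by (simp add: abs_mult)
      also have "\<dots> \<le> (LBINT y:{e..x}. ?g y)"
      proof (rule set_integral_mono)
        show "set_integrable lborel {e..x} (\<lambda>y. \<bar>F 1 y * (1/y)\<bar>)"
          by (rule set_integrable_abs[OF borel_integrable_atLeastAtMost'[OF c]])
        show "set_integrable lborel {e..x} ?g" by (rule set_integral_add(1)[OF i1 i2])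
        fix y assume y: "y \<in> {e..x}"
        have y0: "0 < y" "y \<le> 1" using y e x by auto
        have "y powr (1 + w) * (1/y)\<^sup>2 = y powr (1 + w) * y powr (-2)" using y0 by (simp add: powr_minus_divide powr_numeral power_divide)
        also have "\<dots> = y powr (w - 1)" by (simp flip: powr_add)
        finally show "\<bar>F 1 y * (1/y)\<bar> \<le> ?g y" using amgm_wt[OF y0 m, of "1/y"] by simp
      qed
      also have "\<dots> = m / 2 * (LBINT y:{e..x}. wt w y / y * (F 1 y)\<^sup>2) + 1 / m * (LBINT y:{e..x}. y powr (w - 1))"
        unfolding set_integral_add(2)[OF i1 i2] by (simp only: set_integral_mult_right)
      also have "\<dots> \<le> m / 2 * A + 1 / m * (x powr w / w)"
        using A_part(2)[OF sub] pv m by (intro add_mono mult_left_mono) auto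
      finally show ?thesis by (simp add: mult.commute)
    qed
    ultimately show ?thesis by linarith
  qed
  have "\<bar>f 0 - f x - F 1 x\<bar> \<le> \<bar>f 0 - f 0 - 0\<bar> + (m / 2 * A + x powr w / (w * m))"
  proof (rule tendsto_lowerbound)
    have "(F 1 \<longlongrightarrow> 0) (at_right 0)"
    proof (rule Lim_null_comparison)
      show "eventually (\<lambda>e. norm (F 1 e) \<le> C * sqrt e) (at_right 0)"
        unfolding eventually_at_right_field using FG_ratio(7)[of 1] by (intro exI[of _ 1]) auto
      have "((\<lambda>e. C * sqrt e) \<longlongrightarrow> C * sqrt 0) (at_right 0)" by (intro tendsto_intros)
      thus "((\<lambda>e. C * sqrt e) \<longlongrightarrow> 0) (at_right 0)" by simp
    qed
    moreover have "(f \<longlongrightarrow> f 0) (at_right 0)"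
      using DERIV_isCont[OF tameD(1)[OF tame, of 0]] by (auto simp: isCont_def intro: filterlim_mono[OF _ order_refl at_le])
    ultimately show "((\<lambda>e. \<bar>f 0 - f e - F 1 e\<bar> + (m / 2 * A + x powr w / (w * m))) \<longlongrightarrow> \<bar>f 0 - f 0 - 0\<bar> + (m / 2 * A + x powr w / (w * m))) (at_right 0)"
      by (intro tendsto_intros)
    show "eventually (\<lambda>e. \<bar>f 0 - f x - F 1 x\<bar> \<le> \<bar>f 0 - f e - F 1 e\<bar> + (m / 2 * A + x powr w / (w * m))) (at_right 0)"
      unfolding eventually_at_right_field using step x by (intro exI[of _ x]) auto
  qed simp
  also have "x powr w = x powr (w/2) * x powr (w/2)" by (simp flip: powr_add)
  also have "m / 2 * A + (x powr (w/2) * x powr (w/2)) / (w * m) = x powr (w/2) * (l / 2 * A + 1 / (w * l))"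
    unfolding m_def using x l w by (simp add: field_simps)
  finally show ?thesis by simp
qed

text \<open>The common quantity behind all dissipative estimates: for \<open>2 * a \<le> b\<close>
  it dominates the singular part of each of them, and for \<open>2 * b < w\<close> it is controlled
  by \<open>A\<close>.\<close>

definition gap_integral where "gap_integral b = (LBINT x:{0<..<1}. \<bar>f 0 - f x\<bar> * x powr (- 1 - b))"

definition gap_const where "gap_const b = 1 + 1 / (w/2 - b) + 1 / (w/2 - b) / w"

text \<open>Split the gap into \<open>F 1\<close> and its mean. The first part leaves the power
  \<open>x powr (w - 1 - 2 * b)\<close> after Young's inequality, the second is of order
  \<open>x powr (w/2)\<close> and leaves \<open>x powr (w/2 - 1 - b)\<close>. Both are integrable at
  0 exactly when \<open>2 * b < w\<close>. Optimising in \<open>l\<close> would give a multiple of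
  \<open>\<surd>A\<close>.\<close>

lemma gap_integral_bound:
  assumes b: "2 * b < w" and l: "l > 0"
  shows "set_integrable lborel {0<..<1} (\<lambda>x. \<bar>f 0 - f x\<bar> * x powr (- 1 - b))"
    "gap_integral b \<le> gap_const b * (l * A + 1 / l)"
proof -
  define k where "k = 1 / (w/2 - b)"
  have k: "k > 0" unfolding k_def using b by simp
  define B where "B = l / 2 * A + 1 / (w * l)"
  have B: "B \<ge> 0" unfolding B_def using A_nonneg l w by auto
  let ?g = "\<lambda>x. (l / 2 * (wt w x / x * (F 1 x)\<^sup>2) + 1 / l * x powr (w - 1 - 2 * b)) + B * x powr (w/2 - 1 - b)"
  have i1: "set_integrable lborel {0<..<1} (\<lambda>x. l / 2 * (wt w x / x * (F 1 x)\<^sup>2))"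
    by (intro set_integrable_mult_right A_part) auto
  have v1: "(LBINT x:{0<..<1}. l / 2 * (wt w x / x * (F 1 x)\<^sup>2)) \<le> l / 2 * A"
    unfolding set_integral_mult_right using l by (intro mult_left_mono A_part(2)) auto
  have i2: "set_integrable lborel {0<..<1} (\<lambda>x. 1 / l * x powr (w - 1 - 2 * b))"
    by (intro set_integrable_mult_right set_integrable_powr_from_0) (use b in auto)
  have "(LBINT x:{0<..<1}. x powr (w - 1 - 2 * b)) = 1 powr (w - 1 - 2 * b + 1) / (w - 1 - 2 * b + 1)"
    by (rule set_integral_powr_from_0) (use b in auto)
  also have "\<dots> = k / 2" unfolding k_def using b by (simp add: field_simps)
  finally have v2: "(LBINT x:{0<..<1}. 1 / l * x powr (w - 1 - 2 * b)) = 1 / l * (k / 2)"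
    unfolding set_integral_mult_right by (simp only:)
  have i3: "set_integrable lborel {0<..<1} (\<lambda>x. B * x powr (w/2 - 1 - b))"
    by (intro set_integrable_mult_right set_integrable_powr_from_0) (use b in auto)
  have "(LBINT x:{0<..<1}. x powr (w/2 - 1 - b)) = 1 powr (w/2 - 1 - b + 1) / (w/2 - 1 - b + 1)"
    by (rule set_integral_powr_from_0) (use b in auto)
  hence v3: "(LBINT x:{0<..<1}. B * x powr (w/2 - 1 - b)) = B * k"
    unfolding set_integral_mult_right k_def by simp
  note i12 = set_integral_add(1)[OF i1 i2]
  note i123 = set_integral_add(1)[OF i12 i3]
  have dom: "\<bar>\<bar>f 0 - f x\<bar> * x powr (- 1 - b)\<bar> \<le> ?g x" if "x \<in> {0<..<1}" for x
  proof -
    have x: "0 < x" "x \<le> 1" using that by auto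
    have "x powr (1 + w) * (x powr (- 1 - b))\<^sup>2 = x powr (1 + w) * (x powr (- 1 - b) * x powr (- 1 - b))" by (simp add: power2_eq_square)
    also have "\<dots> = x powr (1 + w + ((- 1 - b) + (- 1 - b)))" by (simp only: powr_add)
    also have "1 + w + ((- 1 - b) + (- 1 - b)) = w - 1 - 2 * b" by simp
    finally have 1: "\<bar>F 1 x * x powr (- 1 - b)\<bar> \<le> l / 2 * (wt w x / x * (F 1 x)\<^sup>2) + 1 / l * x powr (w - 1 - 2 * b)"
      using amgm_wt[OF x l, of "x powr (- 1 - b)"] by simp
    have "\<bar>f 0 - f x - F 1 x\<bar> * x powr (- 1 - b) \<le> x powr (w/2) * B * x powr (- 1 - b)"
      unfolding B_def using gap_minus_F_bound[OF x l] by (intro mult_right_mono) auto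
    also have "\<dots> = B * x powr (w/2 + (- 1 - b))" by (simp only: powr_add mult_ac)
    also have "w/2 + (- 1 - b) = w/2 - 1 - b" by simp
    finally have 2: "\<bar>f 0 - f x - F 1 x\<bar> * x powr (- 1 - b) \<le> B * x powr (w/2 - 1 - b)" .
    have "\<bar>f 0 - f x\<bar> \<le> \<bar>F 1 x\<bar> + \<bar>f 0 - f x - F 1 x\<bar>" by linarith
    hence "\<bar>f 0 - f x\<bar> * x powr (- 1 - b) \<le> (\<bar>F 1 x\<bar> + \<bar>f 0 - f x - F 1 x\<bar>) * x powr (- 1 - b)" by (rule mult_right_mono) simp
    also have "\<dots> = \<bar>F 1 x * x powr (- 1 - b)\<bar> + \<bar>f 0 - f x - F 1 x\<bar> * x powr (- 1 - b)" by (simp add: distrib_right abs_mult)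
    finally show ?thesis using 1 2 by (simp add: abs_mult)
  qed
  show "set_integrable lborel {0<..<1} (\<lambda>x. \<bar>f 0 - f x\<bar> * x powr (- 1 - b))"
    by (rule set_integrable_dominated(1)[OF i123 _ _ dom]) auto
  have "gap_integral b \<le> (LBINT x:{0<..<1}. ?g x)"
    unfolding gap_integral_def by (rule order_trans[OF abs_ge_self set_integrable_dominated(2)[OF i123 _ _ dom]]) auto
  also have "\<dots> = (LBINT x:{0<..<1}. l / 2 * (wt w x / x * (F 1 x)\<^sup>2)) + 1 / l * (k / 2) + B * k"
    unfolding set_integral_add(2)[OF i12 i3] set_integral_add(2)[OF i1 i2] v2 v3 ..
  also have "\<dots> \<le> l / 2 * A + 1 / l * (k / 2) + B * k" using v1 by simp
  also have "\<dots> = (l * A) * ((1 + k) / 2) + (1 / l) * (k / 2 + k / w)"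
    unfolding B_def using w l by (simp add: field_simps)
  also have "\<dots> \<le> (l * A) * (1 + k + k / w) + (1 / l) * (1 + k + k / w)"
  proof -
    have "k / w \<ge> 0" using k w by simp
    moreover have "(1 + k) / 2 \<le> 1 + k" using k by simp
    ultimately have 1: "(1 + k) / 2 \<le> 1 + k + k / w" by (rule add_increasing2)
    have 2: "k / 2 + k / w \<le> 1 + k + k / w" using k by simp
    show ?thesis by (rule add_mono[OF mult_left_mono[OF 1] mult_left_mono[OF 2]]) (use l A_nonneg in auto)
  qed
  also have "\<dots> = gap_const b * (l * A + 1 / l)" unfolding gap_const_def k_def[symmetric] by (simp add: algebra_simps)
  finally show "gap_integral b \<le> gap_const b * (l * A + 1 / l)" .
qed

lemma gap_integral_mono:
  assumes b: "2 * b < w" and c: "c \<le> 1 + b"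
  shows "set_integrable lborel {0<..<1} (\<lambda>x. \<bar>f 0 - f x\<bar> * x powr (- c))"
    "(LBINT x:{0<..<1}. \<bar>f 0 - f x\<bar> * x powr (- c)) \<le> gap_integral b"
proof -
  have dom: "\<bar>\<bar>f 0 - f x\<bar> * x powr (- c)\<bar> \<le> \<bar>f 0 - f x\<bar> * x powr (- 1 - b)" if "x \<in> {0<..<1}" for x
  proof -
    have "x powr (- c) \<le> x powr (- 1 - b)" using that c by (intro powr_mono') auto
    thus ?thesis by (simp add: abs_mult mult_left_mono)
  qed
  note i = gap_integral_bound(1)[OF b zero_less_one]
  show "set_integrable lborel {0<..<1} (\<lambda>x. \<bar>f 0 - f x\<bar> * x powr (- c))"
    by (rule set_integrable_dominated(1)[OF i _ _ dom]) auto
  show "(LBINT x:{0<..<1}. \<bar>f 0 - f x\<bar> * x powr (- c)) \<le> gap_integral b"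
    unfolding gap_integral_def by (rule order_trans[OF abs_ge_self set_integrable_dominated(2)[OF i _ _ dom]]) auto
qed

text \<open>On \<open>(0, 1)\<close> the kernel \<open>z powr (- 1 - 2 * a)\<close> is at most
  \<open>z powr (- 1 - b)\<close> because \<open>2 * a \<le> b\<close>; beyond 1 the gap is at most
  \<open>K\<close> and the kernel is integrable.\<close>

lemma dissipation_at_0_bound:
  assumes a: "0 \<le> a" "a < 1/2" and b: "2 * a \<le> b" "2 * b < w" and K: "\<And>x. 0 \<le> f x" "\<And>x. f x \<le> K"
  shows "\<bar>dissipation a f 0\<bar> \<le> frac_const a * (2 + 1 / a) * (gap_integral b + K)"
proof (cases "a = 0")
  case True thus ?thesis by (simp add: dissipation_def frac_const_def)
next
  case False
  hence a0: "a > 0" using a by simp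
  have gK: "\<bar>f 0 - f x\<bar> \<le> K" for x using K[of 0] K[of x] by (simp add: abs_le_iff)
  have K0: "K \<ge> 0" using gK[of 0] by simp
  have I0: "gap_integral b \<ge> 0" unfolding gap_integral_def by (rule set_integral_nonneg') simp
  let ?h = "\<lambda>z. \<bar>f 0 - f z\<bar> * frac_kernel a z"
  have c: "?h z = \<bar>f 0 - f z\<bar> * z powr (- (1 + 2 * a))" if "z > 0" for z using that by (simp add: frac_kernel_def)
  have "set_integrable lborel {0<..<1} ?h = set_integrable lborel {0<..<1} (\<lambda>z. \<bar>f 0 - f z\<bar> * z powr (- (1 + 2 * a)))"
    by (rule set_integrable_cong[OF refl refl c]) auto
  hence i1: "set_integrable lborel {0<..<1} ?h" using gap_integral_mono(1)[OF b(2), of "1 + 2 * a"] b by simp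
  have "(LBINT z:{0<..<1}. ?h z) = (LBINT z:{0<..<1}. \<bar>f 0 - f z\<bar> * z powr (- (1 + 2 * a)))"
    by (rule set_lebesgue_integral_cong) (use c in auto)
  hence v1: "(LBINT z:{0<..<1}. ?h z) \<le> gap_integral b" using gap_integral_mono(2)[OF b(2), of "1 + 2 * a"] b by simp
  have j: "set_integrable lborel {1<..} (\<lambda>z. K * z powr (-1 - 2 * a))"
    by (intro set_integrable_mult_right set_integrable_powr_at_top) (use a0 in auto)
  have jv: "(LBINT z:{1<..}. K * z powr (-1 - 2 * a)) = K * (1 / (2 * a))"
    unfolding set_integral_mult_right using set_integral_powr_at_top[of "-1 - 2 * a" 1] a0 by simp
  have dom: "\<bar>?h z\<bar> \<le> K * z powr (-1 - 2 * a)" if "z \<in> {1<..}" for z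
    using gK[of z] that by (simp add: frac_kernel_def mult_right_mono)
  have i2: "set_integrable lborel {1<..} ?h" by (rule set_integrable_dominated(1)[OF j _ _ dom]) auto
  have v2: "(LBINT z:{1<..}. ?h z) \<le> K * (1 / (2 * a))"
    unfolding jv[symmetric] by (rule order_trans[OF abs_ge_self set_integrable_dominated(2)[OF j _ _ dom]]) auto
  note h = set_integrable_half_line_split[OF i1 i2 zero_less_one]
  have ev: "?h (-z) = ?h z" for z using even_f[of z] by (simp add: frac_kernel_def)
  have "\<bar>dissipation a f 0\<bar> = frac_const a * \<bar>LBINT z. (f 0 - f z) * frac_kernel a z\<bar>"
    unfolding dissipation_tame[OF tame a] abs_mult using frac_const_nonneg[OF a(1)] by simp
  also have "\<bar>LBINT z. (f 0 - f z) * frac_kernel a z\<bar> \<le> (LBINT z. ?h z)"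
    using integral_abs_bound[of lborel "\<lambda>z. (f 0 - f z) * frac_kernel a z"] by (simp add: abs_mult)
  also have "\<dots> = 2 * ((LBINT z:{0<..<1}. ?h z) + (LBINT z:{1<..}. ?h z))"
    using integrable_even_half_line(2)[OF ev h(1)] h(2) by simp
  also have "\<dots> \<le> 2 * (gap_integral b + K * (1 / (2 * a)))" using v1 v2 by simp
  also have "\<dots> = 2 * gap_integral b + 1 / a * K" using a0 by (simp add: field_simps)
  also have "\<dots> \<le> (2 + 1 / a) * gap_integral b + (2 + 1 / a) * K"
    using I0 K0 a0 by (intro add_mono mult_right_mono) auto
  also have "\<dots> = (2 + 1 / a) * (gap_integral b + K)" by (rule distrib_left[symmetric])
  finally show ?thesis using frac_const_nonneg[OF a(1)] by (simp add: mult_left_mono mult.assoc)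
qed

end

section \<open>The weighted dissipation\<close>

lemma wt_antimono:
  assumes "0 < x" "x \<le> y" "0 < w"
  shows "wt w y \<le> wt w x"
  unfolding wt_def using assms
  by (intro divide_left_mono add_mono powr_mono2 mult_pos_pos add_pos_pos) auto

lemma wt_diff_bound:
  assumes x: "x > 0" and y: "y \<ge> x / 2" and w: "0 < w" "w < 1" and q: "q = w \<or> q = 5/4"
  shows "\<bar>wt w x - wt w y\<bar> \<le> 10 * x powr (-q) * min 1 (\<bar>x - y\<bar> / x)"
proof -
  have y0: "y > 0" using x y by simp
  have xq: "x powr (-q) > 0" using x by simp
  have b: "wt w s \<le> 4 * x powr (-q)" if s: "s \<ge> x / 2" for s
  proof -
    have s0: "s > 0" using s x by simp
    have "wt w s \<le> s powr (-q)" using q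
    proof
      assume "q = 5/4"
      hence "-q = -5/4" by simp
      thus ?thesis using wt_le(2)[OF s0, of w] by (simp only:)
    qed (use wt_le(1)[OF s0, of w] in simp)
    also have "\<dots> \<le> (x/2) powr (-q)" using s x q w by (intro powr_mono2') auto
    also have "\<dots> = x powr (-q) * (1/2) powr (-q)" using x by (simp add: powr_mult[symmetric])
    also have "x powr (-q) * (1/2::real) powr (-q) \<le> x powr (-q) * (1/2) powr (-2)" using q w by (intro mult_left_mono powr_mono') auto
    also have "(1/2::real) powr (-2) = 4" by (simp add: powr_minus_divide powr_numeral power_divide)
    finally show ?thesis by simp
  qed
  have d: "\<bar>wt w x - wt w y\<bar> \<le> (10 * x powr (-q) / x) * \<bar>x - y\<bar>"
  proof -
    have "norm (wt w x - wt w y) \<le> (10 * x powr (-q) / x) * norm (x - y)"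
    proof (rule field_differentiable_bound[of "{x/2..}" "wt w" "\<lambda>s. - wt_exponent w s * wt w s / s"])
      fix s assume "s \<in> {x/2..}"
      hence s: "s \<ge> x/2" "s > 0" using x by auto
      show "(wt w has_field_derivative - wt_exponent w s * wt w s / s) (at s within {x/2..})"
        using wt_deriv[OF s(2)] by (rule has_field_derivative_at_within)
      have "norm (- wt_exponent w s * wt w s / s) = wt_exponent w s * wt w s / s"
        using wt_exponent_bounds[OF s(2) w] wt_pos[OF s(2), of w] s by (simp add: abs_mult)
      also have "\<dots> \<le> (5/4 * (4 * x powr (-q))) / (x/2)"
        using wt_exponent_bounds[OF s(2) w] wt_pos[OF s(2), of w] b[OF s(1)] s x
        by (intro frac_le mult_mono) auto
      also have "\<dots> = 10 * x powr (-q) / x" by simp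
      finally show "norm (- wt_exponent w s * wt w s / s) \<le> 10 * x powr (-q) / x" .
    qed (use x y in auto)
    thus ?thesis by simp
  qed
  have "\<bar>wt w x - wt w y\<bar> \<le> 4 * x powr (-q)"
    using b[of x] b[OF y] wt_pos[OF x, of w] wt_pos[OF y0, of w] x by (simp add: abs_le_iff)
  hence "\<bar>wt w x - wt w y\<bar> \<le> 10 * x powr (-q)" using xq by linarith
  thus ?thesis using d by (auto simp: min_def)
qed

text \<open>The kernel of the fractional Laplacian acting on even functions, folded onto the half
  line. Its symmetry is what makes the later symmetrisation work.\<close>

definition half_line_kernel :: "real \<Rightarrow> real \<Rightarrow> real \<Rightarrow> real" where
  "half_line_kernel a x y = frac_kernel a (x - y) + frac_kernel a (x + y)"

lemma half_line_kernel_nonneg: "half_line_kernel a x y \<ge> 0"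
  unfolding half_line_kernel_def by simp

lemma half_line_kernel_sym: "half_line_kernel a x y = half_line_kernel a y x"
  unfolding half_line_kernel_def frac_kernel_def by (simp add: abs_minus_commute add.commute)

text \<open>Rescaling by \<open>y = x * (1 + z)\<close> reduces this to the truncated kernel
  integral at unit scale.\<close>

lemma frac_kernel_scaled:
  assumes x: "x > 0" and a: "0 < a" "a < 1/2"
  shows "integrable lborel (\<lambda>y. min 1 (\<bar>x - y\<bar> / x) * frac_kernel a (x - y))"
    "(LBINT y. min 1 (\<bar>x - y\<bar> / x) * frac_kernel a (x - y)) = x powr (-2*a) * (2 / (1 - 2 * a) + 1 / a)"
proof -
  let ?I = "2 / (1 - 2 * a) + 1 / a"
  have h: "has_bochner_integral lborel (\<lambda>z. min 1 \<bar>z\<bar> * frac_kernel a z) ?I"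
    using frac_kernel_truncated_integrable[OF a] by (simp add: has_bochner_integral_iff)
  have "has_bochner_integral lborel (\<lambda>y. min 1 \<bar>-1 + 1/x * y\<bar> * frac_kernel a (-1 + 1/x * y)) (?I /\<^sub>R \<bar>1/x\<bar>)"
    using lborel_has_bochner_integral_real_affine_iff[of "1/x" "\<lambda>z. min 1 \<bar>z\<bar> * frac_kernel a z" ?I "-1"] h x by simp
  hence "has_bochner_integral lborel (\<lambda>y. x powr (-1-2*a) * (min 1 \<bar>-1 + 1/x * y\<bar> * frac_kernel a (-1 + 1/x * y)))
     (x powr (-1-2*a) * (?I /\<^sub>R \<bar>1/x\<bar>))" by (rule has_bochner_integral_mult_right)
  also have "(\<lambda>y. x powr (-1-2*a) * (min 1 \<bar>-1 + 1/x * y\<bar> * frac_kernel a (-1 + 1/x * y))) =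
     (\<lambda>y. min 1 (\<bar>x - y\<bar> / x) * frac_kernel a (x - y))"
  proof
    fix y
    have e: "\<bar>-1 + 1/x * y\<bar> = \<bar>x - y\<bar> / x"
    proof -
      have "-1 + 1/x * y = (y - x) / x" using x by (simp add: field_simps)
      thus ?thesis using x by (simp add: abs_minus_commute)
    qed
    have "x powr (-1-2*a) * (\<bar>x - y\<bar> / x) powr (-1-2*a) = (x * (\<bar>x - y\<bar> / x)) powr (-1-2*a)"
      by (rule powr_mult[symmetric])
    also have "x * (\<bar>x - y\<bar> / x) = \<bar>x - y\<bar>" using x by simp
    finally have "x powr (-1-2*a) * (\<bar>x - y\<bar> / x) powr (-1-2*a) = \<bar>x - y\<bar> powr (-1-2*a)" .
    thus "x powr (-1-2*a) * (min 1 \<bar>-1 + 1/x * y\<bar> * frac_kernel a (-1 + 1/x * y)) = min 1 (\<bar>x - y\<bar> / x) * frac_kernel a (x - y)"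
      unfolding frac_kernel_def e by (metis mult.left_commute)
  qed
  also have "x powr (-1-2*a) * (?I /\<^sub>R \<bar>1/x\<bar>) = (x powr (-1-2*a) * x powr 1) * ?I" using x by simp
  also have "x powr (-1-2*a) * x powr 1 = x powr (-2*a)" by (simp only: powr_add[symmetric]) simp
  finally show "integrable lborel (\<lambda>y. min 1 (\<bar>x - y\<bar> / x) * frac_kernel a (x - y))"
    "(LBINT y. min 1 (\<bar>x - y\<bar> / x) * frac_kernel a (x - y)) = x powr (-2*a) * ?I"
    by (auto simp: has_bochner_integral_iff)
qed

text \<open>For \<open>y < x / 2\<close> the weight difference is at most \<open>wt w y\<close> by
  monotonicity and the kernel is at most its value at distance \<open>x / 2\<close>, so only the
  mass \<open>J\<close> of the weight enters. For the other \<open>y\<close> the Lipschitz bound at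
  scale \<open>x\<close> tames the singularity on the diagonal.\<close>

lemma wt_commutator_bound:
  assumes x: "x > 0" and w: "0 < w" "w < 1" and q: "q = w \<or> q = 5/4" and a: "0 < a" "a < 1/2"
    and J: "(LBINT y:{0<..<x/2}. wt w y) \<le> J"
  shows "set_integrable lborel {0<..} (\<lambda>y. \<bar>wt w x - wt w y\<bar> * half_line_kernel a x y)"
    "(LBINT y:{0<..}. \<bar>wt w x - wt w y\<bar> * half_line_kernel a x y) \<le>
       20 * (x powr (-q) * x powr (-2*a)) * (2 / (1 - 2 * a) + 1 / a) + 2 * (x/2) powr (-1-2*a) * J"
proof -
  let ?g1 = "\<lambda>y. (20 * x powr (-q)) * (min 1 (\<bar>x - y\<bar> / x) * frac_kernel a (x - y))"
  let ?g2 = "\<lambda>y. (2 * (x/2) powr (-1-2*a)) * (indicat_real {0<..<x/2} y * wt w y)"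
  have i1: "set_integrable lborel {0<..} ?g1"
    by (intro set_integrable_mult_right set_integrable_lborel_imp frac_kernel_scaled x a) auto
  have "(LBINT y:{0<..}. ?g1 y) \<le> (LBINT y. ?g1 y)"
    by (rule set_integral_nonneg_le_integral) (use frac_kernel_scaled(1)[OF x a] x in auto)
  hence v1: "(LBINT y:{0<..}. ?g1 y) \<le> (20 * x powr (-q)) * (x powr (-2*a) * (2 / (1 - 2 * a) + 1 / a))"
    using frac_kernel_scaled(2)[OF x a] by simp
  have iw: "set_integrable lborel {0<..<x/2} (wt w)" by (rule set_integrable_subset[OF wt_integrable[OF w]]) auto
  have e: "(\<lambda>y. indicat_real {0<..} y *\<^sub>R (indicat_real {0<..<x/2} y * wt w y)) = (\<lambda>y. indicat_real {0<..<x/2} y *\<^sub>R wt w y)"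
    by (auto simp: indicator_def fun_eq_iff)
  have i2': "set_integrable lborel {0<..} (\<lambda>y. indicat_real {0<..<x/2} y * wt w y)"
    "(LBINT y:{0<..}. indicat_real {0<..<x/2} y * wt w y) = (LBINT y:{0<..<x/2}. wt w y)"
    using iw unfolding set_integrable_def set_lebesgue_integral_def e by auto
  have i2: "set_integrable lborel {0<..} ?g2" by (rule set_integrable_mult_right[OF i2'(1)])
  have v2: "(LBINT y:{0<..}. ?g2 y) \<le> (2 * (x/2) powr (-1-2*a)) * J"
    unfolding set_integral_mult_right i2'(2) using J by (intro mult_left_mono) auto
  have dom: "\<bar>\<bar>wt w x - wt w y\<bar> * half_line_kernel a x y\<bar> \<le> ?g1 y + ?g2 y" if "y \<in> {0<..}" for y
  proof -
    have y: "y > 0" using that by simp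
    have g1: "?g1 y \<ge> 0" using x by simp
    have g2: "?g2 y \<ge> 0" using wt_pos[OF y, of w] by (simp add: indicator_def)
    have k: "\<bar>wt w x - wt w y\<bar> * half_line_kernel a x y \<le> \<bar>wt w x - wt w y\<bar> * (2 * frac_kernel a (x - y))"
    proof (cases "x = y")
      case False
      have "frac_kernel a (x + y) \<le> frac_kernel a (x - y)"
        unfolding frac_kernel_def using x y a False by (intro powr_mono2') auto
      thus ?thesis unfolding half_line_kernel_def by (intro mult_left_mono) auto
    qed simp
    have "\<bar>wt w x - wt w y\<bar> * (2 * frac_kernel a (x - y)) \<le> ?g1 y + ?g2 y"
    proof (cases "y < x / 2")
      case True
      have "\<bar>wt w x - wt w y\<bar> \<le> wt w y"
        using wt_antimono[OF y, of x w] wt_pos[OF x, of w] True x w by simp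
      moreover have "frac_kernel a (x - y) \<le> (x/2) powr (-1-2*a)"
        unfolding frac_kernel_def using True x y a by (intro powr_mono2') auto
      ultimately have "\<bar>wt w x - wt w y\<bar> * (2 * frac_kernel a (x - y)) \<le> wt w y * (2 * (x/2) powr (-1-2*a))"
        using wt_pos[OF y, of w] by (intro mult_mono) auto
      also have "\<dots> = ?g2 y" using True y by simp
      finally show ?thesis using g1 by linarith
    next
      case False
      have "\<bar>wt w x - wt w y\<bar> * (2 * frac_kernel a (x - y)) \<le> (10 * x powr (-q) * min 1 (\<bar>x - y\<bar> / x)) * (2 * frac_kernel a (x - y))"
        using False by (intro mult_right_mono wt_diff_bound x w q) auto
      also have "\<dots> = ?g1 y" by simp
      finally show ?thesis using g2 by linarith
    qed
    thus ?thesis using k half_line_kernel_nonneg[of a x y] by (simp add: abs_mult)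
  qed
  note i12 = set_integral_add(1)[OF i1 i2]
  have m: "(\<lambda>y. \<bar>wt w x - wt w y\<bar> * half_line_kernel a x y) \<in> borel_measurable borel"
    unfolding half_line_kernel_def by measurable
  show "set_integrable lborel {0<..} (\<lambda>y. \<bar>wt w x - wt w y\<bar> * half_line_kernel a x y)"
    by (rule set_integrable_dominated(1)[OF i12 _ m dom]) auto
  have "(LBINT y:{0<..}. \<bar>wt w x - wt w y\<bar> * half_line_kernel a x y) \<le> (LBINT y:{0<..}. ?g1 y + ?g2 y)"
    by (rule order_trans[OF abs_ge_self set_integrable_dominated(2)[OF i12 _ m dom]]) auto
  also have "\<dots> \<le> (20 * x powr (-q)) * (x powr (-2*a) * (2 / (1 - 2 * a) + 1 / a)) + (2 * (x/2) powr (-1-2*a)) * J"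
    unfolding set_integral_add(2)[OF i1 i2] using v1 v2 by linarith
  finally show "(LBINT y:{0<..}. \<bar>wt w x - wt w y\<bar> * half_line_kernel a x y) \<le>
       20 * (x powr (-q) * x powr (-2*a)) * (2 / (1 - 2 * a) + 1 / a) + 2 * (x/2) powr (-1-2*a) * J" by (simp add: mult.assoc)
qed

definition commutator_const :: "real \<Rightarrow> real \<Rightarrow> real" where
  "commutator_const w a = 20 * (2 / (1 - 2 * a) + 1 / a) + 8 / (1 - w) + 8 * (LBINT y:{0<..}. wt w y)"

lemma wt_mass_nonneg: "(LBINT y:{0<..}. wt w y) \<ge> 0"
  by (rule set_integral_nonneg') (auto intro: less_imp_le[OF wt_pos])

lemma commutator_const_nonneg:
  assumes "0 \<le> a" "a < 1/2" "w < 1"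
  shows "commutator_const w a \<ge> 0"
  unfolding commutator_const_def using assms wt_mass_nonneg[of w] by (intro add_nonneg_nonneg) auto

text \<open>For small \<open>x\<close> the mass of the weight below \<open>x / 2\<close> is of order
  \<open>x powr (1 - w)\<close>, so both terms of the commutator bound scale like
  \<open>x powr (- (w + 2 * a))\<close>.\<close>

lemma wt_commutator_bound_near:
  assumes x: "0 < x" "x \<le> 1" and w: "0 < w" "w < 1" and a: "0 < a" "a < 1/2"
  shows "(LBINT y:{0<..}. \<bar>wt w x - wt w y\<bar> * half_line_kernel a x y) \<le> commutator_const w a * x powr (- (w + 2 * a))"
proof -
  let ?r = "x powr (- (w + 2 * a))"
  let ?I = "2 / (1 - 2 * a) + 1 / a"
  have i: "set_integrable lborel {0<..<x/2} (\<lambda>y. y powr (-w))" "(LBINT y:{0<..<x/2}. y powr (-w)) = (x/2) powr (1 - w) / (1 - w)"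
    using set_integrable_powr_from_0[of "-w" "x/2"] set_integral_powr_from_0[of "-w" "x/2"] x w by auto
  have J: "(LBINT y:{0<..<x/2}. wt w y) \<le> (x/2) powr (1 - w) / (1 - w)"
    unfolding i(2)[symmetric]
  proof (rule set_integral_mono[OF _ i(1)])
    show "set_integrable lborel {0<..<x/2} (wt w)" by (rule set_integrable_subset[OF wt_integrable[OF w]]) auto
  qed (auto intro: wt_le)
  have "2 * (x/2) powr (-1-2*a) * ((x/2) powr (1 - w) / (1 - w)) = 2 / (1 - w) * ((x/2) powr (-1-2*a) * (x/2) powr (1 - w))" by simp
  also have "(x/2) powr (-1-2*a) * (x/2) powr (1 - w) = (x * (1/2)) powr ((-1-2*a) + (1 - w))"
    by (simp only: powr_add times_divide_eq_right mult_1_right)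
  also have "(-1-2*a) + (1 - w) = - (w + 2 * a)" by simp
  also have "(x * (1/2)) powr (- (w + 2 * a)) = ?r * (1/2) powr (- (w + 2 * a))" by (rule powr_mult)
  also have "2 / (1 - w) * (?r * (1/2) powr (- (w + 2 * a))) \<le> 2 / (1 - w) * (?r * (1/2) powr (-2))"
    using w a by (intro mult_left_mono powr_mono') auto
  also have "(1/2::real) powr (-2) = 4" by (simp add: powr_minus_divide powr_numeral power_divide)
  finally have 1: "2 * (x/2) powr (-1-2*a) * ((x/2) powr (1 - w) / (1 - w)) \<le> 8 / (1 - w) * ?r" by simp
  have 2: "x powr (-w) * x powr (-2*a) = ?r" by (simp add: powr_add[symmetric])
  have "(LBINT y:{0<..}. \<bar>wt w x - wt w y\<bar> * half_line_kernel a x y) \<le>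
       20 * (x powr (-w) * x powr (-2*a)) * ?I + 2 * (x/2) powr (-1-2*a) * ((x/2) powr (1 - w) / (1 - w))"
    by (rule wt_commutator_bound(2)[OF x(1) w _ a J]) simp
  also have "\<dots> \<le> 20 * ?r * ?I + 8 / (1 - w) * ?r" unfolding 2 using 1 by simp
  also have "\<dots> = (20 * ?I + 8 / (1 - w)) * ?r"
    by (simp only: distrib_right mult.assoc mult.commute[of ?r])
  also have "\<dots> \<le> commutator_const w a * ?r"
    unfolding commutator_const_def using wt_mass_nonneg[of w] by (intro mult_right_mono) auto
  finally show ?thesis .
qed

text \<open>For large \<open>x\<close> the bound is governed by the mass of the weight at smaller
  \<open>y\<close>, seen through the kernel at a distance of order \<open>x\<close>. Hence the decay
  \<open>x powr (- 1 - 2 * a)\<close>, slower than the local contribution with exponent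
  \<open>5/4 + 2 * a\<close>.\<close>

lemma wt_commutator_bound_far:
  assumes x: "1 < x" and w: "0 < w" "w < 1" and a: "0 < a" "a < 1/2"
  shows "(LBINT y:{0<..}. \<bar>wt w x - wt w y\<bar> * half_line_kernel a x y) \<le> commutator_const w a * x powr (- 1 - 2 * a)"
proof -
  let ?r = "x powr (- 1 - 2 * a)"
  let ?I = "2 / (1 - 2 * a) + 1 / a"
  let ?L = "LBINT y:{0<..}. wt w y"
  have x0: "x > 0" using x by simp
  have I0: "?I \<ge> 0" using a by simp
  have J: "(LBINT y:{0<..<x/2}. wt w y) \<le> ?L"
    by (rule set_integral_nonneg_mono_set[OF wt_integrable[OF w]]) (auto intro: less_imp_le[OF wt_pos])
  have "(x/2) powr (-1-2*a) = (x * (1/2)) powr (-1-2*a)" by simp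
  also have "\<dots> = ?r * (1/2) powr (-1-2*a)" by (rule powr_mult)
  also have "?r * (1/2::real) powr (-1-2*a) \<le> ?r * (1/2) powr (-2)" using a by (intro mult_left_mono powr_mono') auto
  also have "(1/2::real) powr (-2) = 4" by (simp add: powr_minus_divide powr_numeral power_divide)
  finally have "(x/2) powr (-1-2*a) \<le> 4 * ?r" by simp
  hence 1: "2 * (x/2) powr (-1-2*a) * ?L \<le> 8 * ?r * ?L" using wt_mass_nonneg[of w] by (intro mult_right_mono) auto
  have "x powr (-(5/4)) * x powr (-2*a) = x powr (-(5/4) - 2*a)" by (simp add: powr_add[symmetric])
  also have "\<dots> \<le> ?r" using x by (intro powr_mono) auto
  finally have 2: "20 * (x powr (-(5/4)) * x powr (-2*a)) * ?I \<le> 20 * ?r * ?I"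
    using I0 by (intro mult_right_mono mult_left_mono) auto
  have "(LBINT y:{0<..}. \<bar>wt w x - wt w y\<bar> * half_line_kernel a x y) \<le>
       20 * (x powr (-(5/4)) * x powr (-2*a)) * ?I + 2 * (x/2) powr (-1-2*a) * ?L"
    by (rule wt_commutator_bound(2)[OF x0 w _ a J]) simp
  also have "\<dots> \<le> 20 * ?r * ?I + 8 * ?r * ?L" using 1 2 by linarith
  also have "\<dots> = (20 * ?I + 8 * ?L) * ?r" by (simp add: algebra_simps)
  also have "\<dots> \<le> commutator_const w a * ?r"
    unfolding commutator_const_def using w by (intro mult_right_mono) auto
  finally show ?thesis .
qed

context even_profile begin

lemma dissipation_half_line:
  assumes a: "0 < a" "a < 1/2"
  shows "set_integrable lborel {0<..} (\<lambda>y. (f x - f y) * half_line_kernel a x y)"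
    "set_integrable lborel {0<..} (\<lambda>y. \<bar>f x - f y\<bar> * half_line_kernel a x y)"
    "dissipation a f x = frac_const a * (LBINT y:{0<..}. (f x - f y) * half_line_kernel a x y)"
    "(LBINT y:{0<..}. \<bar>f x - f y\<bar> * half_line_kernel a x y) \<le> 2 * M * (2 / (1 - 2 * a) + 1 / a)"
proof -
  have gen: "set_integrable lborel {0<..} (\<lambda>y. g y * half_line_kernel a x y)"
    "(LBINT z. g (x + z) * frac_kernel a z) = (LBINT y:{0<..}. g y * half_line_kernel a x y)"
    if i: "integrable lborel (\<lambda>z. g (x + z) * frac_kernel a z)" and ev: "\<And>y. g (-y) = g y" for g :: "real \<Rightarrow> real"
  proof -
    let ?q = "\<lambda>y. g y * frac_kernel a (y - x)"
    have hb: "has_bochner_integral lborel ?q (LBINT z. g (x + z) * frac_kernel a z)"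
      using lborel_has_bochner_integral_real_affine_iff[of 1 "\<lambda>z. g (x + z) * frac_kernel a z" _ "-x"]
        has_bochner_integral_integrable[OF i] by simp
    hence qi: "integrable lborel ?q" by (simp add: has_bochner_integral_iff)
    have qi': "integrable lborel (\<lambda>y. ?q (0 - y))" "integrable lborel (\<lambda>y. ?q (0 + y))"
      using qi lborel_integrable_real_affine[OF qi, of "-1" 0] by auto
    note s = set_integrable_lborel_imp[OF qi'(1), of "{0<..}"] set_integrable_lborel_imp[OF qi'(2), of "{0<..}"]
    have e: "?q (0 - y) + ?q (0 + y) = g y * half_line_kernel a x y" for y
    proof -
      have "frac_kernel a (- y - x) = frac_kernel a (x + y)" "frac_kernel a (y - x) = frac_kernel a (x - y)"
        unfolding frac_kernel_def by (simp_all add: abs_minus_commute abs_minus_cancel[of "x + y", symmetric] del: abs_minus_cancel)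
      thus ?thesis unfolding half_line_kernel_def using ev[of y] by (simp add: distrib_left)
    qed
    show "set_integrable lborel {0<..} (\<lambda>y. g y * half_line_kernel a x y)"
      using set_integral_add(1)[OF s] unfolding e by simp
    have "(LBINT z. g (x + z) * frac_kernel a z) = (LBINT y:UNIV. ?q y)"
      using hb by (simp add: has_bochner_integral_iff set_lebesgue_integral_def)
    also have "\<dots> = (LBINT y:{y. \<bar>0 - y\<bar> > 0}. ?q y)"
      by (rule set_integral_discrete_difference[where X="{0}"]) auto
    also have "\<dots> = (LBINT z:{0<..}. ?q (0 - z) + ?q (0 + z))"
      by (rule set_integral_symmetric_split) (use s in auto)
    finally show "(LBINT z. g (x + z) * frac_kernel a z) = (LBINT y:{0<..}. g y * half_line_kernel a x y)"
      unfolding e .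
  qed
  note t = tame_frac_integrable[OF tame a, of x]
  note g1 = gen[of "\<lambda>y. f x - f y", OF t(1)]
  show "set_integrable lborel {0<..} (\<lambda>y. (f x - f y) * half_line_kernel a x y)" by (rule g1(1)) (simp add: even_f)
  show "dissipation a f x = frac_const a * (LBINT y:{0<..}. (f x - f y) * half_line_kernel a x y)"
    using dissipation_tame[OF tame, of a x] g1(2) a by (simp add: even_f)
  have ia: "integrable lborel (\<lambda>z. \<bar>f x - f (x + z)\<bar> * frac_kernel a z)"
    using integrable_abs[OF t(1)] by (simp add: abs_mult)
  note g2 = gen[of "\<lambda>y. \<bar>f x - f y\<bar>", OF ia]
  show "set_integrable lborel {0<..} (\<lambda>y. \<bar>f x - f y\<bar> * half_line_kernel a x y)" by (rule g2(1)) (simp add: even_f)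
  have "(LBINT y:{0<..}. \<bar>f x - f y\<bar> * half_line_kernel a x y) = (LBINT z. \<bar>f x - f (x + z)\<bar> * frac_kernel a z)"
    by (rule g2(2)[symmetric]) (simp add: even_f)
  also have "\<dots> \<le> (LBINT z. 2 * M * (min 1 \<bar>z\<bar> * frac_kernel a z))"
  proof (rule integral_mono[OF ia])
    show "integrable lborel (\<lambda>z. 2 * M * (min 1 \<bar>z\<bar> * frac_kernel a z))"
      by (intro integrable_mult_right frac_kernel_truncated_integrable a)
    fix z
    note tD = tameD[OF tame]
    have "\<bar>f x - f (x + z)\<bar> \<le> 2 * M * min 1 \<bar>z\<bar>"
      using tD(9)[of x "x + z"] tD(4)[of x] tD(4)[of "x + z"] tD(12) by (auto simp: min_def mult_right_mono intro: order_trans)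
    from mult_right_mono[OF this frac_kernel_nonneg[of a z]]
    show "\<bar>f x - f (x + z)\<bar> * frac_kernel a z \<le> 2 * M * (min 1 \<bar>z\<bar> * frac_kernel a z)" by simp
  qed
  also have "\<dots> = 2 * M * (2 / (1 - 2 * a) + 1 / a)" using frac_kernel_truncated_integrable(2)[OF a] by simp
  finally show "(LBINT y:{0<..}. \<bar>f x - f y\<bar> * half_line_kernel a x y) \<le> 2 * M * (2 / (1 - 2 * a) + 1 / a)" .
qed

text \<open>Here \<open>psi\<close> is the profile of the commutator bound. Near the origin
  \<open>w + 2 * a \<le> 1 + b\<close>, since \<open>w < 1\<close> and \<open>2 * a \<le> b\<close>,
  so \<open>gap_integral b\<close> dominates; beyond 1 the gap is at most \<open>K\<close>.\<close>

lemma gap_weighted_integral: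
  assumes a: "0 < a" "a < 1/2" and b: "2 * a \<le> b" "2 * b < w" and K: "\<And>x. 0 \<le> f x" "\<And>x. f x \<le> K"
  defines "psi \<equiv> \<lambda>x. if x < 1 then x powr (- (w + 2 * a)) else x powr (- 1 - 2 * a)"
  shows "set_integrable lborel {0<..} (\<lambda>x. \<bar>f 0 - f x\<bar> * psi x)"
    "(LBINT x:{0<..}. \<bar>f 0 - f x\<bar> * psi x) \<le> gap_integral b + K * (1 / (2 * a))"
proof -
  have gK: "\<bar>f 0 - f x\<bar> \<le> K" for x using K[of 0] K[of x] by (simp add: abs_le_iff)
  have c: "w + 2 * a \<le> 1 + b" using b w by linarith
  note g = gap_integral_mono[OF b(2) c]
  have "set_integrable lborel {0<..<1} (\<lambda>x. \<bar>f 0 - f x\<bar> * psi x) = set_integrable lborel {0<..<1} (\<lambda>x. \<bar>f 0 - f x\<bar> * x powr (- (w + 2 * a)))"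
    by (rule set_integrable_cong) (auto simp: psi_def)
  hence i1: "set_integrable lborel {0<..<1} (\<lambda>x. \<bar>f 0 - f x\<bar> * psi x)" using g(1) by simp
  have v1: "(LBINT x:{0<..<1}. \<bar>f 0 - f x\<bar> * psi x) = (LBINT x:{0<..<1}. \<bar>f 0 - f x\<bar> * x powr (- (w + 2 * a)))"
    by (rule set_lebesgue_integral_cong) (auto simp: psi_def)
  have j: "set_integrable lborel {1<..} (\<lambda>z. K * z powr (-1 - 2 * a))"
    by (intro set_integrable_mult_right set_integrable_powr_at_top) (use a in auto)
  have jv: "(LBINT z:{1<..}. K * z powr (-1 - 2 * a)) = K * (1 / (2 * a))"
    unfolding set_integral_mult_right using set_integral_powr_at_top[of "-1 - 2 * a" 1] a by simp
  have m: "(\<lambda>x. \<bar>f 0 - f x\<bar> * psi x) \<in> borel_measurable borel" unfolding psi_def by measurable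
  have dom: "\<bar>\<bar>f 0 - f z\<bar> * psi z\<bar> \<le> K * z powr (-1 - 2 * a)" if "z \<in> {1<..}" for z
    using gK[of z] that by (simp add: psi_def abs_mult mult_right_mono)
  have i2: "set_integrable lborel {1<..} (\<lambda>x. \<bar>f 0 - f x\<bar> * psi x)" by (rule set_integrable_dominated(1)[OF j _ m dom]) auto
  have v2: "(LBINT z:{1<..}. \<bar>f 0 - f z\<bar> * psi z) \<le> K * (1 / (2 * a))"
    unfolding jv[symmetric] by (rule order_trans[OF abs_ge_self set_integrable_dominated(2)[OF j _ m dom]]) auto
  note h = set_integrable_half_line_split[OF i1 i2 zero_less_one]
  show "set_integrable lborel {0<..} (\<lambda>x. \<bar>f 0 - f x\<bar> * psi x)" by (rule h(1))
  show "(LBINT x:{0<..}. \<bar>f 0 - f x\<bar> * psi x) \<le> gap_integral b + K * (1 / (2 * a))"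
    unfolding h(2) v1 using g(2) v2 by linarith
qed

text \<open>
  Moving the fractional Laplacian onto the weight is not absolutely convergent, so the double
  integral is symmetrised first; the factor \<open>f x - f y\<close> is then split at the value \<open>f 0\<close>.
\<close>

lemma weighted_dissipation_bound:
  assumes a: "0 \<le> a" "a < 1/2" and b: "2 * a \<le> b" "2 * b < w" and K: "\<And>x. 0 \<le> f x" "\<And>x. f x \<le> K"
  shows "\<bar>LBINT x:{0<..}. wt w x * dissipation a f x\<bar> \<le>
     frac_const a * (commutator_const w a * (1 + 1 / (2 * a))) * (gap_integral b + K)"
proof (cases "a = 0")
  case True thus ?thesis by (simp add: dissipation_def frac_const_def)
next
  case False
  hence a: "0 < a" "a < 1/2" using a by auto
  have gK: "\<bar>f 0 - f x\<bar> \<le> K" for x using K[of 0] K[of x] by (simp add: abs_le_iff)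
  have K0: "K \<ge> 0" using gK[of 0] by simp
  have I0: "gap_integral b \<ge> 0" unfolding gap_integral_def by (rule set_integral_nonneg') simp
  define psi where "psi = (\<lambda>x. if x < 1 then x powr (- (w + 2 * a)) else x powr (- 1 - 2 * a))"
  have gw: "set_integrable lborel {0<..} (\<lambda>x. \<bar>f 0 - f x\<bar> * psi x)"
    "(LBINT x:{0<..}. \<bar>f 0 - f x\<bar> * psi x) \<le> gap_integral b + K * (1 / (2 * a))"
    unfolding psi_def by (rule gap_weighted_integral[OF a b K])+
  let ?CC = "commutator_const w a"
  have CC0: "?CC \<ge> 0" using a w by (intro commutator_const_nonneg) auto
  have psi0: "psi x \<ge> 0" for x unfolding psi_def by simp
  \<comment> \<open>Exchanging \<open>x\<close> and \<open>y\<close> in the double integral and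
    averaging replaces the weight by the difference \<open>wt w x - wt w y\<close>;
    \<open>\<Phi>\<close> is the absolute value of the resulting kernel.\<close>
  define \<Phi> where "\<Phi> x y = indicat_real {0<..} x * indicat_real {0<..} y * (\<bar>wt w x - wt w y\<bar> * half_line_kernel a x y)" for x y
  have Phi0: "\<Phi> x y \<ge> 0" for x y unfolding \<Phi>_def by (simp add: half_line_kernel_nonneg)
  have Phi_sym: "\<Phi> x y = \<Phi> y x" for x y
    unfolding \<Phi>_def by (simp add: half_line_kernel_sym[of a x y] abs_minus_commute mult.commute)
  have Phi_m[measurable]: "case_prod \<Phi> \<in> borel_measurable (lborel \<Otimes>\<^sub>M lborel)"
    unfolding \<Phi>_def[abs_def] half_line_kernel_def case_prod_beta by measurable
  have Phi_int: "integrable lborel (\<Phi> x)" "(LBINT y. \<Phi> x y) \<le> indicat_real {0<..} x * (?CC * psi x)" for x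
  proof -
    have e: "\<Phi> x = (\<lambda>y. indicat_real {0<..} x * (indicat_real {0<..} y *\<^sub>R (\<bar>wt w x - wt w y\<bar> * half_line_kernel a x y)))"
      by (auto simp: \<Phi>_def fun_eq_iff)
    show "integrable lborel (\<Phi> x)"
    proof (cases "x > 0")
      case True
      show ?thesis unfolding e
        using wt_commutator_bound(1)[OF True w disjI1[OF refl] a order_refl] by (simp add: set_integrable_def)
    qed (simp add: e)
    show "(LBINT y. \<Phi> x y) \<le> indicat_real {0<..} x * (?CC * psi x)"
    proof (cases "x > 0")
      case True
      have "(LBINT y. \<Phi> x y) = (LBINT y:{0<..}. \<bar>wt w x - wt w y\<bar> * half_line_kernel a x y)"
        unfolding e set_lebesgue_integral_def using True by simp
      also have "\<dots> \<le> ?CC * psi x"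
      proof (cases "x < 1")
        case True
        thus ?thesis using wt_commutator_bound_near[OF \<open>x > 0\<close> _ w a] by (simp add: psi_def)
      next
        case False
        show ?thesis
        proof (cases "x = 1")
          case True
          have "x powr (- (w + 2 * a)) = x powr (- 1 - 2 * a)" unfolding True by simp
          thus ?thesis using wt_commutator_bound_near[OF \<open>x > 0\<close> _ w a] True by (simp add: psi_def)
        next
          case False
          hence "x > 1" using \<open>\<not> x < 1\<close> by simp
          thus ?thesis using wt_commutator_bound_far[OF _ w a] by (simp add: psi_def)
        qed
      qed
      finally show ?thesis using True by simp
    qed (simp add: e)
  qed
  define h where "h x y = indicat_real {0<..} x * indicat_real {0<..} y * (wt w x * ((f x - f y) * half_line_kernel a x y))" for x y
  have h_m[measurable]: "case_prod h \<in> borel_measurable (lborel \<Otimes>\<^sub>M lborel)"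
    unfolding h_def[abs_def] half_line_kernel_def case_prod_beta by measurable
  have h_e: "h x = (\<lambda>y. (indicat_real {0<..} x * wt w x) * (indicat_real {0<..} y *\<^sub>R ((f x - f y) * half_line_kernel a x y)))" for x
    by (auto simp: h_def fun_eq_iff)
  have h_inner: "integrable lborel (h x)" for x
    unfolding h_e using dissipation_half_line(1)[OF a, of x] by (simp add: set_integrable_def)
  have h_int: "integrable (lborel \<Otimes>\<^sub>M lborel) (case_prod h)"
  proof (rule lborel_pair.Fubini_integrable[OF h_m])
    \<comment> \<open>This crude bound through \<open>M\<close> only justifies Fubini's theorem; it
      does not enter the estimate.\<close>
    let ?B = "2 * M * (2 / (1 - 2 * a) + 1 / a)"
    show "integrable lborel (\<lambda>x. LBINT y. norm (case_prod h (x, y)))"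
    proof (rule Bochner_Integration.integrable_bound)
      show "integrable lborel (\<lambda>x. ?B * (indicat_real {0<..} x *\<^sub>R wt w x))"
        using wt_integrable[OF w] by (simp add: set_integrable_def)
      show "(\<lambda>x. LBINT y. norm (case_prod h (x, y))) \<in> borel_measurable lborel" by measurable
      show "AE x in lborel. norm (LBINT y. norm (case_prod h (x, y))) \<le> norm (?B * (indicat_real {0<..} x *\<^sub>R wt w x))"
      proof (rule AE_I2)
        fix x
        show "norm (LBINT y. norm (case_prod h (x, y))) \<le> norm (?B * (indicat_real {0<..} x *\<^sub>R wt w x))"
        proof (cases "x > 0")
          case True
          have "(LBINT y. norm (case_prod h (x, y))) = wt w x * (LBINT y:{0<..}. \<bar>f x - f y\<bar> * half_line_kernel a x y)"
            unfolding set_lebesgue_integral_def integral_mult_right_zero[symmetric] using True wt_pos[OF True, of w]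
            by (intro Bochner_Integration.integral_cong) (auto simp: h_def abs_mult half_line_kernel_nonneg)
          also have "\<dots> \<le> wt w x * ?B"
            using dissipation_half_line(4)[OF a, of x] wt_pos[OF True, of w] by (intro mult_left_mono) auto
          finally have *: "(LBINT y. norm (case_prod h (x, y))) \<le> wt w x * ?B" .
          have "norm (LBINT y. norm (case_prod h (x, y))) = (LBINT y. norm (case_prod h (x, y)))" by simp
          also have "\<dots> \<le> \<bar>wt w x * ?B\<bar>" using * by linarith
          also have "\<dots> = norm (?B * (indicat_real {0<..} x *\<^sub>R wt w x))" using True by (simp add: mult.commute)
          finally show ?thesis .
        qed (simp add: h_def)
      qed
    qed
    show "AE x in lborel. integrable lborel (\<lambda>y. case_prod h (x, y))" using h_inner by simp
  qed
  define T where "T = (LINT p|(lborel \<Otimes>\<^sub>M lborel). case_prod h p)"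
  have T_eq: "(LBINT x:{0<..}. wt w x * dissipation a f x) = frac_const a * T"
  proof -
    have "T = (LBINT x. (LBINT y. h x y))"
      unfolding T_def using lborel_pair.integral_fst'[OF h_int] by simp
    also have "\<dots> = (LBINT x:{0<..}. wt w x * (LBINT y:{0<..}. (f x - f y) * half_line_kernel a x y))"
      unfolding set_lebesgue_integral_def by (simp add: h_e mult.assoc)
    finally have "frac_const a * T = (LBINT x:{0<..}. frac_const a * (wt w x * (LBINT y:{0<..}. (f x - f y) * half_line_kernel a x y)))"
      by (simp only: set_integral_mult_right)
    thus ?thesis by (auto simp: dissipation_half_line(3)[OF a] mult_ac)
  qed
  let ?H = "\<lambda>(x, y). h x y + h y x"
  have hs_int: "integrable (lborel \<Otimes>\<^sub>M lborel) (\<lambda>(x, y). h y x)"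
    using lborel_pair.integrable_product_swap[OF h_int] by (simp add: case_prod_beta)
  have hs_val: "(LINT p|(lborel \<Otimes>\<^sub>M lborel). (\<lambda>(x, y). h y x) p) = T"
    unfolding T_def using lborel_pair.integral_product_swap[of "case_prod h"] by simp
  have H_int: "integrable (lborel \<Otimes>\<^sub>M lborel) ?H"
    using Bochner_Integration.integrable_add[OF h_int hs_int] by (simp add: split_beta')
  have "(LINT p|(lborel \<Otimes>\<^sub>M lborel). ?H p) = T + T"
    using Bochner_Integration.integral_add[OF h_int hs_int] hs_val unfolding T_def by (simp add: split_beta')
  hence T2: "2 * \<bar>T\<bar> \<le> (LINT p|(lborel \<Otimes>\<^sub>M lborel). \<bar>?H p\<bar>)"
    using integral_abs_bound[of "lborel \<Otimes>\<^sub>M lborel" ?H] by simp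
  let ?R = "?CC * (gap_integral b + K * (1 / (2 * a)))"
  have R0: "?R \<ge> 0" using CC0 I0 K0 a by simp
  \<comment> \<open>The majorant is handled with nonnegative integrals, so Tonelli's theorem applies
    before its integrability is known. By symmetry of \<open>\<Phi>\<close> the second majorant,
    with \<open>f y\<close> in place of \<open>f x\<close>, has the same integral.\<close>
  have one: "(\<integral>\<^sup>+x. (\<integral>\<^sup>+y. ennreal (\<Phi> x y * \<bar>f 0 - f x\<bar>) \<partial>lborel) \<partial>lborel) \<le> ennreal ?R"
  proof -
    have "(\<integral>\<^sup>+y. ennreal (\<Phi> x y * \<bar>f 0 - f x\<bar>) \<partial>lborel) \<le> ennreal (?CC * (indicat_real {0<..} x *\<^sub>R (\<bar>f 0 - f x\<bar> * psi x)))" for x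
    proof -
      have "(\<integral>\<^sup>+y. ennreal (\<Phi> x y * \<bar>f 0 - f x\<bar>) \<partial>lborel) = ennreal (LBINT y. \<Phi> x y * \<bar>f 0 - f x\<bar>)"
        by (rule nn_integral_eq_integral) (use Phi_int(1) Phi0 in auto)
      also have "(LBINT y. \<Phi> x y * \<bar>f 0 - f x\<bar>) = (LBINT y. \<Phi> x y) * \<bar>f 0 - f x\<bar>" by simp
      also have "\<dots> \<le> (indicat_real {0<..} x * (?CC * psi x)) * \<bar>f 0 - f x\<bar>" by (rule mult_right_mono[OF Phi_int(2)]) simp
      finally show ?thesis by (simp add: mult_ac ennreal_leI)
    qed
    hence "(\<integral>\<^sup>+x. (\<integral>\<^sup>+y. ennreal (\<Phi> x y * \<bar>f 0 - f x\<bar>) \<partial>lborel) \<partial>lborel) \<le> (\<integral>\<^sup>+x. ennreal (?CC * (indicat_real {0<..} x *\<^sub>R (\<bar>f 0 - f x\<bar> * psi x))) \<partial>lborel)"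
      by (rule nn_integral_mono)
    also have "\<dots> = ennreal (LBINT x. ?CC * (indicat_real {0<..} x *\<^sub>R (\<bar>f 0 - f x\<bar> * psi x)))"
      by (rule nn_integral_eq_integral) (use gw(1) CC0 psi0 in \<open>auto simp: set_integrable_def\<close>)
    also have "(LBINT x. ?CC * (indicat_real {0<..} x *\<^sub>R (\<bar>f 0 - f x\<bar> * psi x))) = ?CC * (LBINT x:{0<..}. \<bar>f 0 - f x\<bar> * psi x)"
      unfolding set_lebesgue_integral_def by simp
    also have "\<dots> \<le> ?R" using gw(2) CC0 by (rule mult_left_mono)
    finally show ?thesis by (simp add: ennreal_leI)
  qed
  have m1: "(\<lambda>p. ennreal (case_prod (\<lambda>x y. \<Phi> x y * \<bar>f 0 - f x\<bar>) p)) \<in> borel_measurable (lborel \<Otimes>\<^sub>M lborel)"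
    by measurable
  have m2: "(\<lambda>p. ennreal (case_prod (\<lambda>x y. \<Phi> x y * \<bar>f 0 - f y\<bar>) p)) \<in> borel_measurable (lborel \<Otimes>\<^sub>M lborel)"
    by measurable
  have "ennreal (LINT p|(lborel \<Otimes>\<^sub>M lborel). \<bar>?H p\<bar>) = (\<integral>\<^sup>+p. ennreal \<bar>?H p\<bar> \<partial>(lborel \<Otimes>\<^sub>M lborel))"
    by (rule nn_integral_eq_integral[symmetric]) (use H_int in auto)
  also have "\<dots> \<le> (\<integral>\<^sup>+p. ennreal (case_prod (\<lambda>x y. \<Phi> x y * \<bar>f 0 - f x\<bar>) p) + ennreal (case_prod (\<lambda>x y. \<Phi> x y * \<bar>f 0 - f y\<bar>) p) \<partial>(lborel \<Otimes>\<^sub>M lborel))"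
  proof (rule nn_integral_mono)
    fix p :: "real \<times> real"
    obtain x y where p: "p = (x, y)" by (cases p)
    have "h x y + h y x = indicat_real {0<..} x * indicat_real {0<..} y * ((wt w x - wt w y) * half_line_kernel a x y) * (f x - f y)"
      unfolding h_def half_line_kernel_sym[of a y x] by (simp add: algebra_simps)
    hence "\<bar>h x y + h y x\<bar> = \<Phi> x y * \<bar>f x - f y\<bar>"
      unfolding \<Phi>_def by (simp add: abs_mult half_line_kernel_nonneg)
    also have "\<dots> \<le> \<Phi> x y * (\<bar>f 0 - f x\<bar> + \<bar>f 0 - f y\<bar>)" using Phi0 by (intro mult_left_mono) auto
    finally have "\<bar>h x y + h y x\<bar> \<le> \<Phi> x y * \<bar>f 0 - f x\<bar> + \<Phi> x y * \<bar>f 0 - f y\<bar>" by (simp add: distrib_left)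
    thus "ennreal \<bar>?H p\<bar> \<le> ennreal (case_prod (\<lambda>x y. \<Phi> x y * \<bar>f 0 - f x\<bar>) p) + ennreal (case_prod (\<lambda>x y. \<Phi> x y * \<bar>f 0 - f y\<bar>) p)"
      unfolding p using Phi0 by (simp add: ennreal_leI ennreal_plus[symmetric] del: ennreal_plus)
  qed
  also have "\<dots> = (\<integral>\<^sup>+p. ennreal (case_prod (\<lambda>x y. \<Phi> x y * \<bar>f 0 - f x\<bar>) p) \<partial>(lborel \<Otimes>\<^sub>M lborel)) +
      (\<integral>\<^sup>+p. ennreal (case_prod (\<lambda>x y. \<Phi> x y * \<bar>f 0 - f y\<bar>) p) \<partial>(lborel \<Otimes>\<^sub>M lborel))"
    by (rule nn_integral_add[OF m1 m2])
  also have "(\<integral>\<^sup>+p. ennreal (case_prod (\<lambda>x y. \<Phi> x y * \<bar>f 0 - f x\<bar>) p) \<partial>(lborel \<Otimes>\<^sub>M lborel)) =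
      (\<integral>\<^sup>+x. (\<integral>\<^sup>+y. ennreal (\<Phi> x y * \<bar>f 0 - f x\<bar>) \<partial>lborel) \<partial>lborel)"
    using lborel.nn_integral_fst[OF m1] by simp
  also have "(\<integral>\<^sup>+p. ennreal (case_prod (\<lambda>x y. \<Phi> x y * \<bar>f 0 - f y\<bar>) p) \<partial>(lborel \<Otimes>\<^sub>M lborel)) =
      (\<integral>\<^sup>+y. (\<integral>\<^sup>+x. ennreal (\<Phi> x y * \<bar>f 0 - f y\<bar>) \<partial>lborel) \<partial>lborel)"
    using lborel_pair.nn_integral_snd[OF m2] by simp
  also have "\<dots> = (\<integral>\<^sup>+x. (\<integral>\<^sup>+y. ennreal (\<Phi> x y * \<bar>f 0 - f x\<bar>) \<partial>lborel) \<partial>lborel)"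
    by (intro nn_integral_cong) (simp add: Phi_sym)
  also have "(\<integral>\<^sup>+x. (\<integral>\<^sup>+y. ennreal (\<Phi> x y * \<bar>f 0 - f x\<bar>) \<partial>lborel) \<partial>lborel) + (\<integral>\<^sup>+x. (\<integral>\<^sup>+y. ennreal (\<Phi> x y * \<bar>f 0 - f x\<bar>) \<partial>lborel) \<partial>lborel) \<le> ennreal ?R + ennreal ?R"
    by (rule add_mono[OF one one])
  also have "\<dots> = ennreal (2 * ?R)" using R0 by (simp add: ennreal_plus[symmetric] del: ennreal_plus)
  finally have "(LINT p|(lborel \<Otimes>\<^sub>M lborel). \<bar>?H p\<bar>) \<le> 2 * ?R"
    using R0 by (subst (asm) ennreal_le_iff) auto
  hence "\<bar>T\<bar> \<le> ?R" using T2 by linarith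
  also have "\<dots> = ?CC * (1 * gap_integral b + (1 / (2 * a)) * K)" by simp
  also have "\<dots> \<le> ?CC * ((1 + 1 / (2 * a)) * gap_integral b + (1 + 1 / (2 * a)) * K)"
    using I0 K0 a CC0 by (intro mult_left_mono add_mono mult_right_mono) auto
  also have "\<dots> = (?CC * (1 + 1 / (2 * a))) * (gap_integral b + K)"
  proof -
    have "C * (c * i + c * k) = (C * c) * (i + k)" for C c i k :: real by (simp add: algebra_simps)
    thus ?thesis .
  qed
  finally have "frac_const a * \<bar>T\<bar> \<le> frac_const a * ((?CC * (1 + 1 / (2 * a))) * (gap_integral b + K))"
    using frac_const_nonneg[of a] a by (intro mult_left_mono) auto
  thus ?thesis unfolding T_eq abs_mult using frac_const_nonneg[of a] a by (simp only: abs_of_nonneg mult.assoc less_imp_le)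
qed

end

section \<open>Growth of the blow-up functional\<close>

text \<open>The rate \<open>q\<close> is available only while \<open>Z \<ge> b\<close>. Up to a
  first return to the level \<open>b\<close> the mean value theorem makes \<open>Z\<close> grow from
  \<open>Z 0 > b\<close>, so there is no return and the rate persists up to time 1.\<close>

lemma growth_beyond_threshold:
  fixes Z :: "real \<Rightarrow> real"
  assumes c: "continuous_on {0..1} Z" and d: "\<And>t. t \<in> {0<..<1} \<Longrightarrow> (Z has_real_derivative Z' t) (at t)"
    and g: "\<And>t. t \<in> {0<..<1} \<Longrightarrow> Z t \<ge> b \<Longrightarrow> Z' t \<ge> q" and q: "q > 0" and Z0: "Z 0 > b"
  shows "Z 1 \<ge> Z 0 + q"
proof -
  have mvt: "Z t \<ge> Z 0 + q * t" if t: "0 < t" "t \<le> 1" and above: "\<And>s. 0 < s \<Longrightarrow> s < t \<Longrightarrow> Z s \<ge> b" for t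
  proof -
    have "\<exists>l z. 0 < z \<and> z < t \<and> (Z has_real_derivative l) (at z) \<and> Z t - Z 0 = (t - 0) * l"
    proof (rule MVT)
      show "continuous_on {0..t} Z" using t by (intro continuous_on_subset[OF c]) auto
      show "Z differentiable (at x)" if "0 < x" "x < t" for x
        using d[of x] that t by (auto simp: real_differentiable_def)
    qed (use t in auto)
    then obtain l z where z: "0 < z" "z < t" "(Z has_real_derivative l) (at z)" "Z t - Z 0 = t * l" by auto
    have "l = Z' z" using DERIV_unique[OF z(3) d[of z]] z t by auto
    hence "l \<ge> q" using g[of z] above[of z] z t by auto
    hence "t * q \<le> t * l" using t by (intro mult_left_mono) auto
    thus ?thesis using z(4) by (simp add: mult.commute)
  qed
  have "Z s > b" if s: "s \<in> {0..1}" for s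
  proof (rule ccontr)
    assume "\<not> Z s > b"
    define S where "S = {0..1} \<inter> Z -` {..b}"
    have ne: "S \<noteq> {}" using s \<open>\<not> Z s > b\<close> by (auto simp: S_def)
    have cl: "closed S" unfolding S_def by (rule continuous_closed_preimage[OF c]) auto
    have bd: "bdd_below S" by (rule bdd_belowI[of _ 0]) (auto simp: S_def)
    have in_S: "Inf S \<in> S" by (rule closed_contains_Inf[OF ne bd cl])
    define t where "t = Inf S"
    have t: "t \<in> {0..1}" "Z t \<le> b" using in_S by (auto simp: S_def t_def)
    have t0: "t > 0" using t Z0 by (cases "t = 0") auto
    have "Z r \<ge> b" if "0 < r" "r < t" for r
    proof (rule ccontr)
      assume "\<not> Z r \<ge> b"
      hence "r \<in> S" using that t by (auto simp: S_def)
      hence "t \<le> r" unfolding t_def by (rule cInf_lower[OF _ bd])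
      thus False using that by simp
    qed
    hence "Z t \<ge> Z 0 + q * t" using t t0 by (intro mvt) auto
    moreover have "q * t > 0" using q t0 by simp
    ultimately show False using t Z0 by linarith
  qed
  hence "Z 1 \<ge> Z 0 + q * 1" by (intro mvt) (auto intro: less_imp_le)
  thus ?thesis by simp
qed

context CCF_solution begin

text \<open>The full right-hand side of the equation, transport together with dissipation, and not
  only the velocity.\<close>

definition velocity_rhs where
  "velocity_rhs t x = hilbert_transform (\<theta> t) x * deriv (\<theta> t) x - dissipation \<alpha> (\<theta> t) x"

definition rhs_bound where
  "rhs_bound = (4 * bound + 1) * bound + frac_const \<alpha> * (2 * bound * (2 / (1 - 2 * \<alpha>) + 1 / \<alpha>))"

lemma velocity_rhs_bound:
  assumes t: "t \<in> {0..1}"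
  shows "\<bar>velocity_rhs t x\<bar> \<le> rhs_bound"
proof -
  note tb = tame_bound[OF t]
  have "\<bar>hilbert_transform (\<theta> t) x * deriv (\<theta> t) x\<bar> \<le> (4 * bound + 1) * bound"
    unfolding abs_mult using hilbert_transform_tame(3)[OF tb, of x] tameD(5)[OF tb, of x] tameD(12)[OF tb]
    by (intro mult_mono) auto
  thus ?thesis unfolding velocity_rhs_def rhs_bound_def using dissipation_bound[OF tb alpha(1) alpha_half, of x] by linarith
qed

text \<open>Supplies a bound for the difference quotients that is uniform in \<open>x\<close>, the
  majorant for differentiating under the integral. The open time interval is where the equation
  gives two-sided derivatives and \<open>rhs_bound\<close> applies.\<close>

lemma time_lipschitz:
  assumes "s \<in> {0<..<1}" "t \<in> {0<..<1}"
  shows "\<bar>\<theta> s x - \<theta> t x\<bar> \<le> rhs_bound * \<bar>s - t\<bar>"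
proof -
  have "norm (\<theta> s x - \<theta> t x) \<le> rhs_bound * norm (s - t)"
  proof (rule field_differentiable_bound[of "{0<..<1}" "\<lambda>s. \<theta> s x" "\<lambda>s. velocity_rhs s x"])
    fix r :: real assume r: "r \<in> {0<..<1}"
    show "((\<lambda>s. \<theta> s x) has_field_derivative velocity_rhs r x) (at r within {0<..<1})"
      unfolding velocity_rhs_def by (rule has_field_derivative_at_within[OF equation]) (use r in auto)
    show "norm (velocity_rhs r x) \<le> rhs_bound" using velocity_rhs_bound[of r x] r by auto
  qed (use assms in auto)
  thus ?thesis by simp
qed

text \<open>Dominated convergence of the difference quotients, along sequences, with majorant
  \<open>rhs_bound * wt w x\<close>.\<close>

lemma weighted_mean_deriv:
  assumes t: "t \<in> {0<..<1}" and w: "0 < w" "w < 1"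
  shows "set_integrable lborel {0<..} (\<lambda>x. wt w x * velocity_rhs t x)"
    "((\<lambda>s. LBINT x:{0<..}. wt w x * \<theta> s x) has_real_derivative
       (LBINT x:{0<..}. wt w x * velocity_rhs t x)) (at t)"
proof -
  have m[measurable]: "\<theta> s \<in> borel_measurable borel" if "s \<in> {0<..<1}" for s
    using tameD(10)[OF tame_bound[of s]] that by auto
  have wB: "set_integrable lborel {0<..} (\<lambda>x. rhs_bound * wt w x)"
    by (intro set_integrable_mult_right wt_integrable w)
  have wI: "set_integrable lborel {0<..} (\<lambda>x. wt w x * \<theta> s x)" if s: "s \<in> {0<..<1}" for s
    using wt_bounded_integrable[OF w m[OF s] tameD(4)[OF tame_bound]] s by auto
  have key: "(\<lambda>n. LBINT x:{0<..}. wt w x * ((\<theta> (X n) x - \<theta> t x) / (X n - t))) \<longlonglongrightarrow> (LBINT x:{0<..}. wt w x * velocity_rhs t x)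
     \<and> set_integrable lborel {0<..} (\<lambda>x. wt w x * velocity_rhs t x)"
    if X: "\<And>n. X n \<in> {0<..<1} - {t}" "X \<longlonglongrightarrow> t" for X
  proof -
    let ?s = "\<lambda>n x. indicat_real {0<..} x *\<^sub>R (wt w x * ((\<theta> (X n) x - \<theta> t x) / (X n - t)))"
    have lim: "(\<lambda>n. ?s n x) \<longlonglongrightarrow> indicat_real {0<..} x *\<^sub>R (wt w x * velocity_rhs t x)" for x
    proof -
      have "((\<lambda>s. (\<theta> s x - \<theta> t x) / (s - t)) \<longlongrightarrow> velocity_rhs t x) (at t)"
        using equation[of t x] t unfolding has_field_derivative_iff velocity_rhs_def by simp
      hence "(\<lambda>n. (\<theta> (X n) x - \<theta> t x) / (X n - t)) \<longlonglongrightarrow> velocity_rhs t x"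
        using X unfolding tendsto_at_iff_sequentially comp_def by auto
      thus ?thesis by (intro tendsto_intros)
    qed
    have sm: "?s n \<in> borel_measurable lborel" for n
    proof -
      have [measurable]: "\<theta> (X n) \<in> borel_measurable borel" "\<theta> t \<in> borel_measurable borel" using m X(1)[of n] t by auto
      show ?thesis by measurable
    qed
    \<comment> \<open>Measurability of the right-hand side in \<open>x\<close> is inherited from the
      difference quotients.\<close>
    have lm: "(\<lambda>x. indicat_real {0<..} x *\<^sub>R (wt w x * velocity_rhs t x)) \<in> borel_measurable lborel"
      by (rule borel_measurable_LIMSEQ_real[OF lim sm])
    have dom: "norm (?s n x) \<le> indicat_real {0<..} x *\<^sub>R (rhs_bound * wt w x)" for n x
    proof (cases "x > 0")
      case True
      have "\<bar>(\<theta> (X n) x - \<theta> t x) / (X n - t)\<bar> \<le> rhs_bound"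
        using time_lipschitz[of "X n" t x] X(1)[of n] t by (auto simp: abs_divide field_simps)
      from mult_left_mono[OF this less_imp_le[OF wt_pos[OF True, of w]]]
      show ?thesis using True wt_pos[OF True, of w] by (simp add: abs_mult abs_divide mult.commute)
    qed simp
    note D = lm sm wB[unfolded set_integrable_def] AE_I2[OF lim] AE_I2[OF dom]
    show ?thesis unfolding set_lebesgue_integral_def set_integrable_def
      using integral_dominated_convergence[OF D] integrable_dominated_convergence[OF D] by blast
  qed
  have quot: "(LBINT x:{0<..}. wt w x * ((\<theta> s x - \<theta> t x) / (s - t))) =
      ((LBINT x:{0<..}. wt w x * \<theta> s x) - (LBINT x:{0<..}. wt w x * \<theta> t x)) / (s - t)" if s: "s \<in> {0<..<1}" for s
  proof -
    have "(LBINT x:{0<..}. wt w x * ((\<theta> s x - \<theta> t x) / (s - t))) = (LBINT x:{0<..}. (wt w x * \<theta> s x - wt w x * \<theta> t x) / (s - t))"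
      by (simp add: right_diff_distrib)
    also have "\<dots> = (LBINT x:{0<..}. wt w x * \<theta> s x - wt w x * \<theta> t x) / (s - t)"
      by (rule set_integral_divide_zero)
    also have "(LBINT x:{0<..}. wt w x * \<theta> s x - wt w x * \<theta> t x) = (LBINT x:{0<..}. wt w x * \<theta> s x) - (LBINT x:{0<..}. wt w x * \<theta> t x)"
      by (rule set_integral_diff(2)[OF wI[OF s] wI[OF t]])
    finally show ?thesis .
  qed
  have "((\<lambda>s. LBINT x:{0<..}. wt w x * \<theta> s x) has_real_derivative
       (LBINT x:{0<..}. wt w x * velocity_rhs t x)) (at t within {0<..<1})"
    unfolding has_field_derivative_iff tendsto_at_iff_sequentially comp_def
  proof (intro allI impI)
    fix X :: "nat \<Rightarrow> real" assume X: "\<forall>i. X i \<in> {0<..<1} - {t}" "X \<longlonglongrightarrow> t"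
    have "(LBINT x:{0<..}. wt w x * ((\<theta> (X n) x - \<theta> t x) / (X n - t))) =
      ((LBINT x:{0<..}. wt w x * \<theta> (X n) x) - (LBINT x:{0<..}. wt w x * \<theta> t x)) / (X n - t)" for n
      by (rule quot) (use X in auto)
    thus "(\<lambda>n. ((LBINT x:{0<..}. wt w x * \<theta> (X n) x) - (LBINT x:{0<..}. wt w x * \<theta> t x)) / (X n - t))
       \<longlonglongrightarrow> (LBINT x:{0<..}. wt w x * velocity_rhs t x)"
      using key[of X] X by simp
  qed
  thus "((\<lambda>s. LBINT x:{0<..}. wt w x * \<theta> s x) has_real_derivative
       (LBINT x:{0<..}. wt w x * velocity_rhs t x)) (at t)"
    using t by (simp add: at_within_open[of t "{0<..<1}"])
  \<comment> \<open>Integrability of the limit comes out of dominated convergence along one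
    sequence, so one has to be exhibited.\<close>
  have "\<exists>X. (\<forall>n. X n \<in> {0<..<1} - {t}) \<and> X \<longlonglongrightarrow> t"
  proof -
    have "t islimpt {0<..<1}" using t by (intro open_imp_islimpt) auto
    thus ?thesis unfolding islimpt_sequential by auto
  qed
  then obtain X where "\<And>n. X n \<in> {0<..<1} - {t}" "X \<longlonglongrightarrow> t" by blast
  thus "set_integrable lborel {0<..} (\<lambda>x. wt w x * velocity_rhs t x)" using key by blast
qed

lemma weighted_mean_continuous:
  assumes w: "0 < w" "w < 1"
  shows "continuous_on {0..1} (\<lambda>s. LBINT x:{0<..}. wt w x * \<theta> s x)"
  unfolding continuous_on_iff
proof (intro ballI allI impI)
  fix t e :: real assume t: "t \<in> {0..1}" and e: "e > 0"
  let ?L = "LBINT x:{0<..}. wt w x"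
  have L: "?L \<ge> 0" by (rule wt_mass_nonneg)
  have wI: "set_integrable lborel {0<..} (\<lambda>x. wt w x * \<theta> s x)" if s: "s \<in> {0..1}" for s
    by (rule wt_bounded_integrable[OF w tameD(10)[OF tame_bound[OF s]] tameD(4)[OF tame_bound[OF s]]])
  define \<epsilon> where "\<epsilon> = e / (2 * (?L + 1))"
  have eps: "\<epsilon> > 0" unfolding \<epsilon>_def using e L by simp
  obtain d where d: "d > 0" "\<And>s x. s \<ge> 0 \<Longrightarrow> \<bar>s - t\<bar> < d \<Longrightarrow> \<bar>\<theta> s x - \<theta> t x\<bar> \<le> \<epsilon>"
    using uniform_continuity[of t \<epsilon>] t eps by auto
  show "\<exists>d>0. \<forall>s\<in>{0..1}. dist s t < d \<longrightarrow> dist (LBINT x:{0<..}. wt w x * \<theta> s x) (LBINT x:{0<..}. wt w x * \<theta> t x) < e"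
  proof (intro exI[of _ d] conjI ballI impI d(1))
    fix s :: real assume s: "s \<in> {0..1}" "dist s t < d"
    have "(LBINT x:{0<..}. wt w x * \<theta> s x) - (LBINT x:{0<..}. wt w x * \<theta> t x) = (LBINT x:{0<..}. wt w x * \<theta> s x - wt w x * \<theta> t x)"
      by (rule set_integral_diff(2)[symmetric, OF wI[OF s(1)] wI[OF t]])
    also have "\<bar>\<dots>\<bar> \<le> (LBINT x:{0<..}. \<epsilon> * wt w x)"
    proof (rule set_integrable_dominated(2))
      show "set_integrable lborel {0<..} (\<lambda>x. \<epsilon> * wt w x)" by (intro set_integrable_mult_right wt_integrable w)
      show "(\<lambda>x. wt w x * \<theta> s x - wt w x * \<theta> t x) \<in> borel_measurable borel"
        using tameD(10)[OF tame_bound[OF s(1)]] tameD(10)[OF tame_bound[OF t]] by measurable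
      fix x :: real assume "x \<in> {0<..}"
      hence x: "x > 0" by simp
      have "\<bar>wt w x * \<theta> s x - wt w x * \<theta> t x\<bar> = wt w x * \<bar>\<theta> s x - \<theta> t x\<bar>"
        using wt_pos[OF x, of w] by (simp add: right_diff_distrib[symmetric] abs_mult)
      also have "\<dots> \<le> wt w x * \<epsilon>" using wt_pos[OF x, of w] d(2)[of s x] s by (intro mult_left_mono) (auto simp: dist_real_def)
      finally show "\<bar>wt w x * \<theta> s x - wt w x * \<theta> t x\<bar> \<le> \<epsilon> * wt w x" by (simp add: mult.commute)
    qed simp
    also have "\<dots> = \<epsilon> * ?L" by simp
    also have "\<dots> < e"
    proof -
      have "\<epsilon> * ?L \<le> \<epsilon> * (?L + 1)" using eps by (intro mult_left_mono) auto
      also have "\<dots> = e / 2"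
      proof -
        have cancel: "e / (2 * l) * l = e / 2" if "l > 0" for l :: real using that by simp
        show ?thesis unfolding \<epsilon>_def by (rule cancel) (use L in simp)
      qed
      finally show ?thesis using e by simp
    qed
    finally show "dist (LBINT x:{0<..}. wt w x * \<theta> s x) (LBINT x:{0<..}. wt w x * \<theta> t x) < e"
      by (simp add: dist_real_def)
  qed
qed

text \<open>The solution-dependent \<open>bound\<close> has disappeared: \<open>Cd\<close> and
  \<open>G\<close> depend on \<open>\<alpha>\<close>, \<open>w\<close> and \<open>b\<close> only, so
  \<open>K\<close> can be chosen in terms of them. The coefficient \<open>7 / (8 * pi)\<close> is
  twice the coercivity constant, owing to the factor 2 in \<open>Z\<close>. The parameter
  \<open>l\<close> is quantified separately in the two estimates because different values will be
  inserted.\<close>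

lemma main_differential_inequality:
  fixes w b K :: real
  assumes w: "0 < w" "w < 1" and b: "2 * \<alpha> \<le> b" "-1 \<le> b" "2 * b < w"
    and init: "\<And>x. 0 \<le> \<theta>\<^sub>0 x" "\<And>x. \<theta>\<^sub>0 x \<le> K" "\<And>x. \<theta>\<^sub>0 (-x) = \<theta>\<^sub>0 x" and K: "K > 0"
    and t: "t \<in> {0<..<1}"
  defines "Z \<equiv> \<lambda>s. \<theta> s 0 - 2 * (LBINT x:{0<..}. wt w x * \<theta> s x)"
    and "Cd \<equiv> frac_const \<alpha> * (2 + 1 / \<alpha>) + 2 * (frac_const \<alpha> * (commutator_const w \<alpha> * (1 + 1 / (2 * \<alpha>))))"
    and "G \<equiv> 1 + 1 / (w/2 - b) + 1 / (w/2 - b) / w"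
  shows "\<exists>Z' A. (Z has_real_derivative Z') (at t) \<and> A \<ge> 0 \<and>
    (\<forall>l>0. Z' \<ge> 7 / (8 * pi) * A - Cd * (G * (l * A + 1 / l) + K)) \<and> (\<forall>l>0. Z t \<le> G * (l * A + 1 / l))"
proof -
  have t': "t \<in> {0..1}" "t > 0" using t by auto
  interpret pr: even_profile w bound "\<theta> t"
    by unfold_locales (use tame_bound[OF t'(1)] even[OF init(3) t'(1)] w in auto)
  have pos: "0 \<le> \<theta> t x" for x by (rule nonneg[OF init(1) t'(1)])
  have up: "\<theta> t x \<le> K" for x by (rule upper_bound[OF init(2) K t'(1)])
  have Cd0: "Cd \<ge> 0"
    unfolding Cd_def using alpha w
    by (intro add_nonneg_nonneg mult_nonneg_nonneg commutator_const_nonneg frac_const_nonneg) auto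
  let ?I = "pr.gap_integral b"
  let ?D = "LBINT x:{0<..}. wt w x * dissipation \<alpha> (\<theta> t) x"
  let ?N = "LBINT x:{0<..}. wt w x * (hilbert_transform (\<theta> t) x * deriv (\<theta> t) x)"
  have I: "?I \<le> G * (l * pr.A + 1 / l)" if "l > 0" for l
    using pr.gap_integral_bound(2)[OF b(3) that] unfolding pr.gap_const_def G_def .
  \<comment> \<open>Evenness kills the transport term at the origin, so the value there changes by
    dissipation alone.\<close>
  have dx0: "deriv (\<theta> t) 0 = 0"
  proof -
    have "((\<lambda>x. \<theta> t (-x)) has_real_derivative - deriv (\<theta> t) 0) (at 0)"
      using DERIV_mirror[THEN iffD1, of "\<theta> t" "deriv (\<theta> t) 0" 0] tameD(1)[OF tame_bound[OF t'(1)], of 0] by simp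
    moreover have "(\<lambda>x. \<theta> t (-x)) = \<theta> t" using even[OF init(3) t'(1)] by auto
    ultimately have "(\<theta> t has_real_derivative - deriv (\<theta> t) 0) (at 0)" by simp
    hence "deriv (\<theta> t) 0 = - deriv (\<theta> t) 0" by (rule DERIV_imp_deriv)
    thus ?thesis by simp
  qed
  have dm: "((\<lambda>s. \<theta> s 0) has_real_derivative - dissipation \<alpha> (\<theta> t) 0) (at t)"
    using equation[OF t'(2), of 0] dx0 by simp
  note dP = weighted_mean_deriv[OF t w]
  have P_split: "(LBINT x:{0<..}. wt w x * velocity_rhs t x) = ?N - ?D"
  proof -
    have e: "wt w x * dissipation \<alpha> (\<theta> t) x = wt w x * (hilbert_transform (\<theta> t) x * deriv (\<theta> t) x) - wt w x * velocity_rhs t x" for x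
      unfolding velocity_rhs_def by (simp add: right_diff_distrib)
    have "?D = ?N - (LBINT x:{0<..}. wt w x * velocity_rhs t x)"
      unfolding e by (rule set_integral_diff(2)[OF pr.coercivity(1) dP(1)])
    thus ?thesis by simp
  qed
  let ?Z' = "- dissipation \<alpha> (\<theta> t) 0 - 2 * (?N - ?D)"
  have dZ: "(Z has_real_derivative ?Z') (at t)"
    unfolding Z_def P_split[symmetric] by (intro DERIV_diff dm DERIV_cmult dP)
  have b1: "\<bar>dissipation \<alpha> (\<theta> t) 0\<bar> \<le> frac_const \<alpha> * (2 + 1 / \<alpha>) * (?I + K)"
    by (rule pr.dissipation_at_0_bound[OF alpha(1) alpha_half b(1,3) pos up])
  have b2: "\<bar>?D\<bar> \<le> frac_const \<alpha> * (commutator_const w \<alpha> * (1 + 1 / (2 * \<alpha>))) * (?I + K)"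
    by (rule pr.weighted_dissipation_bound[OF alpha(1) alpha_half b(1,3) pos up])
  have "Cd * (?I + K) = frac_const \<alpha> * (2 + 1 / \<alpha>) * (?I + K) + 2 * (frac_const \<alpha> * (commutator_const w \<alpha> * (1 + 1 / (2 * \<alpha>))) * (?I + K))"
    unfolding Cd_def by (simp only: distrib_right mult.assoc)
  moreover have "2 * (- 7 / (16 * pi) * pr.A) = - (7 / (8 * pi) * pr.A)" by simp
  moreover have "p - s \<le> - d - 2 * (n - e)"
    if "s = u + 2 * v" "2 * r = - p" "\<bar>d\<bar> \<le> u" "\<bar>e\<bar> \<le> v" "n \<le> r" for p s d n e u v r :: real
    unfolding right_diff_distrib using that by linarith
  ultimately have Z'_ge: "?Z' \<ge> 7 / (8 * pi) * pr.A - Cd * (?I + K)"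
    using b1 b2 pr.coercivity(2) by blast
  have 1: "?Z' \<ge> 7 / (8 * pi) * pr.A - Cd * (G * (l * pr.A + 1 / l) + K)" if l: "l > 0" for l
  proof -
    have "Cd * (?I + K) \<le> Cd * (G * (l * pr.A + 1 / l) + K)" using I[OF l] Cd0 by (intro mult_left_mono) auto
    thus ?thesis using Z'_ge by linarith
  qed
  \<comment> \<open>On \<open>(0, 1)\<close> the weight is at least 1/2, so twice the weighted mean
    dominates the integral of \<open>\<theta> t\<close> over \<open>(0, 1)\<close>. This is the
    origin of the factor 2 in \<open>Z\<close>, which is thus at most the integral of the gap over
    \<open>(0, 1)\<close>.\<close>
  have ZI: "Z t \<le> ?I"
  proof -
    have wI: "set_integrable lborel {0<..} (\<lambda>x. wt w x * \<theta> t x)"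
      by (rule wt_bounded_integrable[OF w tameD(10)[OF tame_bound[OF t'(1)]] tameD(4)[OF tame_bound[OF t'(1)]]])
    have "set_integrable lborel {0..1} (\<theta> t)"
      by (rule borel_integrable_atLeastAtMost'[OF tameD(3)[OF tame_bound[OF t'(1)]]])
    hence i: "set_integrable lborel {0<..<1} (\<theta> t)" by (rule set_integrable_subset) auto
    have ic: "set_integrable lborel {0<..<1} (\<lambda>x::real. \<theta> t 0)"
      unfolding set_integrable_def by (auto intro!: integrable_real_indicator)
    have "(LBINT x:{0<..<1}. \<theta> t x) \<le> (LBINT x:{0<..<1}. 2 * (wt w x * \<theta> t x))"
    proof (rule set_integral_mono[OF i])
      show "set_integrable lborel {0<..<1} (\<lambda>x. 2 * (wt w x * \<theta> t x))"
        by (rule set_integrable_mult_right, rule set_integrable_subset[OF wI]) auto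
      fix x :: real assume x: "x \<in> {0<..<1}"
      have "1 \<le> x powr (-w)" using x w powr_mono'[of "-w" 0 x] by auto
      hence "1/2 \<le> wt w x" using wt_ge[of x w] x w by auto
      hence "1/2 * \<theta> t x \<le> wt w x * \<theta> t x" using pos[of x] by (rule mult_right_mono)
      thus "\<theta> t x \<le> 2 * (wt w x * \<theta> t x)" by simp
    qed
    also have "\<dots> = 2 * (LBINT x:{0<..<1}. wt w x * \<theta> t x)" by (rule set_integral_mult_right)
    also have "(LBINT x:{0<..<1}. wt w x * \<theta> t x) \<le> (LBINT x:{0<..}. wt w x * \<theta> t x)"
      by (rule set_integral_nonneg_mono_set[OF wI]) (use pos in \<open>auto intro!: mult_nonneg_nonneg less_imp_le[OF wt_pos]\<close>)
    finally have "Z t \<le> \<theta> t 0 - (LBINT x:{0<..<1}. \<theta> t x)" unfolding Z_def by simp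
    also have "\<theta> t 0 = (LBINT x:{0<..<1::real}. \<theta> t 0)" by (simp add: set_lebesgue_integral_def)
    also have "(LBINT x:{0<..<1::real}. \<theta> t 0) - (LBINT x:{0<..<1}. \<theta> t x) = (LBINT x:{0<..<1}. \<theta> t 0 - \<theta> t x)"
      by (rule set_integral_diff(2)[symmetric, OF ic i])
    also have "\<dots> \<le> (LBINT x:{0<..<1}. \<bar>\<theta> t 0 - \<theta> t x\<bar> * x powr (- 0))"
    proof (rule set_integral_mono)
      show "set_integrable lborel {0<..<1} (\<lambda>x. \<theta> t 0 - \<theta> t x)" by (rule set_integral_diff(1)[OF ic i])
      show "set_integrable lborel {0<..<1} (\<lambda>x. \<bar>\<theta> t 0 - \<theta> t x\<bar> * x powr (- 0))"
        by (rule pr.gap_integral_mono(1)[OF b(3)]) (use b in auto)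
    qed auto
    also have "\<dots> \<le> ?I" by (rule pr.gap_integral_mono(2)[OF b(3)]) (use b in auto)
    finally show ?thesis .
  qed
  have 2: "Z t \<le> G * (l * pr.A + 1 / l)" if "l > 0" for l using ZI I[OF that] by linarith
  show ?thesis using dZ pr.A_nonneg 1 2 by blast
qed

end

section \<open>Gaussian initial data\<close>

text \<open>For \<open>\<bar>x\<bar> > 1\<close> raise \<open>u \<le> exp u\<close> with
  \<open>u = N * x\<^sup>2 / (k + 1)\<close> to the power \<open>k + 1\<close>; the resulting
  \<open>x ^ (2 * (k + 1))\<close> dominates \<open>\<bar>x\<bar> ^ k\<close>.\<close>

lemma power_gaussian_bounded:
  assumes N: "N > (0::real)"
  shows "\<exists>B. \<forall>x. \<bar>x ^ k * exp (- N * x\<^sup>2)\<bar> \<le> B"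
proof (intro exI allI)
  fix x :: real
  define c where "c = (real (Suc k) / N) ^ Suc k"
  have c: "c > 0" unfolding c_def using N by simp
  show "\<bar>x ^ k * exp (- N * x\<^sup>2)\<bar> \<le> 1 + c"
  proof (cases "\<bar>x\<bar> \<le> 1")
    case True
    have "\<bar>x ^ k\<bar> \<le> 1" using True by (simp add: power_abs power_le_one)
    moreover have "exp (- N * x\<^sup>2) \<le> 1" using N by simp
    ultimately have "\<bar>x ^ k\<bar> * exp (- N * x\<^sup>2) \<le> 1 * 1" by (intro mult_mono) auto
    thus ?thesis using c by (simp add: abs_mult)
  next
    case False
    let ?m = "real (Suc k)"
    have "N * x\<^sup>2 / ?m \<le> exp (N * x\<^sup>2 / ?m)" using exp_ge_add_one_self[of "N * x\<^sup>2 / ?m"] by linarith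
    hence "(N * x\<^sup>2 / ?m) ^ Suc k \<le> exp (N * x\<^sup>2 / ?m) ^ Suc k" using N by (intro power_mono) auto
    also have "exp (N * x\<^sup>2 / ?m) ^ Suc k = exp (N * x\<^sup>2)"
      unfolding exp_of_nat_mult[symmetric] by simp
    finally have 1: "(N * x\<^sup>2 / ?m) ^ Suc k \<le> exp (N * x\<^sup>2)" .
    have "\<bar>x\<bar> ^ k \<le> \<bar>x\<bar> ^ (2 * Suc k)" using False by (intro power_increasing) auto
    also have "\<dots> = (x\<^sup>2) ^ Suc k" by (simp only: power_mult power2_abs)
    also have "\<dots> = c * (N * x\<^sup>2 / ?m) ^ Suc k"
      unfolding c_def power_mult_distrib[symmetric] using N by simp
    also have "\<dots> \<le> c * exp (N * x\<^sup>2)" using 1 c by (intro mult_left_mono) auto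
    finally have "\<bar>x\<bar> ^ k * exp (- N * x\<^sup>2) \<le> c * exp (N * x\<^sup>2) * exp (- N * x\<^sup>2)" by (rule mult_right_mono) simp
    also have "\<dots> = c" by (simp add: mult.assoc flip: exp_add)
    finally show ?thesis by (simp add: abs_mult power_abs)
  qed
qed

lemma poly_gaussian_bounded:
  assumes N: "N > (0::real)"
  shows "\<exists>B. \<forall>x. \<bar>poly p x * exp (- N * x\<^sup>2)\<bar> \<le> B"
proof -
  obtain B where B: "\<And>k x. \<bar>x ^ k * exp (- N * x\<^sup>2)\<bar> \<le> B k" using power_gaussian_bounded[OF N] by metis
  show ?thesis
  proof (intro exI allI)
    fix x :: real
    have "poly p x * exp (- N * x\<^sup>2) = (\<Sum>i\<le>degree p. coeff p i * (x ^ i * exp (- N * x\<^sup>2)))"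
      unfolding poly_altdef by (simp add: sum_distrib_right mult.assoc)
    also have "\<bar>\<dots>\<bar> \<le> (\<Sum>i\<le>degree p. \<bar>coeff p i * (x ^ i * exp (- N * x\<^sup>2))\<bar>)" by (rule sum_abs)
    also have "\<dots> \<le> (\<Sum>i\<le>degree p. \<bar>coeff p i\<bar> * B i)"
      by (rule sum_mono) (use B in \<open>simp only: abs_mult[of "coeff p _"]\<close>, auto intro!: mult_left_mono)
    finally show "\<bar>poly p x * exp (- N * x\<^sup>2)\<bar> \<le> (\<Sum>i\<le>degree p. \<bar>coeff p i\<bar> * B i)" .
  qed
qed

lemma poly_gaussian_integrable:
  assumes N: "N > (0::real)"
  shows "integrable lborel (\<lambda>x. poly p x * exp (- N * x\<^sup>2))"
proof -
  obtain B1 where B1: "\<And>x. \<bar>poly p x * exp (- N * x\<^sup>2)\<bar> \<le> B1" using poly_gaussian_bounded[OF N] by blast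
  obtain B2 where B2: "\<And>x. \<bar>poly (p * monom 1 2) x * exp (- N * x\<^sup>2)\<bar> \<le> B2" using poly_gaussian_bounded[OF N] by blast
  define B where "B = max B1 B2"
  have B0: "B \<ge> 0" using B1[of 0] unfolding B_def by linarith
  \<comment> \<open>The truncated kernel serves as a ready-made integrable majorant: it behaves like
    \<open>\<bar>z\<bar> powr (-1/2)\<close> near 0 and \<open>\<bar>z\<bar> powr (-3/2)\<close> at
    infinity, below which the bounds \<open>B1\<close> and \<open>B2 / x\<^sup>2\<close>
    fit.\<close>
  have i: "integrable lborel (\<lambda>z. B * (min 1 \<bar>z\<bar> * frac_kernel (1/4) z))"
    by (intro integrable_mult_right frac_kernel_truncated_integrable) auto
  show ?thesis
  proof (rule Bochner_Integration.integrable_bound[OF i])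
    show "(\<lambda>x. poly p x * exp (- N * x\<^sup>2)) \<in> borel_measurable lborel"
      by (intro borel_measurable_continuous_onI[THEN measurable_lborel2[THEN equalityD2, THEN subsetD]] continuous_intros)
    show "AE x in lborel. norm (poly p x * exp (- N * x\<^sup>2)) \<le> norm (B * (min 1 \<bar>x\<bar> * frac_kernel (1/4) x))"
      using AE_lborel_singleton[of 0]
    proof eventually_elim
      case (elim x)
      have "\<bar>poly p x * exp (- N * x\<^sup>2)\<bar> \<le> B * (min 1 \<bar>x\<bar> * frac_kernel (1/4) x)"
      proof (cases "\<bar>x\<bar> \<le> 1")
        case True
        have "\<bar>x\<bar> powr 1 * \<bar>x\<bar> powr (-1 - 2 * (1/4)) = \<bar>x\<bar> powr (-1/2)" by (simp only: powr_add[symmetric]) simp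
        moreover have "1 \<le> \<bar>x\<bar> powr (-1/2)" using True elim powr_mono'[of "-1/2" 0 "\<bar>x\<bar>"] by auto
        ultimately have "1 \<le> min 1 \<bar>x\<bar> * frac_kernel (1/4) x" using True by (simp add: frac_kernel_def min_def)
        hence "B * 1 \<le> B * (min 1 \<bar>x\<bar> * frac_kernel (1/4) x)" using B0 by (rule mult_left_mono)
        thus ?thesis using B1[of x] unfolding B_def by simp
      next
        case False
        have "\<bar>poly p x * exp (- N * x\<^sup>2)\<bar> * x\<^sup>2 \<le> B"
          using B2[of x] unfolding B_def by (simp add: poly_monom abs_mult mult_ac)
        hence "\<bar>poly p x * exp (- N * x\<^sup>2)\<bar> \<le> B * (1 / x\<^sup>2)" using elim by (simp add: field_simps)
        also have "1 / x\<^sup>2 = \<bar>x\<bar> powr (-2)" using False by (simp add: powr_minus_divide powr_numeral)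
        also have "B * \<bar>x\<bar> powr (-2) \<le> B * \<bar>x\<bar> powr (-1 - 2 * (1/4))" using False B0 by (intro mult_left_mono powr_mono) auto
        finally show ?thesis using False by (simp add: frac_kernel_def)
      qed
      thus ?case using B0 by (simp add: abs_mult)
    qed
  qed
qed

text \<open>Every derivative is a polynomial times the same Gaussian, and its square is a polynomial
  times the Gaussian with \<open>2 * N\<close>.\<close>

lemma smooth_Sobolev_gaussian:
  assumes N: "N > (0::real)"
  shows "smooth_Sobolev (\<lambda>x. K * exp (- N * x\<^sup>2))"
proof -
  have d: "((\<lambda>x. poly p x * exp (- N * x\<^sup>2)) has_real_derivative
      poly (pderiv p - [:0, 2 * N:] * p) x * exp (- N * x\<^sup>2)) (at x)" for p x
    by (auto intro!: derivative_eq_intros poly_DERIV simp: algebra_simps)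
  have ex: "\<exists>p. (deriv ^^ n) (\<lambda>x. K * exp (- N * x\<^sup>2)) = (\<lambda>x. poly p x * exp (- N * x\<^sup>2))" for n
  proof (induction n)
    case 0
    show ?case by (intro exI[of _ "[:K:]"]) simp
  next
    case (Suc n)
    then obtain p where p: "(deriv ^^ n) (\<lambda>x. K * exp (- N * x\<^sup>2)) = (\<lambda>x. poly p x * exp (- N * x\<^sup>2))" by blast
    have "(deriv ^^ Suc n) (\<lambda>x. K * exp (- N * x\<^sup>2)) = (\<lambda>x. poly (pderiv p - [:0, 2 * N:] * p) x * exp (- N * x\<^sup>2))"
      unfolding funpow.simps comp_def p using DERIV_imp_deriv[OF d[of p]] by (intro ext)
    thus ?case by blast
  qed
  show ?thesis unfolding smooth_Sobolev_def
  proof (intro conjI allI)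
    fix n x
    obtain p where p: "(deriv ^^ n) (\<lambda>x. K * exp (- N * x\<^sup>2)) = (\<lambda>x. poly p x * exp (- N * x\<^sup>2))" using ex by blast
    show "(deriv ^^ n) (\<lambda>x. K * exp (- N * x\<^sup>2)) differentiable (at x)"
      unfolding p using d[of p x] by (auto simp: real_differentiable_def)
    have "(\<lambda>x. (poly p x * exp (- N * x\<^sup>2))\<^sup>2) = (\<lambda>x. poly (p * p) x * exp (- (2 * N) * x\<^sup>2))"
      by (auto simp: fun_eq_iff power_mult_distrib power2_eq_square simp flip: exp_add)
    thus "integrable lborel (\<lambda>x. ((deriv ^^ n) (\<lambda>x. K * exp (- N * x\<^sup>2)) x)\<^sup>2)"
      unfolding p using poly_gaussian_integrable[of "2 * N" "p * p"] N by simp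
  qed
qed

text \<open>Concentration makes the weighted mean of the data negligible against their height,
  independently of the amplitude; the initial value of \<open>Z\<close> is then close to
  \<open>K\<close>.\<close>

lemma concentrated_gaussian:
  assumes w: "0 < w" "w < 1" and e: "e > 0"
  shows "\<exists>N>0. (LBINT x:{0<..}. wt w x * exp (- N * x\<^sup>2)) < e"
proof -
  have "(\<lambda>n. LBINT x. indicat_real {0<..} x *\<^sub>R (wt w x * exp (- real (Suc n) * x\<^sup>2))) \<longlonglongrightarrow> (LBINT (x::real). 0)"
  proof (rule integral_dominated_convergence[where w="\<lambda>x. indicat_real {0<..} x *\<^sub>R wt w x"])
    show "integrable lborel (\<lambda>x. indicat_real {0<..} x *\<^sub>R wt w x)" using wt_integrable[OF w] by (simp add: set_integrable_def)
    show "AE x in lborel. (\<lambda>n. indicat_real {0<..} x *\<^sub>R (wt w x * exp (- real (Suc n) * x\<^sup>2))) \<longlonglongrightarrow> 0"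
    proof (rule AE_I2)
      fix x :: real
      show "(\<lambda>n. indicat_real {0<..} x *\<^sub>R (wt w x * exp (- real (Suc n) * x\<^sup>2))) \<longlonglongrightarrow> 0"
      proof (cases "x > 0")
        case True
        hence "x\<^sup>2 > 0" by simp
        hence "(\<lambda>n. exp (- real (Suc n) * x\<^sup>2)) \<longlonglongrightarrow> 0" by real_asymp
        hence "(\<lambda>n. indicat_real {0<..} x *\<^sub>R (wt w x * exp (- real (Suc n) * x\<^sup>2))) \<longlonglongrightarrow> indicat_real {0<..} x *\<^sub>R (wt w x * 0)"
          by (intro tendsto_intros)
        thus ?thesis by simp
      qed simp
    qed
    fix n
    show "AE x in lborel. norm (indicat_real {0<..} x *\<^sub>R (wt w x * exp (- real (Suc n) * x\<^sup>2))) \<le> indicat_real {0<..} x *\<^sub>R wt w x"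
    proof (rule AE_I2)
      fix x :: real
      have "- real (Suc n) * x\<^sup>2 \<le> 0" by (intro mult_nonpos_nonneg) auto
      hence "exp (- real (Suc n) * x\<^sup>2) \<le> 1" by (simp only: exp_le_one_iff)
      thus "norm (indicat_real {0<..} x *\<^sub>R (wt w x * exp (- real (Suc n) * x\<^sup>2))) \<le> indicat_real {0<..} x *\<^sub>R wt w x"
        using wt_pos[of x w] mult_left_mono[of "exp (- real (Suc n) * x\<^sup>2)" 1 "wt w x"]
        by (cases "x > 0") (simp_all only: indicator_simps greaterThan_iff real_norm_def abs_mult, simp_all)
    qed
  qed auto
  hence "(\<lambda>n. LBINT x:{0<..}. wt w x * exp (- real (Suc n) * x\<^sup>2)) \<longlonglongrightarrow> 0"
    unfolding set_lebesgue_integral_def by simp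
  from order_tendstoD(2)[OF this e] obtain n where "(LBINT x:{0<..}. wt w x * exp (- real (Suc n) * x\<^sup>2)) < e"
    by (auto simp: eventually_sequentially)
  thus ?thesis by (intro exI[of _ "real (Suc n)"]) simp
qed

theorem theorem6p1:
  fixes \<alpha> :: real
  assumes "0 \<le> \<alpha>" and "\<alpha> < 1 / 4"
  shows "\<exists>\<theta>\<^sub>0. smooth_Sobolev \<theta>\<^sub>0 \<and> forms_finite_time_singularity \<alpha> \<theta>\<^sub>0"
proof -
  \<comment> \<open>Both exponents are midpoints of the intervals allowed to them: \<open>w\<close>
    between \<open>4 * \<alpha>\<close> and 1, and \<open>b\<close> between
    \<open>2 * \<alpha>\<close> and \<open>w / 2\<close>. The first interval is nonempty because
    \<open>\<alpha> < 1/4\<close>.\<close>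
  define w where "w = (1 + 4 * \<alpha>) / 2"
  define b where "b = (2 * \<alpha> + w / 2) / 2"
  have w: "4 * \<alpha> < w" "0 < w" "w < 1" unfolding w_def using assms by auto
  have b: "2 * \<alpha> \<le> b" "-1 \<le> b" "2 * b < w" unfolding b_def using w assms by auto
  define Cd where "Cd = frac_const \<alpha> * (2 + 1 / \<alpha>) + 2 * (frac_const \<alpha> * (commutator_const w \<alpha> * (1 + 1 / (2 * \<alpha>))))"
  define G where "G = 1 + 1 / (w/2 - b) + 1 / (w/2 - b) / w"
  have Cd0: "Cd \<ge> 0"
    unfolding Cd_def using assms w
    by (intro add_nonneg_nonneg mult_nonneg_nonneg commutator_const_nonneg frac_const_nonneg) auto
  have G1: "G \<ge> 1" unfolding G_def using b w by auto
  \<comment> \<open>Half of the coercivity constant \<open>7 / (8 * pi)\<close>: with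
    \<open>l\<^sub>0\<close> below, one half absorbs the part of the dissipation that is
    proportional to \<open>A\<close>, and the other half drives the growth. The 1 in the denominator
    of \<open>l\<^sub>0\<close> covers \<open>Cd = 0\<close>, the case
    \<open>\<alpha> = 0\<close>.\<close>
  define c where "c = 7 / (16 * pi)"
  have c0: "c > 0" unfolding c_def by simp
  define l\<^sub>0 where "l\<^sub>0 = c / (Cd * G + 1)"
  have CdG: "Cd * G \<ge> 0" using Cd0 G1 by simp
  have l0: "l\<^sub>0 > 0" unfolding l\<^sub>0_def using c0 CdG by (intro divide_pos_pos) auto
  have l0c: "Cd * G * l\<^sub>0 \<le> c"
  proof -
    have "Cd * G * l\<^sub>0 \<le> (Cd * G + 1) * l\<^sub>0" using l0 by (intro mult_right_mono) auto
    also have "\<dots> = c" unfolding l\<^sub>0_def using CdG by simp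
    finally show ?thesis .
  qed
  define E where "E = Cd * G / l\<^sub>0"
  have E0: "E \<ge> 0" unfolding E_def using CdG l0 by simp
  \<comment> \<open>If \<open>Z t \<ge> K/2\<close>, then \<open>A t\<close> will turn out to be at
    least \<open>K\<^sup>2 / (16 * G\<^sup>2)\<close>, so the driving term is at least
    \<open>k * K\<^sup>2\<close>.\<close>
  define k where "k = c / (16 * G\<^sup>2)"
  have k0: "k > 0" unfolding k_def using c0 G1 by simp
  \<comment> \<open>Large enough for the quadratic term to exceed all losses, which are at most
    linear in \<open>K\<close>, by the surplus \<open>K + 1\<close>.\<close>
  define K where "K = (E + Cd + 2) / k + 1"
  have K1: "K \<ge> 1" unfolding K_def using E0 Cd0 k0 by simp
  have Kk: "k * K\<^sup>2 - E - Cd * K \<ge> K + 1"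
  proof -
    have "k * K = E + Cd + 2 + k" unfolding K_def using k0 by (simp add: field_simps)
    hence "k * K \<ge> E + Cd + 2" using k0 by simp
    hence "(k * K) * K \<ge> (E + Cd + 2) * K" using K1 by (intro mult_right_mono) auto
    moreover have "E * K \<ge> E * 1" using E0 K1 by (intro mult_left_mono) auto
    ultimately show ?thesis using K1 by (simp add: power2_eq_square algebra_simps)
  qed
  \<comment> \<open>With 1/16 one gets \<open>Z 0 > 7/8 * K\<close>, above the threshold
    \<open>K/2\<close>.\<close>
  obtain N where N: "N > 0" "(LBINT x:{0<..}. wt w x * exp (- N * x\<^sup>2)) < 1/16"
    using concentrated_gaussian[OF w(2,3), of "1/16"] by auto
  define \<theta>\<^sub>0 where "\<theta>\<^sub>0 = (\<lambda>x. K * exp (- N * x\<^sup>2))"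
  have init: "0 \<le> \<theta>\<^sub>0 x" "\<theta>\<^sub>0 x \<le> K" "\<theta>\<^sub>0 (-x) = \<theta>\<^sub>0 x" for x
    unfolding \<theta>\<^sub>0_def using K1 N by auto
  have "\<not> global_smooth_CCF_solution \<alpha> \<theta>\<^sub>0 \<theta>" for \<theta>
  proof
    assume sol: "global_smooth_CCF_solution \<alpha> \<theta>\<^sub>0 \<theta>"
    interpret CCF_solution \<alpha> \<theta>\<^sub>0 \<theta> by unfold_locales (use sol assms in auto)
    define Z where "Z = (\<lambda>s. \<theta> s 0 - 2 * (LBINT x:{0<..}. wt w x * \<theta> s x))"
    have K0: "K > 0" using K1 by simp
    have ex: "\<exists>Z' A. (Z has_real_derivative Z') (at t) \<and> A \<ge> 0 \<and>
       (\<forall>l>0. Z' \<ge> 7 / (8 * pi) * A - Cd * (G * (l * A + 1 / l) + K)) \<and> (\<forall>l>0. Z t \<le> G * (l * A + 1 / l))" if "t \<in> {0<..<1}" for t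
      unfolding Z_def Cd_def G_def by (rule main_differential_inequality[OF w(2,3) b init K0 that])
    obtain Z' A where ZA: "\<And>t. t \<in> {0<..<1} \<Longrightarrow> (Z has_real_derivative Z' t) (at t)"
      "\<And>t l. t \<in> {0<..<1} \<Longrightarrow> l > 0 \<Longrightarrow> Z' t \<ge> 7 / (8 * pi) * A t - Cd * (G * (l * A t + 1 / l) + K)"
      "\<And>t l. t \<in> {0<..<1} \<Longrightarrow> l > 0 \<Longrightarrow> Z t \<le> G * (l * A t + 1 / l)" "\<And>t. t \<in> {0<..<1} \<Longrightarrow> A t \<ge> 0"
      using ex by metis
    have Z0: "Z 0 > K/2"
    proof -
      have "Z 0 = K - 2 * (K * (LBINT x:{0<..}. wt w x * exp (- N * x\<^sup>2)))"
        unfolding Z_def initial \<theta>\<^sub>0_def by (simp add: mult.left_commute)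
      moreover have "K * (LBINT x:{0<..}. wt w x * exp (- N * x\<^sup>2)) < K * (1/16)"
        using N K0 by (intro mult_strict_left_mono) auto
      ultimately show ?thesis using K0 by linarith
    qed
    have "Z 1 \<ge> Z 0 + (K + 1)"
    \<comment> \<open>The rate \<open>K + 1\<close> above the level \<open>K/2\<close> brings
      \<open>Z 1\<close> beyond \<open>K\<close>, whereas the maximum principle keeps it at most
      \<open>K\<close>.\<close>
    proof (rule growth_beyond_threshold[OF _ ZA(1), where b="K/2"])
      have "continuous_on {0..1} (\<lambda>s. \<theta> s 0)"
        unfolding continuous_on_iff
      proof (intro ballI allI impI)
        fix t e :: real assume t: "t \<in> {0..1}" "e > 0"
        then obtain d where d: "d > 0" "\<And>s x. s \<ge> 0 \<Longrightarrow> \<bar>s - t\<bar> < d \<Longrightarrow> \<bar>\<theta> s x - \<theta> t x\<bar> \<le> e/2"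
          using uniform_continuity[of t "e/2"] by auto
        show "\<exists>d>0. \<forall>s\<in>{0..1}. dist s t < d \<longrightarrow> dist (\<theta> s 0) (\<theta> t 0) < e"
        proof (intro exI[of _ d] conjI ballI impI d(1))
          fix s :: real assume "s \<in> {0..1}" "dist s t < d"
          hence "\<bar>\<theta> s 0 - \<theta> t 0\<bar> \<le> e/2" using d(2)[of s 0] by (simp add: dist_real_def)
          thus "dist (\<theta> s 0) (\<theta> t 0) < e" using t by (simp add: dist_real_def)
        qed
      qed
      thus "continuous_on {0..1} Z" unfolding Z_def
        by (intro continuous_intros weighted_mean_continuous w)
      fix t assume t: "t \<in> {0<..<1}" and Zt: "Z t \<ge> K/2"
      have Zp: "Z t > 0" using Zt K0 by linarith
      \<comment> \<open>With \<open>l = 2 * G / Z t\<close> the term \<open>G / l\<close> is half of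
        \<open>Z t\<close> and can be absorbed, which leaves a quadratic lower bound for
        \<open>A t\<close>.\<close>
      have "Z t \<le> G * ((2 * G / Z t) * A t + 1 / (2 * G / Z t))"
        by (rule ZA(3)[OF t]) (use G1 Zp in auto)
      also have "\<dots> = 2 * G\<^sup>2 * A t / Z t + Z t / 2" using G1 Zp by (simp add: field_simps power2_eq_square)
      finally have "Z t / 2 \<le> 2 * G\<^sup>2 * A t / Z t" by linarith
      hence "Z t * Z t \<le> 4 * (G\<^sup>2 * A t)" using Zp by (simp add: field_simps)
      moreover have "(K/2) * (K/2) \<le> Z t * Z t" using Zt K0 by (intro mult_mono) auto
      ultimately have "K\<^sup>2 \<le> 16 * (G\<^sup>2 * A t)" by (simp add: power2_eq_square)
      hence "K\<^sup>2 / (16 * G\<^sup>2) \<le> A t" using G1 by (simp add: field_simps)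
      hence "c * (K\<^sup>2 / (16 * G\<^sup>2)) \<le> c * A t" using c0 by (intro mult_left_mono) auto
      hence kA: "k * K\<^sup>2 \<le> c * A t" unfolding k_def by simp
      have "Cd * (G * (l\<^sub>0 * A t + 1 / l\<^sub>0) + K) = (Cd * G * l\<^sub>0) * A t + E + Cd * K"
        unfolding E_def by (simp add: algebra_simps)
      also have "\<dots> \<le> c * A t + E + Cd * K"
        using l0c ZA(4)[OF t] by (intro add_right_mono mult_right_mono) auto
      finally have "Cd * (G * (l\<^sub>0 * A t + 1 / l\<^sub>0) + K) \<le> c * A t + E + Cd * K" .
      moreover have "7 / (8 * pi) * A t = c * A t + c * A t" unfolding c_def by (simp add: field_simps)
      ultimately have "Z' t \<ge> c * A t - E - Cd * K" using ZA(2)[OF t l0] by linarith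
      thus "Z' t \<ge> K + 1" using kA Kk by linarith
    qed (use Z0 K0 in auto)
    moreover have "Z 1 \<le> K"
    proof -
      have one: "(1::real) \<in> {0..1}" by simp
      have "(LBINT x:{0<..}. wt w x * \<theta> 1 x) \<ge> 0"
        by (rule set_integral_nonneg') (auto intro!: mult_nonneg_nonneg less_imp_le[OF wt_pos] nonneg[OF init(1) one])
      thus ?thesis unfolding Z_def using upper_bound[OF init(2) K0 one, of 0] by linarith
    qed
    ultimately show False using Z0 K0 by linarith
  qed
  moreover have "smooth_Sobolev \<theta>\<^sub>0" unfolding \<theta>\<^sub>0_def by (rule smooth_Sobolev_gaussian[OF N(1)])
  ultimately show ?thesis unfolding forms_finite_time_singularity_def by blast
qed

end
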